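(* Let $A$, $\mathcal H$, $\mathcal H_+$, $\mathrm T=[\Gamma_0,\Gamma_1]^\top$, $J$, $Q_t$, $\mathcal A_t$ and $t_0\in[0,1]$ be as in the context, let $\lambda$ be an isolated eigenvalue of $\mathcal A_{t_0}$ of finite multiplicity $m\in\mathbb N$, and let $P_t$, $S_{t_0}$ and $U_t$ be, respectively, the Riesz projections, the reduced resolvent and the transformation operators defined in the context. For $t$ near $t_0$ let $W_t:=P_{t_0}U_t^{-1}\mathcal A_tU_tP_{t_0}$ (identified with its restriction to $\operatorname{ran}(P_{t_0})$). Then, as $t\to t_0$, $$W_t=W_{t_0}+\dot W_{t_0}(t-t_0)+\tfrac12\ddot W_{t_0}(t-t_0)^2+o((t-t_0)^2),$$ where $W_{t_0}=\lambda P_{t_0}$ and $$\dot W_{t_0}:=(\mathrm TP_{t_0})^*J\dot Q_{t_0}\mathrm TP_{t_0},$$ $$\ddot W_{t_0}:=(\mathrm TP_{t_0})^*J\ddot Q_{t_0}\mathrm TP_{t_0}-2\big(\mathrm T(\mathrm TS_{t_0})^*\dot Q_{t_0}J\mathrm TP_{t_0}\big)^*\dot Q_{t_0}J\mathrm TP_{t_0}.$$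
   Context: Inner products are linear in the first argument. $\mathcal H$, $\mathfrak H$ are complex Hilbert spaces. $A$ is a densely defined symmetric operator in $\mathcal H$ with equal (possibly infinite) deficiency indices. $\mathcal H_+:=\operatorname{dom}(A^* )$ is equipped with the graph scalar product $\langle u,v\rangle_{\mathcal H_+}=\langle u,v\rangle_{\mathcal H}+\langle A^*u,A^*v\rangle_{\mathcal H}$. Boundary triplet: $\mathrm T:=[\Gamma_0,\Gamma_1]^\top\in\mathcal B(\mathcal H_+,\mathfrak H\times\mathfrak H)$ is bounded, surjective, and satisfies $\langle A^*u,v\rangle_{\mathcal H}-\langle u,A^*v\rangle_{\mathcal H}=\langle\Gamma_1u,\Gamma_0v\rangle_{\mathfrak H}-\langle\Gamma_0u,\Gamma_1v\rangle_{\mathfrak H}$ for all $u,v\in\mathcal H_+$. Symplectic form on $\mathfrak H\times\mathfrak H$: $\omega((f_1,f_2)^\top,(g_1,g_2)^\top)=\langle f_2,g_1\rangle_{\mathfrak H}-\langle f_1,g_2\rangle_{\mathfrak H}=\langle J(f_1,f_2)^\top,(g_1,g_2)^\top\rangle_{\mathfrak H\times\mathfrak H}$, with $J=\begin{bmatrix}0&I_{\mathfrak H}\\-I_{\mathfrak H}&0\end{bmatrix}$. A subspace $\mathcal F\subset\mathfrak H\times\mathfrak H$ is Lagrangian if it equals its $\omega$-annihilator $\{f:\omega(f,g)=0\ \forall g\in\mathcal F\}$. For every Lagrangian $\mathcal F$, the restriction of $A^*$ to $\mathrm T^{-1}(\mathcal F)$ is a self-adjoint extension of $A$, and all self-adjoint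 extensions arise this way. Family: for $t\in[0,1]$, $Q_t\in\mathcal B(\mathfrak H\times\mathfrak H)$ is an orthogonal projection whose range is Lagrangian; $t_0\in[0,1]$ is fixed and, as $t\to t_0$ (in $[0,1]$), $Q_t=Q_{t_0}+\dot Q_{t_0}(t-t_0)+\frac12\ddot Q_{t_0}(t-t_0)^2+o((t-t_0)^2)$ in $\mathcal B(\mathfrak H\times\mathfrak H)$ with $\dot Q_{t_0},\ddot Q_{t_0}\in\mathcal B(\mathfrak H\times\mathfrak H)$. $\mathcal A_t$ is the self-adjoint extension of $A$ with $\mathrm T(\operatorname{dom}(\mathcal A_t))=\operatorname{ran}(Q_t)$, and $R_t(\zeta):=(\mathcal A_t-\zeta)^{-1}$ for $\zeta\notin\operatorname{Spec}(\mathcal A_t)$. Spectral objects: $\gamma:=\{z\in\mathbb C:2|z-\lambda|=\operatorname{dist}(\lambda,\operatorname{Spec}(\mathcal A_{t_0})\setminus\{\lambda\})\}$, oriented counterclockwise. For $t$ sufficiently close to $t_0$, $\gamma\cap\operatorname{Spec}(\mathcal A_t)=\emptyset$ and $\gamma$ encloses $m$ eigenvalues (counted with multiplicity) of $\mathcal A_t$, the $\lambda$-group; $P_t:=\frac{-1}{2\pi\mathbf i}\int_\gamma R_t(\zeta)\,d\zeta$ is the Riesz projection. The reduced resolvent is $S_{t_0}:=\frac{-1}{2\pi\mathbf i}\int_\gamma(\lambda-\zeta)^{-1}R_{t_0}(\zeta)\,d\zeta=\lim_{\zeta\to\lambda}R_{t_0}(\zeta)(I_{\mathcal H}-P_{t_0})$.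 Transformation operators: with $D_t:=P_t-P_{t_0}$ (which tends to $0$ in norm as $t\to t_0$, so $I-D_t^2$ is invertible for $t$ near $t_0$), $U_t:=(I-D_t^2)^{-1/2}\big((I-P_t)(I-P_{t_0})+P_tP_{t_0}\big)$, with inverse $U_t^{-1}=\big((I-P_{t_0})(I-P_t)+P_{t_0}P_t\big)(I-D_t^2)^{-1/2}$. One has $U_tP_{t_0}=P_tU_t$, and $U_t$ maps $\operatorname{ran}(P_{t_0})$ unitarily onto $\operatorname{ran}(P_t)$. The operators $P_{t_0},S_{t_0}$ belong to $\mathcal B(\mathcal H,\mathcal H_+)$, so $\mathrm TP_{t_0},\mathrm TS_{t_0}\in\mathcal B(\mathcal H,\mathfrak H\times\mathfrak H)$, and $(\cdot)^*$ denotes the adjoint of such operators, an element of $\mathcal B(\mathfrak H\times\mathfrak H,\mathcal H)$. The operator $(\mathrm TS_{t_0})^*\dot Q_{t_0}J\mathrm TP_{t_0}$ maps $\mathcal H$ boundedly into $\mathcal H_+$, so $\mathrm T(\mathrm TS_{t_0})^*\dot Q_{t_0}J\mathrm TP_{t_0}\in\mathcal B(\mathcal H,\mathfrak H\times\mathfrak H)$ and its adjoint is well defined. *)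

theory Defs
  imports
    "HOL-Complex_Analysis.Complex_Analysis"
    "HOL-Library.Equipollence"
    "HOL-Library.Landau_Symbols"
begin

section \<open>Complex Hilbert spaces\<close>

class scaleC =
  fixes scaleC :: "complex \<Rightarrow> 'a \<Rightarrow> 'a" (infixr "*\<^sub>C" 75)

text \<open>The inner product is linear in its first argument.\<close>

class complex_inner = real_normed_vector + scaleC +
  fixes cinner :: "'a \<Rightarrow> 'a \<Rightarrow> complex"
  assumes scaleR_scaleC: "r *\<^sub>R x = complex_of_real r *\<^sub>C x"
    and scaleC_add_right: "a *\<^sub>C (x + y) = a *\<^sub>C x + a *\<^sub>C y"
    and scaleC_add_left: "(a + b) *\<^sub>C x = a *\<^sub>C x + b *\<^sub>C x"
    and scaleC_scaleC: "a *\<^sub>C b *\<^sub>C x = (a * b) *\<^sub>C x"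
    and cinner_add_left: "cinner (x + y) z = cinner x z + cinner y z"
    and cinner_scaleC_left: "cinner (a *\<^sub>C x) y = a * cinner x y"
    and cinner_commute: "cinner x y = cnj (cinner y x)"
    and cinner_self: "cinner x x = complex_of_real ((norm x)\<^sup>2)"

class complex_hilbert = complex_inner + banach

lemma scaleC_one: "1 *\<^sub>C x = (x :: 'a :: complex_inner)"
  using scaleR_scaleC[of 1 x] by simp

global_interpretation complex_vector: vector_space "scaleC :: complex \<Rightarrow> 'a \<Rightarrow> 'a :: complex_inner"
  by unfold_locales (simp_all add: scaleC_add_right scaleC_add_left scaleC_scaleC scaleC_one)

abbreviation clinear :: "('a :: complex_inner \<Rightarrow> 'b :: complex_inner) \<Rightarrow> bool" where
  "clinear \<equiv> Vector_Spaces.linear scaleC scaleC"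

lemma cinner_scaleC_right: "cinner x (a *\<^sub>C y) = cnj a * cinner (x :: 'a :: complex_inner) y"
  by (metis cinner_commute cinner_scaleC_left complex_cnj_mult)

lemma norm_scaleC: "norm (a *\<^sub>C x) = cmod a * norm (x :: 'a :: complex_inner)"
proof -
  have "complex_of_real ((norm (a *\<^sub>C x))\<^sup>2) = complex_of_real ((cmod a * norm x)\<^sup>2)"
    unfolding cinner_self[symmetric] cinner_scaleC_left cinner_scaleC_right
    by (simp add: cinner_self power_mult_distrib complex_norm_square[symmetric] mult_ac)
  then have "(norm (a *\<^sub>C x))\<^sup>2 = (cmod a * norm x)\<^sup>2"
    using of_real_eq_iff by blast
  then show ?thesis
    by (simp add: power2_eq_iff_nonneg)
qed

lemma bounded_linear_scaleC: "bounded_linear (\<lambda>x. a *\<^sub>C (x :: 'a :: complex_inner))"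
proof (rule bounded_linear_intro[of _ "cmod a"])
  fix r and x :: 'a
  show "a *\<^sub>C r *\<^sub>R x = r *\<^sub>R a *\<^sub>C x"
    by (simp add: scaleR_scaleC scaleC_scaleC mult.commute)
qed (simp_all add: scaleC_add_right norm_scaleC mult.commute)

instantiation prod :: (complex_inner, complex_inner) complex_inner
begin

definition scaleC_prod :: "complex \<Rightarrow> 'a \<times> 'b \<Rightarrow> 'a \<times> 'b" where
  "scaleC_prod a x = (a *\<^sub>C fst x, a *\<^sub>C snd x)"

definition cinner_prod :: "'a \<times> 'b \<Rightarrow> 'a \<times> 'b \<Rightarrow> complex" where
  "cinner_prod x y = cinner (fst x) (fst y) + cinner (snd x) (snd y)"

instance
proof
  fix x y :: "'a \<times> 'b"
  show "cinner x y = cnj (cinner y x)"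
    unfolding cinner_prod_def by (metis cinner_commute complex_cnj_add)
qed (simp_all add: scaleC_prod_def cinner_prod_def prod_eq_iff scaleR_scaleC scaleC_add_right
      scaleC_add_left scaleC_scaleC cinner_add_left cinner_scaleC_left cinner_self norm_prod_def
      algebra_simps flip: of_real_add of_real_power)

end

instance prod :: (complex_hilbert, complex_hilbert) complex_hilbert ..

text \<open>
  Bounded operators are elements of the library's type of bounded real-linear maps (with operator
  norm); complex linearity is required separately where it is not automatic.
\<close>

instantiation blinfun :: (real_normed_vector, complex_inner) scaleC
begin

lift_definition scaleC_blinfun :: "complex \<Rightarrow> 'a \<Rightarrow>\<^sub>L 'b \<Rightarrow> 'a \<Rightarrow>\<^sub>L 'b" is "\<lambda>a f x. a *\<^sub>C f x"
  by (rule bounded_linear_compose[OF bounded_linear_scaleC])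

instance ..

end

definition cadjoint :: "'a :: complex_inner \<Rightarrow>\<^sub>L 'b :: complex_inner \<Rightarrow> 'b \<Rightarrow>\<^sub>L 'a" where
  "cadjoint F = (THE G. \<forall>x y. cinner (blinfun_apply F x) y = cinner x (blinfun_apply G y))"

definition orthogonal_projection :: "'a :: complex_inner \<Rightarrow>\<^sub>L 'a \<Rightarrow> bool" where
  "orthogonal_projection P \<longleftrightarrow>
     clinear (blinfun_apply P) \<and> P o\<^sub>L P = P \<and>
     (\<forall>x y. cinner (blinfun_apply P x) y = cinner x (blinfun_apply P y))"

definition hilbert_basis :: "'a :: complex_inner set \<Rightarrow> 'a set \<Rightarrow> bool" where
  "hilbert_basis B V \<longleftrightarrow>
     B \<subseteq> V \<and> (\<forall>b\<in>B. norm b = 1) \<and> pairwise (\<lambda>x y. cinner x y = 0) B \<and>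
     (\<forall>v\<in>V. (\<forall>b\<in>B. cinner v b = 0) \<longrightarrow> v = 0)"


section \<open>Unbounded operators\<close>

text \<open>An operator is identified with its graph; thus \<^term>\<open>Domain A\<close> is its domain, and extension
  of operators is inclusion of graphs.\<close>

type_synonym 'a operator = "('a \<times> 'a) set"

definition linear_operator :: "'a :: complex_inner operator \<Rightarrow> bool" where
  "linear_operator A \<longleftrightarrow> complex_vector.subspace A \<and> single_valued A"

definition op_apply :: "'a operator \<Rightarrow> 'a \<Rightarrow> 'a" where
  "op_apply A u = (THE v. (u, v) \<in> A)"

definition densely_defined :: "'a :: complex_inner operator \<Rightarrow> bool" where
  "densely_defined A \<longleftrightarrow> closure (Domain A) = UNIV"

definition symmetric_operator :: "'a :: complex_inner operator \<Rightarrow> bool" where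
  "symmetric_operator A \<longleftrightarrow> (\<forall>(u, x)\<in>A. \<forall>(v, y)\<in>A. cinner x v = cinner u y)"

definition op_adjoint :: "'a :: complex_inner operator \<Rightarrow> 'a operator" where
  "op_adjoint A = {(v, w). \<forall>(u, x)\<in>A. cinner x v = cinner u w}"

definition self_adjoint :: "'a :: complex_inner operator \<Rightarrow> bool" where
  "self_adjoint A \<longleftrightarrow> linear_operator A \<and> densely_defined A \<and> op_adjoint A = A"

definition eigenspace :: "'a :: complex_inner operator \<Rightarrow> complex \<Rightarrow> 'a set" where
  "eigenspace A \<zeta> = {u. (u, \<zeta> *\<^sub>C u) \<in> A}"

text \<open>The deficiency indices are the (possibly infinite) Hilbert space dimensions of
  \<open>ker (A* - i)\<close> and \<open>ker (A* + i)\<close>; they are compared as cardinals.\<close>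

definition equal_deficiency_indices :: "'a :: complex_inner operator \<Rightarrow> bool" where
  "equal_deficiency_indices A \<longleftrightarrow>
     (\<exists>B C. hilbert_basis B (eigenspace (op_adjoint A) \<i>) \<and>
            hilbert_basis C (eigenspace (op_adjoint A) (- \<i>)) \<and> B \<approx> C)"

definition is_resolvent :: "'a :: complex_inner operator \<Rightarrow> complex \<Rightarrow> 'a \<Rightarrow>\<^sub>L 'a \<Rightarrow> bool" where
  "is_resolvent A \<zeta> R \<longleftrightarrow> {(u, v - \<zeta> *\<^sub>C u) | u v. (u, v) \<in> A}\<inverse> = {(f, blinfun_apply R f) | f. True}"

definition spectrum :: "'a :: complex_inner operator \<Rightarrow> complex set" where
  "spectrum A = {\<zeta>. \<nexists>R. is_resolvent A \<zeta> R}"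

definition resolvent :: "'a :: complex_inner operator \<Rightarrow> complex \<Rightarrow> 'a \<Rightarrow>\<^sub>L 'a" where
  "resolvent A \<zeta> = (THE R. is_resolvent A \<zeta> R)"


section \<open>Boundary triplets\<close>

definition graph_cinner :: "'a :: complex_inner operator \<Rightarrow> 'a \<Rightarrow> 'a \<Rightarrow> complex" where
  "graph_cinner A u v = cinner u v + cinner (op_apply A u) (op_apply A v)"

definition graph_norm :: "'a :: complex_inner operator \<Rightarrow> 'a \<Rightarrow> real" where
  "graph_norm A u = sqrt (Re (graph_cinner A u u))"

text \<open>The trace map \<open>T\<close> is only meaningful on the domain of \<open>A*\<close>; its values elsewhere
  are unconstrained.\<close>

definition boundary_triplet ::
  "'a :: complex_hilbert operator \<Rightarrow> ('a \<Rightarrow> 'b :: complex_hilbert) \<Rightarrow> ('a \<Rightarrow> 'b) \<Rightarrow> bool" where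
  "boundary_triplet A \<Gamma>0 \<Gamma>1 \<longleftrightarrow>
    (let D = Domain (op_adjoint A); Aadj = op_apply (op_adjoint A); T = (\<lambda>u. (\<Gamma>0 u, \<Gamma>1 u)) in
      (\<forall>u\<in>D. \<forall>v\<in>D. T (u + v) = T u + T v) \<and>
      (\<forall>a. \<forall>u\<in>D. T (a *\<^sub>C u) = a *\<^sub>C T u) \<and>
      (\<exists>K. \<forall>u\<in>D. norm (T u) \<le> K * graph_norm (op_adjoint A) u) \<and>
      T ` D = UNIV \<and>
      (\<forall>u\<in>D. \<forall>v\<in>D. cinner (Aadj u) v - cinner u (Aadj v) =
                     cinner (\<Gamma>1 u) (\<Gamma>0 v) - cinner (\<Gamma>0 u) (\<Gamma>1 v)))"

definition symplectic_form :: "'b :: complex_inner \<times> 'b \<Rightarrow> 'b \<times> 'b \<Rightarrow> complex" where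
  "symplectic_form f g = cinner (snd f) (fst g) - cinner (fst f) (snd g)"

lift_definition symplectic_J :: "('b :: complex_inner \<times> 'b) \<Rightarrow>\<^sub>L ('b \<times> 'b)" is
  "\<lambda>f. (snd f, - fst f)"
  by (intro bounded_linear_Pair bounded_linear_minus bounded_linear_fst bounded_linear_snd)

lemma symplectic_form_J: "symplectic_form f g = cinner (blinfun_apply symplectic_J f) g"
proof -
  have "cinner (- x) y = - cinner x y" for x y :: 'a
    using cinner_add_left[of x "- x" y] cinner_add_left[of 0 0 y]
    by (simp add: eq_neg_iff_add_eq_0 add.commute)
  then show ?thesis
    by (simp add: symplectic_form_def cinner_prod_def symplectic_J.rep_eq)
qed

definition lagrangian :: "('b :: complex_inner \<times> 'b) set \<Rightarrow> bool" where
  "lagrangian F \<longleftrightarrow> complex_vector.subspace F \<and> F = {f. \<forall>g\<in>F. symplectic_form f g = 0}"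

text \<open>The product of a map \<open>T\<close> defined on \<open>H\<^sub>+\<close> with an operator in \<open>B(K, H\<^sub>+)\<close>.\<close>

definition trace_comp :: "('a \<Rightarrow> 'c) \<Rightarrow> 'k :: real_normed_vector \<Rightarrow>\<^sub>L 'a :: real_normed_vector \<Rightarrow>
    'k \<Rightarrow>\<^sub>L 'c :: real_normed_vector" where
  "trace_comp T X = Blinfun (\<lambda>x. T (blinfun_apply X x))"


section \<open>Riesz projections and transformation operators\<close>

text \<open>The analogue of \<open>contour_integral\<close> for operator-valued integrands.\<close>

definition op_contour_integral ::
  "(real \<Rightarrow> complex) \<Rightarrow> (complex \<Rightarrow> 'a :: complex_hilbert \<Rightarrow>\<^sub>L 'a) \<Rightarrow> 'a \<Rightarrow>\<^sub>L 'a" where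
  "op_contour_integral g F =
     integral {0..1} (\<lambda>s. vector_derivative g (at s within {0..1}) *\<^sub>C F (g s))"

text \<open>If \<open>lam\<close> is the only point of the spectrum, its distance to the rest of the spectrum is
  infinite, and any circle around it may be used.\<close>

definition spectral_circle :: "'a :: complex_inner operator \<Rightarrow> complex \<Rightarrow> real \<Rightarrow> complex" where
  "spectral_circle A lam = circlepath lam
     (if spectrum A - {lam} = {} then 1 else infdist lam (spectrum A - {lam}) / 2)"

definition riesz_projection :: "(real \<Rightarrow> complex) \<Rightarrow> 'a :: complex_hilbert operator \<Rightarrow> 'a \<Rightarrow>\<^sub>L 'a" where
  "riesz_projection g A = (- 1 / (2 * pi * \<i>)) *\<^sub>C op_contour_integral g (resolvent A)"

definition reduced_resolvent ::
  "(real \<Rightarrow> complex) \<Rightarrow> 'a :: complex_hilbert operator \<Rightarrow> complex \<Rightarrow> 'a \<Rightarrow>\<^sub>L 'a" where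
  "reduced_resolvent g A lam =
     (- 1 / (2 * pi * \<i>)) *\<^sub>C op_contour_integral g (\<lambda>\<zeta>. inverse (lam - \<zeta>) *\<^sub>C resolvent A \<zeta>)"

primrec op_power :: "'a :: real_normed_vector \<Rightarrow>\<^sub>L 'a \<Rightarrow> nat \<Rightarrow> 'a \<Rightarrow>\<^sub>L 'a" where
  "op_power X 0 = id_blinfun"
| "op_power X (Suc n) = X o\<^sub>L op_power X n"

text \<open>\<open>(I - X)\<^sup>-\<^sup>1\<^sup>/\<^sup>2\<close>, given by the binomial series, for operators \<open>X\<close> of norm less than 1.\<close>

definition inv_sqrt_one_minus :: "'a :: real_normed_vector \<Rightarrow>\<^sub>L 'a \<Rightarrow> 'a \<Rightarrow>\<^sub>L 'a" where
  "inv_sqrt_one_minus X = (\<Sum>n. (((- 1 / 2) :: real) gchoose n) *\<^sub>R op_power (- X) n)"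

definition transformation_operator ::
  "'a :: real_normed_vector \<Rightarrow>\<^sub>L 'a \<Rightarrow> 'a \<Rightarrow>\<^sub>L 'a \<Rightarrow> 'a \<Rightarrow>\<^sub>L 'a" where
  "transformation_operator P0 P =
     inv_sqrt_one_minus ((P - P0) o\<^sub>L (P - P0)) o\<^sub>L
       (((id_blinfun - P) o\<^sub>L (id_blinfun - P0)) + (P o\<^sub>L P0))"

definition op_inverse :: "'a :: real_normed_vector \<Rightarrow>\<^sub>L 'a \<Rightarrow> 'a \<Rightarrow>\<^sub>L 'a" where
  "op_inverse U = (THE V. U o\<^sub>L V = id_blinfun \<and> V o\<^sub>L U = id_blinfun)"

end

theory Submission
  imports Defs
begin

text \<open>
  Write \<open>P\<close>, \<open>S\<close> for the Riesz projection and the reduced resolvent of the unperturbed extension,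
  \<open>P\<^sub>t\<close>, \<open>S\<^sub>t\<close> for the integrals of \<open>R\<^sub>t(\<zeta>)\<close> and \<open>(lam - \<zeta>)\<^sup>-\<^sup>1 R\<^sub>t(\<zeta>)\<close> over the same circle, and
  \<open>N\<^sub>t = (A\<^sub>t - lam) P\<^sub>t\<close>.  Then \<open>(A\<^sub>t - lam) S\<^sub>t = I - P\<^sub>t\<close>, and \<open>N = 0\<close> at \<open>t\<^sub>0\<close>, because an
  isolated point of the spectrum of a self-adjoint operator is a simple pole of the resolvent
  (\<open>eigennilpotent_eq_0\<close>).  Put \<open>\<Delta> = Q\<^sub>t - Q\<close> and \<open>\<tau> = t - t\<^sub>0\<close>.

  The algebraic core is Green's identity.  On two self-adjoint extensions the boundary form sees only
  \<open>\<Delta>\<close>, since it vanishes on either Lagrangian range (\<open>Green_extensions\<close>).  Applied to a vector of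
  \<open>ran P\<close> and one of \<open>ran S\<^sub>t\<close> or \<open>ran P\<^sub>t\<close>, it gives exact formulas without any expansion:
  \<open>(P\<^sub>t - P) P = (T S\<^sub>t)* \<Delta> J T P\<close>, \<open>N\<^sub>t P = - (T P\<^sub>t)* \<Delta> J T P\<close> and
  \<open>P N\<^sub>t P = - (T P\<^sub>t P)* \<Delta> J T P\<close>.

  All perturbed objects differ from the unperturbed ones by \<open>O(\<tau>)\<close>: Green's identity also bounds
  \<open>A\<^sub>t - \<zeta>\<close> from below and \<open>R\<^sub>t(\<zeta>) - R(\<zeta>)\<close> from above, uniformly near the circle, in terms of
  \<open>norm \<Delta>\<close> (\<open>annulus_resolvent_perturbation\<close>).  In the transformed operator \<open>P U\<^sub>t\<^sup>-\<^sup>1 A\<^sub>t U\<^sub>t P\<close> the factors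
  \<open>(I - D\<^sup>2)\<^sup>-\<^sup>1\<^sup>/\<^sup>2\<close> are \<open>I + O(\<tau>\<^sup>2)\<close> and \<open>N\<^sub>t\<close> is \<open>O(\<tau>)\<close>, so up to \<open>O(\<tau>\<^sup>3)\<close> it equals \<open>lam P + P N\<^sub>t P\<close>.
  The formula for \<open>P N\<^sub>t P\<close> contains one factor \<open>\<Delta>\<close>, which is known to second order, so \<open>T P\<^sub>t P\<close> is
  needed only to first order.  By the formulas for \<open>(P\<^sub>t - P) P\<close> and \<open>N\<^sub>t P\<close>, which control this
  difference in the graph norm, the derivative of \<open>T P\<^sub>t P\<close> is \<open>T G\<close> with \<open>G = (T S)* Q' J T P\<close>, where
  \<open>Q'\<close> is the first derivative of \<open>Q\<^sub>t\<close>.  Together with \<open>\<Delta> J = - J \<Delta>\<close>, which holds because \<open>J\<close>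
  exchanges each Lagrangian range with its orthogonal complement, this is the claimed expansion.
\<close>

section \<open>Geometry of complex Hilbert spaces\<close>

lemma cinner_add_right: "cinner x (y + z) = cinner x y + cinner (x :: 'a :: complex_inner) z"
  by (metis cinner_add_left cinner_commute complex_cnj_add)

lemma cinner_zero_left [simp]: "cinner 0 (x :: 'a :: complex_inner) = 0"
  using cinner_add_left[of 0 0 x] by simp

lemma cinner_zero_right [simp]: "cinner (x :: 'a :: complex_inner) 0 = 0"
  using cinner_add_right[of x 0 0] by simp

lemma cinner_minus_left: "cinner (- x) y = - cinner x (y :: 'a :: complex_inner)"
  using cinner_add_left[of x "- x" y] by (simp add: eq_neg_iff_add_eq_0 add.commute)

lemma cinner_minus_right: "cinner x (- y) = - cinner x (y :: 'a :: complex_inner)"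
  using cinner_add_right[of x y "- y"] by (simp add: eq_neg_iff_add_eq_0 add.commute)

lemma cinner_diff_left: "cinner (x - y) z = cinner x z - cinner y (z :: 'a :: complex_inner)"
  using cinner_add_left[of x "- y" z] by (simp add: cinner_minus_left)

lemma cinner_diff_right: "cinner x (y - z) = cinner x y - cinner x (z :: 'a :: complex_inner)"
  using cinner_add_right[of x y "- z"] by (simp add: cinner_minus_right)

lemma cinner_scaleR_left: "cinner (r *\<^sub>R x) y = r *\<^sub>R cinner x (y :: 'a :: complex_inner)"
  by (simp add: scaleR_scaleC cinner_scaleC_left scaleR_conv_of_real)

lemma cinner_scaleR_right: "cinner x (r *\<^sub>R y) = r *\<^sub>R cinner x (y :: 'a :: complex_inner)"
  by (simp add: scaleR_scaleC cinner_scaleC_right scaleR_conv_of_real)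

lemmas cinner_simps = cinner_add_left cinner_add_right cinner_diff_left cinner_diff_right
  cinner_minus_left cinner_minus_right cinner_scaleC_left cinner_scaleC_right

lemma cinner_eq_zero_iff [simp]: "cinner x x = 0 \<longleftrightarrow> x = (0 :: 'a :: complex_inner)"
  by (simp add: cinner_self)

lemma cinner_ext: "(\<And>z. cinner x z = cinner y z) \<Longrightarrow> x = (y :: 'a :: complex_inner)"
  using cinner_eq_zero_iff[of "x - y"] by (simp add: cinner_simps)

lemma cinner_ext_right: "(\<And>z. cinner z x = cinner z y) \<Longrightarrow> x = (y :: 'a :: complex_inner)"
  by (rule cinner_ext) (metis cinner_commute)

lemma norm_diff_projection_sq:
  fixes x y :: "'a :: complex_inner"
  assumes "norm y = 1"
  shows "(norm (x - cinner x y *\<^sub>C y))\<^sup>2 = (norm x)\<^sup>2 - (cmod (cinner x y))\<^sup>2"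
proof -
  have y: "cinner y y = 1" using assms by (simp add: cinner_self)
  have "complex_of_real ((norm (x - cinner x y *\<^sub>C y))\<^sup>2) =
      cinner x x - cinner x y * cnj (cinner x y)"
    using y unfolding cinner_self[symmetric]
    by (simp add: cinner_simps cinner_commute[of y x])
  also have "\<dots> = complex_of_real ((norm x)\<^sup>2 - (cmod (cinner x y))\<^sup>2)"
    by (simp add: cinner_self flip: complex_norm_square)
  finally show ?thesis using of_real_eq_iff by blast
qed

lemma Cauchy_Schwarz: "cmod (cinner x y) \<le> norm x * norm (y :: 'a :: complex_inner)"
proof (cases "y = 0")
  case False
  define e where "e = complex_of_real (1 / norm y) *\<^sub>C y"
  have e: "norm e = 1" and y: "y = complex_of_real (norm y) *\<^sub>C e"
    using False by (simp_all add: e_def norm_scaleC scaleC_scaleC scaleC_one norm_divide)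
  have "(cmod (cinner x e))\<^sup>2 \<le> (norm x)\<^sup>2"
    using norm_diff_projection_sq[OF e, of x] zero_le_power2[of "norm (x - cinner x e *\<^sub>C e)"]
    by linarith
  then have "cmod (cinner x e) \<le> norm x"
    by (simp add: power2_le_iff_abs_le)
  moreover have "cmod (cinner x y) = norm y * cmod (cinner x e)"
    by (subst y) (simp add: cinner_scaleC_right norm_mult)
  ultimately show ?thesis
    using mult_left_mono[of "cmod (cinner x e)" "norm x" "norm y"] by (simp add: mult.commute)
qed simp

lemma bounded_bilinear_cinner:
  "bounded_bilinear (cinner :: 'a :: complex_inner \<Rightarrow> 'a \<Rightarrow> complex)"
  by (rule bounded_bilinear.intro)
    (auto simp: cinner_simps cinner_scaleR_left cinner_scaleR_right
      intro!: exI[of _ 1] Cauchy_Schwarz)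

lemmas continuous_on_cinner [continuous_intros] =
  bounded_bilinear.continuous_on[OF bounded_bilinear_cinner]
lemmas tendsto_cinner [tendsto_intros] = bounded_bilinear.tendsto[OF bounded_bilinear_cinner]
lemmas bounded_linear_cinner_left = bounded_bilinear.bounded_linear_left[OF bounded_bilinear_cinner]

lemma bounded_bilinear_scaleC:
  "bounded_bilinear (scaleC :: complex \<Rightarrow> 'a :: complex_inner \<Rightarrow> 'a)"
  by (rule bounded_bilinear.intro)
    (auto simp: scaleC_add_left scaleC_add_right norm_scaleC scaleR_scaleC scaleC_scaleC
      scaleR_conv_of_real mult.commute intro!: exI[of _ 1])

lemmas tendsto_scaleC [tendsto_intros] = bounded_bilinear.tendsto[OF bounded_bilinear_scaleC]

lemma norm_le_if_cinner_le:
  fixes x :: "'a :: complex_inner"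
  assumes C: "0 \<le> C" and le: "\<And>y. cmod (cinner x y) \<le> C * norm y"
  shows "norm x \<le> C"
proof (cases "x = 0")
  case False
  have "(norm x)\<^sup>2 = cmod (cinner x x)" by (simp add: cinner_self norm_power)
  also have "\<dots> \<le> C * norm x" by (rule le)
  finally show ?thesis using False by (simp add: power2_eq_square)
qed (use C in simp)

lemma parallelogram_law:
  "(norm (x + y))\<^sup>2 + (norm (x - y))\<^sup>2 = 2 * (norm x)\<^sup>2 + 2 * (norm (y :: 'a :: complex_inner))\<^sup>2"
proof -
  have "complex_of_real ((norm (x + y))\<^sup>2 + (norm (x - y))\<^sup>2) =
      complex_of_real (2 * (norm x)\<^sup>2 + 2 * (norm y)\<^sup>2)"
    unfolding of_real_add of_real_mult cinner_self[symmetric] by (simp add: cinner_simps)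
  then show ?thesis using of_real_eq_iff by blast
qed

lemma minimal_norm_orthogonal:
  fixes z :: "'a :: complex_inner"
  assumes min: "\<And>a. norm z \<le> norm (z - a *\<^sub>C y)"
  shows "cinner z y = 0"
proof (cases "y = 0")
  case False
  define e where "e = complex_of_real (1 / norm y) *\<^sub>C y"
  have e: "norm e = 1" and y: "y = complex_of_real (norm y) *\<^sub>C e"
    using False by (simp_all add: e_def norm_scaleC scaleC_scaleC scaleC_one norm_divide)
  have "norm z \<le> norm (z - cinner z e *\<^sub>C e)"
    using min[of "cinner z e * complex_of_real (1 / norm y)"] by (simp add: e_def scaleC_scaleC)
  then have "(norm z)\<^sup>2 \<le> (norm z)\<^sup>2 - (cmod (cinner z e))\<^sup>2"
    using norm_diff_projection_sq[OF e, of z] by (metis norm_ge_zero power_mono)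
  then have "cinner z e = 0" by simp
  then show ?thesis by (subst y) (simp add: cinner_scaleC_right)
qed simp

text \<open>
  A minimising sequence for the distance from a point to a closed subspace is Cauchy by the
  parallelogram law, so the distance is attained; the difference to the nearest point is orthogonal
  to the subspace.
\<close>

lemma exists_orthogonal_to_closed_subspace:
  fixes M :: "'a :: complex_hilbert set"
  assumes M: "closed M" "complex_vector.subspace M" and x: "x \<notin> M"
  shows "\<exists>z. z \<noteq> 0 \<and> (\<forall>y\<in>M. cinner z y = 0)"
proof -
  have M0: "0 \<in> M" using M(2) by (rule complex_vector.subspace_0)
  define d where "d = infdist x M"
  have d_le: "d \<le> norm (x - y)" if "y \<in> M" for y
    using infdist_le[OF that, of x] by (simp add: d_def dist_norm)
  have ex: "\<exists>y\<in>M. norm (x - y) < d + inverse (Suc n)" for n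
  proof (rule ccontr)
    assume "\<not> ?thesis"
    then have "d + inverse (Suc n) \<le> infdist x M"
      using M0 by (auto simp: infdist_def dist_norm not_less intro!: cINF_greatest)
    then show False by (simp add: d_def)
  qed
  then obtain y where y: "\<And>n. y n \<in> M" and y_d: "\<And>n. norm (x - y n) < d + inverse (Suc n)"
    by metis
  have d0: "d \<ge> 0" by (simp add: d_def infdist_nonneg)
  have close: "(norm (y m - y n))\<^sup>2 \<le> (8 * d + 4) * inverse (Suc N)" if "m \<ge> N" "n \<ge> N" for m n N
  proof -
    define e where "e = inverse (real (Suc N))"
    have e: "0 < e" "e \<le> 1" by (auto simp: e_def field_simps)
    have le: "norm (x - y k) \<le> d + e" if "k \<ge> N" for k
      using y_d[of k] that by (smt (verit) e_def le_imp_inverse_le of_nat_0_less_iff of_nat_le_iff Suc_le_mono zero_less_Suc)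
    have mid: "(1/2) *\<^sub>C (y m + y n) \<in> M"
      using M(2) y by (intro complex_vector.subspace_scale complex_vector.subspace_add)
    have half: "(1/2) *\<^sub>C (y m + y n) = (1/2) *\<^sub>R (y m + y n)"
      by (simp add: scaleR_scaleC)
    have "(x - y m) + (x - y n) = 2 *\<^sub>R (x - (1/2) *\<^sub>C (y m + y n))"
      unfolding half scaleR_right_diff_distrib by (simp add: scaleR_2)
    then have "norm ((x - y m) + (x - y n)) \<ge> 2 * d"
      using d_le[OF mid] by simp
    then have "4 * d\<^sup>2 \<le> (norm ((x - y m) + (x - y n)))\<^sup>2"
      using power_mono[of "2 * d" _ 2] d0 by (simp add: power_mult_distrib)
    moreover have "(norm (x - y m))\<^sup>2 \<le> (d + e)\<^sup>2" "(norm (x - y n))\<^sup>2 \<le> (d + e)\<^sup>2"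
      using le that by (auto intro!: power_mono)
    ultimately have "(norm ((x - y m) - (x - y n)))\<^sup>2 \<le> 4 * (d + e)\<^sup>2 - 4 * d\<^sup>2"
      using parallelogram_law[of "x - y m" "x - y n"] by linarith
    also have "\<dots> = 8 * d * e + 4 * (e * e)"
      by (simp add: power2_eq_square algebra_simps)
    also have "\<dots> \<le> 8 * d * e + 4 * e"
      using e by (simp add: mult_left_le)
    finally show ?thesis
      by (simp add: e_def norm_minus_commute algebra_simps)
  qed
  have "Cauchy y"
  proof (rule metric_CauchyI)
    fix r :: real assume r: "r > 0"
    then obtain N where N: "inverse (real (Suc N)) < r\<^sup>2 / (8 * d + 4)"
      using reals_Archimedean[of "r\<^sup>2 / (8 * d + 4)"] d0 by auto
    show "\<exists>N. \<forall>m\<ge>N. \<forall>n\<ge>N. dist (y m) (y n) < r"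
    proof (intro exI[of _ N] allI impI)
      fix m n assume "m \<ge> N" "n \<ge> N"
      from close[OF this] have "(norm (y m - y n))\<^sup>2 \<le> (8 * d + 4) * inverse (Suc N)" .
      also have "\<dots> < (8 * d + 4) * (r\<^sup>2 / (8 * d + 4))"
        using N d0 by (intro mult_strict_left_mono) auto
      also have "\<dots> = r\<^sup>2"
        using d0 by simp
      finally have "(norm (y m - y n))\<^sup>2 < r\<^sup>2" .
      then show "dist (y m) (y n) < r"
        using r by (simp add: dist_norm power_less_imp_less_base)
    qed
  qed
  then obtain p where p: "y \<longlonglongrightarrow> p"
    using Cauchy_convergent convergent_def by blast
  have pM: "p \<in> M" using M(1) y p closed_sequentially by blast
  have "(\<lambda>n. norm (x - y n)) \<longlonglongrightarrow> norm (x - p)"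
    by (intro tendsto_intros p)
  moreover have "(\<lambda>n. d + inverse (real (Suc n))) \<longlonglongrightarrow> d + 0"
    by (intro tendsto_intros LIMSEQ_inverse_real_of_nat)
  ultimately have "norm (x - p) \<le> d"
    using y_d by (intro LIMSEQ_le) (auto intro: less_imp_le)
  then have "norm (x - p) \<le> norm ((x - p) - a *\<^sub>C v)" if "v \<in> M" for a v
    using d_le[of "p + a *\<^sub>C v"] pM M(2) that
    by (simp add: complex_vector.subspace_add complex_vector.subspace_scale diff_diff_eq)
  then have "\<forall>v\<in>M. cinner (x - p) v = 0"
    by (blast intro: minimal_norm_orthogonal)
  moreover have "x - p \<noteq> 0" using pM x by auto
  ultimately show ?thesis by blast
qed

text \<open>
  For \<open>z\<close> orthogonal to the kernel of \<open>f\<close>, the vector \<open>f(z) x - f(x) z\<close> lies in the kernel; pairing it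
  with \<open>z\<close> expresses \<open>f(x)\<close> by an inner product.
\<close>

theorem Riesz_representation:
  fixes f :: "'a :: complex_hilbert \<Rightarrow> complex"
  assumes f: "bounded_linear f" and fC: "\<And>a x. f (a *\<^sub>C x) = a * f x"
  shows "\<exists>y. \<forall>x. f x = cinner x y"
proof (cases "\<forall>x. f x = 0")
  case True
  then show ?thesis by (intro exI[of _ 0]) simp
next
  case False
  interpret bounded_linear f by (rule f)
  define M where "M = {x. f x = 0}"
  have "closed M"
    unfolding M_def by (intro closed_Collect_eq linear_continuous_on f continuous_intros)
  moreover have "complex_vector.subspace M"
    by (auto simp: M_def complex_vector.subspace_def add zero fC)
  moreover obtain x where "x \<notin> M" using False by (auto simp: M_def)
  ultimately obtain z where z: "z \<noteq> 0" "\<And>y. y \<in> M \<Longrightarrow> cinner z y = 0"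
    using exists_orthogonal_to_closed_subspace by metis
  have n: "cinner z z \<noteq> 0" using z by simp
  show ?thesis
  proof (intro exI allI)
    fix x
    have "f z *\<^sub>C x - f x *\<^sub>C z \<in> M"
      by (simp add: M_def diff fC)
    then have "cinner (f z *\<^sub>C x - f x *\<^sub>C z) z = 0"
      using z(2) by (metis cinner_commute complex_cnj_zero)
    then have "f x * cinner z z = f z * cinner x z"
      by (simp add: cinner_simps)
    moreover have "cinner z z = cnj (cinner z z)" by (rule cinner_commute)
    ultimately show "f x = cinner x ((cnj (f z) / cinner z z) *\<^sub>C z)"
      using n by (simp add: cinner_scaleC_right field_simps)
  qed
qed


section \<open>Bounded operators and their adjoints\<close>

lemma scaleC_blinfun_apply [simp]: "blinfun_apply (a *\<^sub>C X) x = a *\<^sub>C blinfun_apply X x"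
  by (simp add: scaleC_blinfun.rep_eq)

lemma clinearI:
  fixes X :: "'a :: complex_inner \<Rightarrow>\<^sub>L 'b :: complex_inner"
  assumes "\<And>a x. X (a *\<^sub>C x) = a *\<^sub>C X x"
  shows "clinear (blinfun_apply X)"
  by unfold_locales (simp_all add: assms blinfun.add_right)

lemma clinear_scaleC:
  fixes X :: "'a :: complex_inner \<Rightarrow>\<^sub>L 'b :: complex_inner"
  assumes "clinear (blinfun_apply X)"
  shows "X (a *\<^sub>C x) = a *\<^sub>C X x"
proof -
  interpret Vector_Spaces.linear scaleC scaleC "blinfun_apply X" by (rule assms)
  show ?thesis by (rule scale)
qed

lemma clinear_compose:
  "clinear (blinfun_apply X) \<Longrightarrow> clinear (blinfun_apply Y) \<Longrightarrow> clinear (blinfun_apply (X o\<^sub>L Y))"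
  by (rule clinearI) (simp add: clinear_scaleC)

lemma clinear_diff:
  "clinear (blinfun_apply X) \<Longrightarrow> clinear (blinfun_apply Y) \<Longrightarrow> clinear (blinfun_apply (X - Y))"
  by (rule clinearI) (simp add: clinear_scaleC blinfun.diff_left complex_vector.scale_right_diff_distrib)

lemma clinear_symplectic_J: "clinear (blinfun_apply symplectic_J)"
  by (rule clinearI) (simp add: symplectic_J.rep_eq scaleC_prod_def)

lemma blinfun_eqI_cinner:
  fixes X Y :: "'a :: real_normed_vector \<Rightarrow>\<^sub>L 'b :: complex_inner"
  assumes "\<And>x y. cinner (X x) y = cinner (Y x) y"
  shows "X = Y"
  by (rule blinfun_eqI, rule cinner_ext, rule assms)

lemma norm_blinfun_le_if_cinner_le:
  fixes X :: "'a :: real_normed_vector \<Rightarrow>\<^sub>L 'b :: complex_inner"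
  assumes C: "0 \<le> C" and "\<And>x y. cmod (cinner (X x) y) \<le> C * norm x * norm y"
  shows "norm X \<le> C"
  using C by (intro norm_blinfun_bound norm_le_if_cinner_le assms) auto

lemma cadjoint_exists:
  fixes F :: "'a :: complex_hilbert \<Rightarrow>\<^sub>L 'b :: complex_inner"
  assumes F: "clinear (blinfun_apply F)"
  shows "\<exists>G. \<forall>x y. cinner (F x) y = cinner x (blinfun_apply G y)"
proof -
  have "\<exists>z. \<forall>x. cinner (F x) y = cinner x z" for y
  proof (rule Riesz_representation)
    show "bounded_linear (\<lambda>x. cinner (F x) y)"
      by (rule bounded_linear_compose[OF bounded_linear_cinner_left blinfun.bounded_linear_right])
  qed (simp add: clinear_scaleC[OF F] cinner_scaleC_left)
  then obtain g where g: "\<And>x y. cinner (F x) y = cinner x (g y)"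
    by metis
  have "bounded_linear g"
  proof (rule bounded_linear_intro[of _ "norm F"])
    show "g (x + y) = g x + g y" for x y
      by (rule cinner_ext_right) (simp add: cinner_simps flip: g)
    show "g (r *\<^sub>R x) = r *\<^sub>R g x" for r x
      by (rule cinner_ext_right) (simp add: cinner_scaleR_right flip: g)
    show "norm (g x) \<le> norm x * norm F" for x
    proof (rule norm_le_if_cinner_le)
      show "0 \<le> norm x * norm F" by simp
      fix y
      have "cmod (cinner (g x) y) = cmod (cinner (F y) x)"
        by (metis cinner_commute complex_mod_cnj g)
      also have "\<dots> \<le> norm (F y) * norm x" by (rule Cauchy_Schwarz)
      also have "\<dots> \<le> (norm F * norm y) * norm x"
        by (intro mult_right_mono norm_blinfun norm_ge_zero)
      finally show "cmod (cinner (g x) y) \<le> norm x * norm F * norm y" by (simp add: mult_ac)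
    qed
  qed
  then show ?thesis
    by (intro exI[of _ "Blinfun g"]) (simp add: bounded_linear_Blinfun_apply g)
qed

lemma cadjoint_eqI:
  fixes F :: "'a :: complex_inner \<Rightarrow>\<^sub>L 'b :: complex_inner"
  assumes "\<And>x y. cinner (F x) y = cinner x (blinfun_apply G y)"
  shows "cadjoint F = G"
  unfolding cadjoint_def
proof (rule the_equality)
  fix G' :: "'b \<Rightarrow>\<^sub>L 'a" assume "\<forall>x y. cinner (F x) y = cinner x (G' y)"
  then show "G' = G"
    by (intro blinfun_eqI cinner_ext_right) (simp flip: assms)
qed (use assms in blast)

lemma cinner_cadjoint:
  fixes F :: "'a :: complex_hilbert \<Rightarrow>\<^sub>L 'b :: complex_inner"
  assumes F: "clinear (blinfun_apply F)"
  shows "cinner (F x) y = cinner x (cadjoint F y)"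
    and "cinner (cadjoint F y) x = cinner y (F x)"
proof -
  obtain G where "\<And>x y. cinner (F x) y = cinner x (blinfun_apply G y)"
    using cadjoint_exists[OF F] by blast
  then show *: "cinner (F x) y = cinner x (cadjoint F y)" for x y
    using cadjoint_eqI by metis
  show "cinner (cadjoint F y) x = cinner y (F x)"
    by (metis * cinner_commute)
qed

lemma clinear_cadjoint:
  fixes F :: "'a :: complex_hilbert \<Rightarrow>\<^sub>L 'b :: complex_inner"
  assumes F: "clinear (blinfun_apply F)"
  shows "clinear (blinfun_apply (cadjoint F))"
  by (rule clinearI, rule cinner_ext) (simp add: cinner_cadjoint[OF F] cinner_simps)

lemma norm_cadjoint_le:
  fixes F :: "'a :: complex_hilbert \<Rightarrow>\<^sub>L 'b :: complex_inner"
  assumes F: "clinear (blinfun_apply F)"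
  shows "norm (cadjoint F) \<le> norm F"
proof (rule norm_blinfun_le_if_cinner_le)
  fix x y
  have "cmod (cinner (cadjoint F x) y) \<le> norm x * norm (F y)"
    by (simp add: cinner_cadjoint[OF F] Cauchy_Schwarz)
  also have "\<dots> \<le> norm x * (norm F * norm y)"
    by (intro mult_left_mono norm_blinfun norm_ge_zero)
  finally show "cmod (cinner (cadjoint F x) y) \<le> norm F * norm x * norm y" by (simp add: mult_ac)
qed simp

lemma cadjoint_diff:
  fixes F G :: "'a :: complex_hilbert \<Rightarrow>\<^sub>L 'b :: complex_inner"
  assumes "clinear (blinfun_apply F)" "clinear (blinfun_apply G)"
  shows "cadjoint (F - G) = cadjoint F - cadjoint G"
  by (rule cadjoint_eqI) (simp add: blinfun.diff_left cinner_simps cinner_cadjoint assms)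

lemma cadjoint_add:
  fixes F G :: "'a :: complex_hilbert \<Rightarrow>\<^sub>L 'b :: complex_inner"
  assumes "clinear (blinfun_apply F)" "clinear (blinfun_apply G)"
  shows "cadjoint (F + G) = cadjoint F + cadjoint G"
  by (rule cadjoint_eqI) (simp add: blinfun.add_left cinner_simps cinner_cadjoint assms)

lemma cadjoint_scaleR:
  fixes F :: "'a :: complex_hilbert \<Rightarrow>\<^sub>L 'b :: complex_inner"
  assumes "clinear (blinfun_apply F)"
  shows "cadjoint (r *\<^sub>R F) = r *\<^sub>R cadjoint F"
  by (rule cadjoint_eqI)
    (simp add: blinfun.scaleR_left cinner_scaleR_left cinner_scaleR_right cinner_cadjoint assms)

section \<open>Adjoints and resolvents of unbounded operators\<close>

lemma op_apply_eq: "single_valued A \<Longrightarrow> (u, v) \<in> A \<Longrightarrow> op_apply A u = v"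
  unfolding op_apply_def by (auto simp: single_valued_def)

lemma subspace_graph_add:
  "complex_vector.subspace A \<Longrightarrow> (u, x) \<in> A \<Longrightarrow> (v, y) \<in> A \<Longrightarrow> (u + v, x + y) \<in> A"
  using complex_vector.subspace_add[of A "(u, x)" "(v, y)"] by simp

lemma subspace_graph_diff:
  "complex_vector.subspace A \<Longrightarrow> (u, x) \<in> A \<Longrightarrow> (v, y) \<in> A \<Longrightarrow> (u - v, x - y) \<in> A"
  using complex_vector.subspace_diff[of A "(u, x)" "(v, y)"] by simp

lemma subspace_graph_scale:
  "complex_vector.subspace A \<Longrightarrow> (u, x) \<in> A \<Longrightarrow> (a *\<^sub>C u, a *\<^sub>C x) \<in> A"
  using complex_vector.subspace_scale[of A "(u, x)" a] by (simp add: scaleC_prod_def)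

lemma op_adjointD: "(v, w) \<in> op_adjoint A \<Longrightarrow> (u, x) \<in> A \<Longrightarrow> cinner x v = cinner u w"
  unfolding op_adjoint_def by auto

lemma op_adjointI: "(\<And>u x. (u, x) \<in> A \<Longrightarrow> cinner x v = cinner u w) \<Longrightarrow> (v, w) \<in> op_adjoint A"
  unfolding op_adjoint_def by auto

lemma op_adjoint_antimono: "A \<subseteq> B \<Longrightarrow> op_adjoint B \<subseteq> op_adjoint A"
  unfolding op_adjoint_def by auto

lemma subspace_op_adjoint: "complex_vector.subspace (op_adjoint A)"
  unfolding complex_vector.subspace_def
  by (auto simp: zero_prod_def scaleC_prod_def cinner_simps op_adjointD intro!: op_adjointI)

lemma closed_op_adjoint: "closed (op_adjoint A)"
proof -
  have "op_adjoint A = (\<Inter>p\<in>A. {q. cinner (snd p) (fst q) = cinner (fst p) (snd q)})"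
    by (fastforce simp: op_adjoint_def)
  also have "closed \<dots>"
    by (intro closed_INT ballI closed_Collect_eq continuous_intros)
  finally show ?thesis .
qed

lemma tendsto_op_adjoint:
  assumes F: "F \<noteq> bot" and f: "(f \<longlongrightarrow> u) F" and g: "(g \<longlongrightarrow> v) F"
    and in_A: "\<forall>\<^sub>F t in F. (f t, g t) \<in> op_adjoint A"
  shows "(u, v) \<in> op_adjoint A"
  by (rule Lim_in_closed_set[OF closed_op_adjoint in_A F tendsto_Pair[OF f g]])

lemma single_valued_op_adjoint:
  assumes "densely_defined A"
  shows "single_valued (op_adjoint A)"
proof (rule single_valuedI)
  fix v w w' assume w: "(v, w) \<in> op_adjoint A" "(v, w') \<in> op_adjoint A"
  have "closure (Domain A) \<subseteq> {u. cinner u w = cinner u w'}"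
  proof (rule closure_minimal)
    show "Domain A \<subseteq> {u. cinner u w = cinner u w'}"
      using op_adjointD[OF w(1)] op_adjointD[OF w(2)] by fastforce
    show "closed {u. cinner u w = cinner u w'}"
      by (intro closed_Collect_eq continuous_intros)
  qed
  then have "cinner u w = cinner u w'" for u
    using assms by (auto simp: densely_defined_def)
  then show "w = w'"
    by (rule cinner_ext_right)
qed

lemma self_adjoint_subspace: "self_adjoint A \<Longrightarrow> complex_vector.subspace A"
  by (simp add: self_adjoint_def linear_operator_def)

lemma self_adjoint_single_valued: "self_adjoint A \<Longrightarrow> single_valued A"
  by (simp add: self_adjoint_def linear_operator_def)

lemma self_adjointD: "self_adjoint A \<Longrightarrow> (u, x) \<in> A \<Longrightarrow> (v, y) \<in> A \<Longrightarrow> cinner x v = cinner u y"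
  using op_adjointD[of v y A u x] by (simp add: self_adjoint_def)

lemma self_adjointI:
  "self_adjoint A \<Longrightarrow> (\<And>u x. (u, x) \<in> A \<Longrightarrow> cinner x v = cinner u w) \<Longrightarrow> (v, w) \<in> A"
  using op_adjointI[of A v w] by (simp add: self_adjoint_def)

lemma self_adjoint_eigenvalue_real:
  assumes A: "self_adjoint A" and u: "(u, lam *\<^sub>C u) \<in> A" "u \<noteq> 0"
  shows "cnj lam = lam"
  using self_adjointD[OF A u(1) u(1)] u(2) by (simp add: cinner_simps)

lemma is_resolvent_iff:
  "is_resolvent A \<zeta> R \<longleftrightarrow>
    (\<forall>u v. (u, v) \<in> A \<longrightarrow> R (v - \<zeta> *\<^sub>C u) = u) \<and> (\<forall>f. (R f, f + \<zeta> *\<^sub>C R f) \<in> A)"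
  (is "?l \<longleftrightarrow> ?r")
proof
  assume l: ?l
  have eq: "(\<exists>u v. f = v - \<zeta> *\<^sub>C u \<and> w = u \<and> (u, v) \<in> A) \<longleftrightarrow> w = R f" for f w
  proof -
    have "(f, w) \<in> {(u, v - \<zeta> *\<^sub>C u) | u v. (u, v) \<in> A}\<inverse> \<longleftrightarrow>
        (f, w) \<in> {(f, blinfun_apply R f) | f. True}"
      using l unfolding is_resolvent_def by simp
    then show ?thesis by auto
  qed
  show ?r
  proof (intro conjI allI impI)
    show "R (v - \<zeta> *\<^sub>C u) = u" if "(u, v) \<in> A" for u v
      using eq[of "v - \<zeta> *\<^sub>C u" u] that by auto
    show "(R f, f + \<zeta> *\<^sub>C R f) \<in> A" for f
      using eq[of f "R f"] by (auto simp: algebra_simps)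
  qed
next
  assume r: ?r
  have "\<exists>u v. f = v - \<zeta> *\<^sub>C u \<and> R f = u \<and> (u, v) \<in> A" for f
    using r by (intro exI[of _ "R f"] exI[of _ "f + \<zeta> *\<^sub>C R f"]) auto
  then show ?l
    unfolding is_resolvent_def using r by auto
qed

lemma is_resolvent_resolvent:
  assumes "\<zeta> \<notin> spectrum A"
  shows "is_resolvent A \<zeta> (resolvent A \<zeta>)"
proof -
  obtain R where R: "is_resolvent A \<zeta> R"
    using assms by (auto simp: spectrum_def)
  have "R' = R" if "is_resolvent A \<zeta> R'" for R'
  proof (rule blinfun_eqI)
    fix f
    have "(R f, f + \<zeta> *\<^sub>C R f) \<in> A" using R by (simp add: is_resolvent_iff)
    then have "R' (f + \<zeta> *\<^sub>C R f - \<zeta> *\<^sub>C R f) = R f"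
      using that unfolding is_resolvent_iff by blast
    then show "R' f = R f" by simp
  qed
  with R show ?thesis
    unfolding resolvent_def by (metis theI)
qed

lemma resolvent_in_graph:
  "\<zeta> \<notin> spectrum A \<Longrightarrow> (resolvent A \<zeta> f, f + \<zeta> *\<^sub>C resolvent A \<zeta> f) \<in> A"
  using is_resolvent_resolvent[of \<zeta> A] by (simp add: is_resolvent_iff)

lemma resolvent_eqI:
  assumes "\<zeta> \<notin> spectrum A" "(u, v) \<in> A" "f = v - \<zeta> *\<^sub>C u"
  shows "resolvent A \<zeta> f = u"
  using is_resolvent_resolvent[OF assms(1)] assms(2,3) by (auto simp: is_resolvent_iff)

lemma clinear_resolvent:
  assumes A: "complex_vector.subspace A" and z: "\<zeta> \<notin> spectrum A"
  shows "clinear (blinfun_apply (resolvent A \<zeta>))"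
proof (rule clinearI)
  fix a x
  show "resolvent A \<zeta> (a *\<^sub>C x) = a *\<^sub>C resolvent A \<zeta> x"
    by (rule resolvent_eqI[OF z subspace_graph_scale[OF A resolvent_in_graph[OF z, of x]]])
      (simp add: scaleC_add_right scaleC_scaleC mult.commute)
qed

lemma resolvent_identity:
  assumes A: "complex_vector.subspace A" and z: "z \<notin> spectrum A" and w: "w \<notin> spectrum A"
  shows "resolvent A z - resolvent A w = (z - w) *\<^sub>C (resolvent A z o\<^sub>L resolvent A w)"
proof (rule blinfun_eqI)
  fix f
  have "resolvent A z (f - (z - w) *\<^sub>C resolvent A w f) = resolvent A w f"
    by (rule resolvent_eqI[OF z resolvent_in_graph[OF w]])
      (simp add: complex_vector.scale_left_diff_distrib)
  then show "(resolvent A z - resolvent A w) f =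
      ((z - w) *\<^sub>C (resolvent A z o\<^sub>L resolvent A w)) f"
    by (simp add: blinfun.diff_left blinfun.diff_right blinfun.add_right clinear_scaleC[OF clinear_resolvent[OF A z]]
        algebra_simps)
qed

lemma norm_scaleC_blinfun_le:
  fixes X :: "'a :: real_normed_vector \<Rightarrow>\<^sub>L 'b :: complex_inner"
  shows "norm (a *\<^sub>C X) \<le> cmod a * norm X"
  by (rule norm_blinfun_bound)
    (auto simp: norm_scaleC mult.assoc intro!: mult_left_mono norm_blinfun)

text \<open>
  The resolvent identity first bounds the resolvent near a point \<open>w\<close>, then its variation there.
\<close>

lemma continuous_on_resolvent:
  assumes A: "complex_vector.subspace A"
  shows "continuous_on (- spectrum A) (resolvent A)"
  unfolding continuous_on_iff
proof (intro ballI allI impI)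
  fix w and e :: real assume w: "w \<in> - spectrum A" and e: "e > 0"
  define C where "C = norm (resolvent A w) + 1"
  have C: "C \<ge> 1" "norm (resolvent A w) \<le> C" by (simp_all add: C_def)
  define d where "d = min (1 / (2 * C)) (e / (2 * C\<^sup>2))"
  have d: "d > 0" using C e by (simp add: d_def)
  show "\<exists>d>0. \<forall>z\<in>- spectrum A. dist z w < d \<longrightarrow> dist (resolvent A z) (resolvent A w) < e"
  proof (intro exI[of _ d] conjI d ballI impI)
    fix z assume z: "z \<in> - spectrum A" "dist z w < d"
    let ?r = "norm (resolvent A z)"
    have "norm (resolvent A z - resolvent A w) \<le> cmod (z - w) * norm (resolvent A z o\<^sub>L resolvent A w)"
      using resolvent_identity[OF A, of z w] z w by (simp add: norm_scaleC_blinfun_le)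
    also have "\<dots> \<le> cmod (z - w) * (?r * C)"
      by (intro mult_left_mono order_trans[OF norm_blinfun_compose] mult_mono) (use C in auto)
    finally have diff: "norm (resolvent A z - resolvent A w) \<le> cmod (z - w) * (?r * C)" .
    have zw: "cmod (z - w) < 1 / (2 * C)" "cmod (z - w) < e / (2 * C\<^sup>2)"
      using z(2) by (auto simp: d_def dist_norm)
    have "cmod (z - w) * (?r * C) \<le> 1 / (2 * C) * (?r * C)"
      using zw(1) C by (intro mult_right_mono) auto
    also have "\<dots> = ?r / 2" using C by simp
    finally have "norm (resolvent A z - resolvent A w) \<le> ?r / 2"
      using diff by linarith
    then have r: "?r \<le> 2 * C"
      using C norm_triangle_ineq2[of "resolvent A z" "resolvent A w"] by linarith
    have "cmod (z - w) * (?r * C) \<le> cmod (z - w) * (2 * C * C)"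
      using r C by (intro mult_left_mono mult_right_mono) auto
    also have "\<dots> < e / (2 * C\<^sup>2) * (2 * C * C)"
      using zw(2) C by (intro mult_strict_right_mono) auto
    also have "\<dots> = e" using C by (simp add: power2_eq_square)
    finally show "dist (resolvent A z) (resolvent A w) < e"
      using diff by (simp add: dist_norm)
  qed
qed

lemma holomorphic_resolvent:
  assumes A: "complex_vector.subspace A" and S: "open S" "S \<inter> spectrum A = {}"
  shows "(\<lambda>z. cinner (resolvent A z x) y) holomorphic_on S"
  unfolding holomorphic_on_open[OF S(1)]
proof (intro ballI)
  fix w assume w: "w \<in> S"
  have "(resolvent A \<longlongrightarrow> resolvent A w) (at w)"
    using continuous_on_resolvent[OF A] S w continuous_on_subset[of "- spectrum A" _ S]
    by (metis Int_commute at_within_open continuous_on_def disjoint_eq_subset_Compl)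
  then have "((\<lambda>z. cinner (resolvent A z (resolvent A w x)) y) \<longlongrightarrow>
      cinner (resolvent A w (resolvent A w x)) y) (at w)"
    by (intro tendsto_intros)
  moreover have "\<forall>\<^sub>F z in at w. cinner (resolvent A z (resolvent A w x)) y =
      (cinner (resolvent A z x) y - cinner (resolvent A w x) y) / (z - w)"
  proof -
    have "\<forall>\<^sub>F z in at w. z \<in> S - {w}"
      using S(1) w by (auto simp: eventually_at_topological)
    then show ?thesis
    proof eventually_elim
      case (elim z)
      then have "resolvent A z x - resolvent A w x = (z - w) *\<^sub>C resolvent A z (resolvent A w x)"
        using arg_cong[OF resolvent_identity[OF A, of z w], of "\<lambda>X. blinfun_apply X x"] S w
        by (auto simp: blinfun.diff_left)
      then show ?case
        using elim by (simp add: cinner_scaleC_left flip: cinner_diff_left)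
    qed
  qed
  ultimately have "((\<lambda>z. cinner (resolvent A z x) y) has_field_derivative
      cinner (resolvent A w (resolvent A w x)) y) (at w)"
    unfolding has_field_derivative_iff by (rule Lim_transform_eventually)
  then show "\<exists>f'. ((\<lambda>z. cinner (resolvent A z x) y) has_field_derivative f') (at w)"
    by blast
qed

lemma cinner_resolvent:
  assumes A: "self_adjoint A" and z: "\<zeta> \<notin> spectrum A" "cnj \<zeta> \<notin> spectrum A"
  shows "cinner (resolvent A \<zeta> x) y = cinner x (resolvent A (cnj \<zeta>) y)"
  using self_adjointD[OF A resolvent_in_graph[OF z(1), of x] resolvent_in_graph[OF z(2), of y]]
  by (simp add: cinner_simps)

text \<open>
  For \<open>u = R(\<zeta>) x\<close> the number \<open>\<langle>A u, u\<rangle>\<close> is real, so the imaginary part of \<open>\<langle>x, u\<rangle>\<close> is \<open>- Im \<zeta> \<parallel>u\<parallel>\<^sup>2\<close>.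
\<close>

lemma resolvent_norm_le:
  assumes A: "self_adjoint A" and z: "\<zeta> \<notin> spectrum A"
  shows "\<bar>Im \<zeta>\<bar> * norm (resolvent A \<zeta> x) \<le> norm x"
proof (cases "resolvent A \<zeta> x = 0")
  case False
  define u where "u = resolvent A \<zeta> x"
  have "cinner (x + \<zeta> *\<^sub>C u) u = cinner u (x + \<zeta> *\<^sub>C u)"
    unfolding u_def by (rule self_adjointD[OF A resolvent_in_graph[OF z] resolvent_in_graph[OF z]])
  then have "Im (cinner (x + \<zeta> *\<^sub>C u) u) = Im (cnj (cinner (x + \<zeta> *\<^sub>C u) u))"
    by (metis cinner_commute)
  then have "Im (cinner x u) = - Im \<zeta> * (norm u)\<^sup>2"
    by (simp add: cinner_simps cinner_self)
  then have "\<bar>Im \<zeta>\<bar> * (norm u)\<^sup>2 = \<bar>Im (cinner x u)\<bar>"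
    by (simp add: abs_mult)
  also have "\<dots> \<le> norm x * norm u"
    by (rule order_trans[OF abs_Im_le_cmod Cauchy_Schwarz])
  finally show ?thesis
    using False by (simp add: u_def power2_eq_square)
qed simp

text \<open>
  If \<open>A - \<zeta>\<close> is bounded below, its range is closed because \<open>A\<close> is; a vector orthogonal to the range
  would be an eigenvector of \<open>A* = A\<close> for the conjugate of \<open>\<zeta>\<close>, which a second lower bound excludes.
\<close>

lemma bounded_below_imp_not_spectrum:
  fixes A :: "'a :: complex_hilbert operator"
  assumes A: "self_adjoint A" and c: "c > 0"
    and below: "\<And>u v. (u, v) \<in> A \<Longrightarrow> c * norm u \<le> norm (v - \<zeta> *\<^sub>C u)"
    and below': "\<And>u v. (u, v) \<in> A \<Longrightarrow> c * norm u \<le> norm (v - cnj \<zeta> *\<^sub>C u)"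
  shows "\<zeta> \<notin> spectrum A" and "norm (resolvent A \<zeta>) \<le> 1 / c"
proof -
  note sub = self_adjoint_subspace[OF A]
  define M where "M = {v - \<zeta> *\<^sub>C u | u v. (u, v) \<in> A}"
  have subM: "complex_vector.subspace M"
    unfolding complex_vector.subspace_def
  proof (intro conjI ballI allI)
    have "(0, 0) \<in> A" using complex_vector.subspace_0[OF sub] by (simp add: zero_prod_def)
    then have "0 - \<zeta> *\<^sub>C 0 \<in> M" unfolding M_def by blast
    then show "0 \<in> M" by simp
    fix f g assume "f \<in> M" "g \<in> M"
    then obtain u v u' v' where uv: "(u, v) \<in> A" "(u', v') \<in> A"
      and fg: "f = v - \<zeta> *\<^sub>C u" "g = v' - \<zeta> *\<^sub>C u'"
      unfolding M_def by blast
    have "f + g = (v + v') - \<zeta> *\<^sub>C (u + u')"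
      by (simp add: fg scaleC_add_right)
    then show "f + g \<in> M"
      unfolding M_def using subspace_graph_add[OF sub uv] by blast
  next
    fix a f assume "f \<in> M"
    then obtain u v where uv: "(u, v) \<in> A" and f: "f = v - \<zeta> *\<^sub>C u"
      unfolding M_def by blast
    have "a *\<^sub>C f = a *\<^sub>C v - \<zeta> *\<^sub>C a *\<^sub>C u"
      by (simp add: f complex_vector.scale_right_diff_distrib scaleC_scaleC mult.commute)
    then show "a *\<^sub>C f \<in> M"
      unfolding M_def using subspace_graph_scale[OF sub uv] by blast
  qed
  have clM: "closed M"
    unfolding closed_sequential_limits
  proof (intro allI impI, elim conjE)
    fix f l assume fM: "\<forall>n. f n \<in> M" and fl: "f \<longlonglongrightarrow> l"
    then obtain u v where uv: "\<And>n. (u n, v n) \<in> A" and f: "\<And>n. f n = v n - \<zeta> *\<^sub>C u n"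
      unfolding M_def by simp metis
    have "Cauchy u"
    proof (rule metric_CauchyI)
      fix e :: real assume "e > 0"
      then obtain N where N: "\<And>m n. m \<ge> N \<Longrightarrow> n \<ge> N \<Longrightarrow> dist (f m) (f n) < c * e"
        using LIMSEQ_imp_Cauchy[OF fl] c by (metis metric_CauchyD mult_pos_pos)
      have "dist (u m) (u n) < e" if "m \<ge> N" "n \<ge> N" for m n
      proof -
        have "c * norm (u m - u n) \<le> norm ((v m - v n) - \<zeta> *\<^sub>C (u m - u n))"
          by (rule below[OF subspace_graph_diff[OF sub uv uv]])
        also have "\<dots> = dist (f m) (f n)"
          by (simp add: f dist_norm complex_vector.scale_right_diff_distrib algebra_simps)
        also have "\<dots> < c * e" by (rule N[OF that])
        finally show ?thesis using c by (simp add: dist_norm)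
      qed
      then show "\<exists>N. \<forall>m\<ge>N. \<forall>n\<ge>N. dist (u m) (u n) < e" by blast
    qed
    then obtain p where p: "u \<longlonglongrightarrow> p"
      using Cauchy_convergent[of u] unfolding convergent_def by auto
    have "(\<lambda>n. f n + \<zeta> *\<^sub>C u n) \<longlonglongrightarrow> l + \<zeta> *\<^sub>C p"
      by (intro tendsto_intros fl p)
    then have "v \<longlonglongrightarrow> l + \<zeta> *\<^sub>C p" by (simp add: f)
    then have "(p, l + \<zeta> *\<^sub>C p) \<in> op_adjoint A"
      using p uv A by (intro tendsto_op_adjoint[OF sequentially_bot]) (auto simp: self_adjoint_def)
    then have "(p, l + \<zeta> *\<^sub>C p) \<in> A" using A by (simp add: self_adjoint_def)
    then have "(l + \<zeta> *\<^sub>C p) - \<zeta> *\<^sub>C p \<in> M" unfolding M_def by blast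
    then show "l \<in> M" by simp
  qed
  have "M = UNIV"
  proof (rule ccontr)
    assume "M \<noteq> UNIV"
    then obtain z where z: "z \<noteq> 0" "\<And>y. y \<in> M \<Longrightarrow> cinner z y = 0"
      using exists_orthogonal_to_closed_subspace[OF clM subM] by blast
    have "(z, cnj \<zeta> *\<^sub>C z) \<in> A"
    proof (rule self_adjointI[OF A])
      fix u x assume "(u, x) \<in> A"
      then have "cinner z (x - \<zeta> *\<^sub>C u) = 0" by (intro z(2)) (auto simp: M_def)
      then have "cinner (x - \<zeta> *\<^sub>C u) z = 0" by (metis cinner_commute complex_cnj_zero)
      then show "cinner x z = cinner u (cnj \<zeta> *\<^sub>C z)" by (simp add: cinner_simps)
    qed
    from below'[OF this] show False using z(1) c by (simp add: mult_le_0_iff)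
  qed
  then have "\<exists>u v. (u, v) \<in> A \<and> f = v - \<zeta> *\<^sub>C u" for f
    unfolding M_def by blast
  then obtain r r' where r': "\<And>f. (r f, r' f) \<in> A" "\<And>f. f = r' f - \<zeta> *\<^sub>C r f"
    by metis
  have r'_eq: "r' f = f + \<zeta> *\<^sub>C r f" for f
    using r'(2)[of f] by (simp add: algebra_simps)
  have r: "(r f, f + \<zeta> *\<^sub>C r f) \<in> A" for f
    using r'(1)[of f] by (simp add: r'_eq)
  have r_unique: "r (v - \<zeta> *\<^sub>C u) = u" if "(u, v) \<in> A" for u v
  proof -
    have "c * norm (r (v - \<zeta> *\<^sub>C u) - u) \<le> 0"
      using below[OF subspace_graph_diff[OF sub r[of "v - \<zeta> *\<^sub>C u"] that]]
      by (simp add: complex_vector.scale_right_diff_distrib)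
    then show ?thesis using c by (simp add: mult_le_0_iff)
  qed
  have le: "norm (r f) \<le> norm f * (1 / c)" for f
    using below[OF r[of f]] c by (simp add: field_simps)
  have bl: "bounded_linear r"
  proof (rule bounded_linear_intro[of _ "1 / c"])
    show "r (x + y) = r x + r y" for x y
      using r_unique[OF subspace_graph_add[OF sub r[of x] r[of y]]]
      by (simp add: scaleC_add_right algebra_simps)
    show "r (a *\<^sub>R x) = a *\<^sub>R r x" for a x
      using r_unique[OF subspace_graph_scale[OF sub r[of x]], of "complex_of_real a"]
      by (simp add: scaleC_add_right scaleR_scaleC scaleC_scaleC mult.commute)
  qed (rule le)
  have "is_resolvent A \<zeta> (Blinfun r)"
    using r r_unique by (simp add: is_resolvent_iff bounded_linear_Blinfun_apply[OF bl])
  then show z: "\<zeta> \<notin> spectrum A" by (auto simp: spectrum_def)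
  show "norm (resolvent A \<zeta>) \<le> 1 / c"
  proof (rule norm_blinfun_bound)
    fix f show "norm (resolvent A \<zeta> f) \<le> 1 / c * norm f"
      using le[of f] resolvent_eqI[OF z r, of f] by (simp add: mult.commute)
  qed (use c in simp)
qed

section \<open>Contour integrals of resolvents\<close>

lemma bounded_bilinear_scaleC_blinfun:
  "bounded_bilinear (scaleC :: complex \<Rightarrow> ('a :: real_normed_vector \<Rightarrow>\<^sub>L 'b :: complex_inner) \<Rightarrow> _)"
proof (rule bounded_bilinear.intro)
  show "\<exists>K. \<forall>a (X :: 'a \<Rightarrow>\<^sub>L 'b). norm (a *\<^sub>C X) \<le> norm a * norm X * K"
    by (intro exI[of _ 1]) (simp add: norm_scaleC_blinfun_le)
qed (auto intro!: blinfun_eqI simp: blinfun.add_left blinfun.scaleR_left scaleC_add_left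
    scaleC_add_right scaleR_scaleC scaleC_scaleC scaleR_conv_of_real mult.commute)

lemmas continuous_on_scaleC_blinfun [continuous_intros] =
  bounded_bilinear.continuous_on[OF bounded_bilinear_scaleC_blinfun]

lemma op_contour_integrable:
  fixes F :: "complex \<Rightarrow> 'a :: complex_hilbert \<Rightarrow>\<^sub>L 'a"
  assumes "0 < r" "continuous_on (sphere c r) F"
  shows "(\<lambda>s. vector_derivative (circlepath c r) (at s within {0..1}) *\<^sub>C F (circlepath c r s))
    integrable_on {0..1}"
proof -
  have cF: "continuous_on {0..1} (\<lambda>s. F (circlepath c r s))"
    by (rule continuous_on_compose2[OF assms(2)])
       (use assms(1) in \<open>auto simp: circlepath dist_norm norm_mult intro!: continuous_intros\<close>)
  have "continuous_on {0..1}
      (\<lambda>s. (2 * pi * \<i> * r * exp (2 * of_real pi * \<i> * s)) *\<^sub>C F (circlepath c r s))"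
    by (intro continuous_intros cF)
  then show ?thesis
    by (intro integrable_continuous_interval)
       (erule continuous_on_eq, simp add: vector_derivative_circlepath01)
qed

text \<open>
  Functionals reduce operator-valued contour integrals to scalar ones, to which the theorems of Cauchy
  and Fubini apply.
\<close>

lemma op_contour_integral_functional:
  fixes h :: "('a :: complex_hilbert \<Rightarrow>\<^sub>L 'a) \<Rightarrow> complex"
  assumes r: "0 < r" and F: "continuous_on (sphere c r) F"
    and h: "bounded_linear h" and hC: "\<And>a X. h (a *\<^sub>C X) = a * h X"
  shows "h (op_contour_integral (circlepath c r) F) = contour_integral (circlepath c r) (\<lambda>\<zeta>. h (F \<zeta>))"
proof -
  have "h (op_contour_integral (circlepath c r) F) =
      integral {0..1} (h \<circ> (\<lambda>s. vector_derivative (circlepath c r) (at s within {0..1}) *\<^sub>C F (circlepath c r s)))"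
    unfolding op_contour_integral_def by (rule integral_linear[OF op_contour_integrable[OF r F] h, symmetric])
  also have "\<dots> = contour_integral (circlepath c r) (\<lambda>\<zeta>. h (F \<zeta>))"
    unfolding contour_integral_integral
    by (intro integral_cong)
       (simp add: hC vector_derivative_circlepath01 vector_derivative_circlepath mult.commute)
  finally show ?thesis .
qed

lemma op_contour_integral_diff:
  assumes "0 < r" "continuous_on (sphere c r) F" "continuous_on (sphere c r) G"
  shows "op_contour_integral (circlepath c r) F - op_contour_integral (circlepath c r) G =
    op_contour_integral (circlepath c r) (\<lambda>\<zeta>. F \<zeta> - G \<zeta>)"
  unfolding op_contour_integral_def
  using assms
  by (subst integral_diff[symmetric])
     (auto intro!: op_contour_integrable simp: bounded_bilinear.diff_right[OF bounded_bilinear_scaleC_blinfun])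

lemma norm_op_contour_integral_le:
  assumes r: "0 < r" and F: "continuous_on (sphere c r) F"
    and K: "\<And>\<zeta>. \<zeta> \<in> sphere c r \<Longrightarrow> norm (F \<zeta>) \<le> K"
  shows "norm (op_contour_integral (circlepath c r) F) \<le> 2 * pi * r * K"
proof -
  let ?f = "\<lambda>s. vector_derivative (circlepath c r) (at s within {0..1}) *\<^sub>C F (circlepath c r s)"
  have on_sphere: "circlepath c r s \<in> sphere c r" for s
    using r by (simp add: circlepath dist_norm norm_mult)
  have "norm (?f s) \<le> 2 * pi * r * K" if "s \<in> {0..1}" for s
    using that r K[OF on_sphere, of s]
    by (intro order_trans[OF norm_scaleC_blinfun_le] mult_mono)
       (auto simp: vector_derivative_circlepath01 norm_mult)
  moreover have "0 \<le> 2 * pi * r * K"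
    using r order_trans[OF norm_ge_zero K[OF on_sphere, of 0]] by simp
  ultimately have "norm (integral {0..1} ?f) \<le> 2 * pi * r * K * (1 - 0)"
    using has_integral_bound_real[of _ "{}" ?f _ 0 1] op_contour_integrable[OF r F]
    by (simp add: has_integral_integral)
  then show ?thesis
    by (simp add: op_contour_integral_def)
qed

text \<open>
  The holomorphic functional calculus for the part of the spectrum inside the path: for self-adjoint
  \<open>B\<close> the weight \<open>\<phi>\<close> yields \<open>\<phi>(B) P\<close> if \<open>\<phi>\<close> is holomorphic inside.
\<close>

definition resolvent_integral ::
  "(real \<Rightarrow> complex) \<Rightarrow> (complex \<Rightarrow> complex) \<Rightarrow> 'a :: complex_hilbert operator \<Rightarrow> 'a \<Rightarrow>\<^sub>L 'a" where
  "resolvent_integral g \<phi> B =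
     (- 1 / (2 * of_real pi * \<i>)) *\<^sub>C op_contour_integral g (\<lambda>\<zeta>. \<phi> \<zeta> *\<^sub>C resolvent B \<zeta>)"

lemma riesz_projection_eq: "riesz_projection g B = resolvent_integral g (\<lambda>_. 1) B"
proof -
  have "1 *\<^sub>C X = X" for X :: "'a \<Rightarrow>\<^sub>L 'a"
    by (rule blinfun_eqI) (simp add: scaleC_one)
  then show ?thesis
    by (simp add: riesz_projection_def resolvent_integral_def)
qed

lemma reduced_resolvent_eq:
  "reduced_resolvent g B c = resolvent_integral g (\<lambda>\<zeta>. inverse (c - \<zeta>)) B"
  by (simp add: reduced_resolvent_def resolvent_integral_def)

lemma contour_integral_inverse_circlepath:
  assumes "norm (w - c) < r"
  shows "contour_integral (circlepath c r) (\<lambda>z. 1 / (z - w)) = 2 * of_real pi * \<i>"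
  using Cauchy_integral_circlepath_simple[of "\<lambda>_. 1" c r w] assms
  by (intro contour_integral_unique) simp

lemma contour_integral_circlepath_holomorphic:
  assumes "0 < r" "f holomorphic_on ball c R" "r < R"
  shows "contour_integral (circlepath c r) f = 0"
  using assms
  by (intro contour_integral_unique Cauchy_theorem_convex_simple[of _ "ball c R"]) auto

lemma contour_integral_circlepath_annulus:
  assumes f: "f holomorphic_on {z. a < norm (z - c) \<and> norm (z - c) < b}"
    and r: "0 < r" "a < r" "r < b" "0 < r'" "a < r'" "r' < b"
  shows "contour_integral (circlepath c r) f = contour_integral (circlepath c r') f"
proof (rule Cauchy_theorem_homotopic_loops[OF _ _ f])
  have op: "open {z. norm (z - c) < b}" "open {z. a < norm (z - c)}"
    by (intro open_Collect_less continuous_intros)+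
  show "open {z. a < norm (z - c) \<and> norm (z - c) < b}"
    using open_Int[OF op] by (simp add: Int_def conj_commute)
  show "homotopic_loops {z. a < norm (z - c) \<and> norm (z - c) < b} (circlepath c r) (circlepath c r')"
  proof (rule homotopic_loops_linear)
    fix t x :: real
    show "closed_segment (circlepath c r t) (circlepath c r' t) \<subseteq> {z. a < norm (z - c) \<and> norm (z - c) < b}"
    proof
      fix z assume "z \<in> closed_segment (circlepath c r t) (circlepath c r' t)"
      then obtain u where u: "0 \<le> u" "u \<le> 1"
        and z: "z = (1 - u) *\<^sub>R circlepath c r t + u *\<^sub>R circlepath c r' t"
        by (auto simp: closed_segment_def)
      define q where "q = (1 - u) * r + u * r'"
      have "z - c = of_real q * exp (2 * of_real pi * \<i> * of_real t)"
        by (simp add: z q_def circlepath scaleR_conv_of_real algebra_simps)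
      moreover have q: "a < q" "q < b" "0 < q"
        unfolding q_def using u r convex_bound_lt[of r b r' "1 - u" u]
          convex_bound_lt[of "- r" "- a" "- r'" "1 - u" u] convex_bound_lt[of "- r" 0 "- r'" "1 - u" u]
        by simp_all
      ultimately have "norm (z - c) = q"
        by (simp add: norm_mult)
      then show "z \<in> {z. a < norm (z - c) \<and> norm (z - c) < b}" using q by simp
    qed
  qed auto
qed auto

locale circle_free_of_spectrum =
  fixes B :: "'a :: complex_hilbert operator" and c :: complex and r :: real
  assumes self_adjoint: "self_adjoint B" and r_pos: "0 < r"
    and circle_free: "\<And>\<zeta>. norm (\<zeta> - c) = r \<Longrightarrow> \<zeta> \<notin> spectrum B"
begin

abbreviation integral_op :: "(complex \<Rightarrow> complex) \<Rightarrow> 'a \<Rightarrow>\<^sub>L 'a" where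
  "integral_op \<phi> \<equiv> resolvent_integral (circlepath c r) \<phi> B"

lemmas subspace = self_adjoint_subspace[OF self_adjoint]

lemma sphere_free: "\<zeta> \<in> sphere c r \<Longrightarrow> \<zeta> \<notin> spectrum B"
  using circle_free[of \<zeta>] by (simp add: dist_norm norm_minus_commute)

lemma path_image_sphere: "path_image (circlepath c r) = sphere c r"
  using r_pos by simp

lemma continuous_on_resolvent_sphere: "continuous_on (sphere c r) (resolvent B)"
  by (rule continuous_on_subset[OF continuous_on_resolvent[OF subspace]]) (use sphere_free in auto)

lemma contour_integrable:
  "continuous_on (sphere c r) f \<Longrightarrow> f contour_integrable_on circlepath c r"
  using r_pos by (intro contour_integrable_continuous_circlepath) simp

lemma functional_integral_op:
  fixes h :: "('a \<Rightarrow>\<^sub>L 'a) \<Rightarrow> complex"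
  assumes \<phi>: "continuous_on (sphere c r) \<phi>"
    and h: "bounded_linear h" "\<And>a X. h (a *\<^sub>C X) = a * h X"
  shows "h (integral_op \<phi>) = (- 1 / (2 * of_real pi * \<i>)) *
    contour_integral (circlepath c r) (\<lambda>\<zeta>. \<phi> \<zeta> * h (resolvent B \<zeta>))"
  unfolding resolvent_integral_def h(2)
  by (subst op_contour_integral_functional[OF r_pos _ h])
     (auto intro!: continuous_intros continuous_on_resolvent_sphere \<phi> simp: h(2))

lemma cinner_integral_op:
  assumes \<phi>: "continuous_on (sphere c r) \<phi>"
  shows "cinner (integral_op \<phi> x) y = (- 1 / (2 * of_real pi * \<i>)) *
    contour_integral (circlepath c r) (\<lambda>\<zeta>. \<phi> \<zeta> * cinner (resolvent B \<zeta> x) y)"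
  by (rule functional_integral_op[OF \<phi>])
     (auto simp: cinner_scaleC_left
       intro!: bounded_linear_compose[OF bounded_linear_cinner_left] blinfun.bounded_linear_left)

lemma continuous_on_cinner_resolvent [continuous_intros]:
  "continuous_on (sphere c r) (\<lambda>\<zeta>. cinner (resolvent B \<zeta> x) y)"
  by (intro continuous_intros continuous_on_resolvent_sphere)

lemma clinear_integral_op:
  assumes \<phi>: "continuous_on (sphere c r) \<phi>"
  shows "clinear (blinfun_apply (integral_op \<phi>))"
proof (rule clinearI, rule cinner_ext)
  fix a x y
  have "contour_integral (circlepath c r) (\<lambda>\<zeta>. \<phi> \<zeta> * cinner (resolvent B \<zeta> (a *\<^sub>C x)) y) =
      contour_integral (circlepath c r) (\<lambda>\<zeta>. a * (\<phi> \<zeta> * cinner (resolvent B \<zeta> x) y))"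
    using sphere_free clinear_resolvent[OF subspace]
    by (intro contour_integral_eq) (simp add: path_image_sphere clinear_scaleC cinner_scaleC_left del: path_image_circlepath)
  also have "\<dots> = a * contour_integral (circlepath c r) (\<lambda>\<zeta>. \<phi> \<zeta> * cinner (resolvent B \<zeta> x) y)"
    by (intro contour_integral_lmul contour_integrable continuous_intros \<phi>)
  finally show "cinner (integral_op \<phi> (a *\<^sub>C x)) y = cinner (a *\<^sub>C integral_op \<phi> x) y"
    by (simp add: cinner_integral_op[OF \<phi>] cinner_scaleC_left)
qed

lemma integral_op_cong:
  assumes "continuous_on (sphere c r) \<phi>" "continuous_on (sphere c r) \<psi>"
    and "\<And>\<zeta>. norm (\<zeta> - c) = r \<Longrightarrow> \<phi> \<zeta> = \<psi> \<zeta>"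
  shows "integral_op \<phi> = integral_op \<psi>"
  by (rule blinfun_eqI_cinner, simp add: cinner_integral_op assms del: path_image_circlepath,
      intro disjI2 contour_integral_eq)
     (use assms(3) in \<open>auto simp: path_image_sphere dist_norm norm_minus_commute simp del: path_image_circlepath\<close>)

lemma integral_op_combination:
  assumes \<phi>: "continuous_on (sphere c r) \<phi>" and \<psi>: "continuous_on (sphere c r) \<psi>"
  shows "integral_op (\<lambda>\<zeta>. a * \<phi> \<zeta> + b * \<psi> \<zeta>) x = a *\<^sub>C integral_op \<phi> x + b *\<^sub>C integral_op \<psi> x"
proof (rule cinner_ext)
  fix y
  let ?R = "\<lambda>\<zeta>. cinner (resolvent B \<zeta> x) y"
  have "contour_integral (circlepath c r) (\<lambda>\<zeta>. a * (\<phi> \<zeta> * ?R \<zeta>) + b * (\<psi> \<zeta> * ?R \<zeta>)) =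
      a * contour_integral (circlepath c r) (\<lambda>\<zeta>. \<phi> \<zeta> * ?R \<zeta>) +
      b * contour_integral (circlepath c r) (\<lambda>\<zeta>. \<psi> \<zeta> * ?R \<zeta>)"
    by (subst contour_integral_add, (intro contour_integrable continuous_intros \<phi> \<psi>)+,
        subst (1 2) contour_integral_lmul, (intro contour_integrable continuous_intros \<phi> \<psi>)+, rule refl)
  then show "cinner (integral_op (\<lambda>\<zeta>. a * \<phi> \<zeta> + b * \<psi> \<zeta>) x) y =
      cinner (a *\<^sub>C integral_op \<phi> x + b *\<^sub>C integral_op \<psi> x) y"
    by (subst cinner_integral_op) (auto intro!: continuous_intros \<phi> \<psi>
        simp: cinner_integral_op \<phi> \<psi> cinner_simps algebra_simps)
qed

text \<open>
  \<open>B\<close> is moved under the integral by \<open>B = B*\<close>: it suffices to test with vectors of its domain, where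
  \<open>B R(\<zeta>) = I + \<zeta> R(\<zeta>)\<close> can be used pointwise.
\<close>

lemma integral_op_in_graph:
  assumes \<phi>: "continuous_on (sphere c r) \<phi>"
  shows "(integral_op \<phi> x, integral_op (\<lambda>\<zeta>. \<zeta> * \<phi> \<zeta>) x +
    ((- 1 / (2 * of_real pi * \<i>)) * contour_integral (circlepath c r) \<phi>) *\<^sub>C x) \<in> B"
    (is "(_, ?w) \<in> B")
proof (rule self_adjointI[OF self_adjoint])
  fix u v assume uv: "(u, v) \<in> B"
  let ?k = "- 1 / (2 * of_real pi * \<i>)" and ?int = "contour_integral (circlepath c r)"
  have "?int (\<lambda>\<zeta>. \<phi> \<zeta> * cinner (resolvent B \<zeta> x) v) =
      ?int (\<lambda>\<zeta>. \<zeta> * \<phi> \<zeta> * cinner (resolvent B \<zeta> x) u + \<phi> \<zeta> * cinner x u)"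
  proof (rule contour_integral_eq)
    fix \<zeta> assume "\<zeta> \<in> path_image (circlepath c r)"
    then have z: "\<zeta> \<notin> spectrum B" using sphere_free r_pos by simp
    have "cinner (resolvent B \<zeta> x) v = cinner x u + \<zeta> * cinner (resolvent B \<zeta> x) u"
      using self_adjointD[OF self_adjoint resolvent_in_graph[OF z, of x] uv]
      by (simp add: cinner_simps)
    then show "\<phi> \<zeta> * cinner (resolvent B \<zeta> x) v =
        \<zeta> * \<phi> \<zeta> * cinner (resolvent B \<zeta> x) u + \<phi> \<zeta> * cinner x u"
      by (simp add: algebra_simps)
  qed
  also have "\<dots> = ?int (\<lambda>\<zeta>. \<zeta> * \<phi> \<zeta> * cinner (resolvent B \<zeta> x) u) + ?int \<phi> * cinner x u"
    by (subst contour_integral_add, (intro contour_integrable continuous_intros \<phi>)+,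
        subst contour_integral_rmul, (intro contour_integrable continuous_intros \<phi>)+, rule refl)
  finally have "cinner (integral_op \<phi> x) v = cinner ?w u"
    by (subst cinner_integral_op[OF \<phi>], subst cinner_add_left, subst cinner_integral_op)
       (auto intro!: continuous_intros \<phi> simp: cinner_simps algebra_simps)
  then show "cinner v (integral_op \<phi> x) = cinner u ?w"
    by (metis cinner_commute)
qed

text \<open>
  Conjugation reverses a circle about a real point and turns \<open>R(\<zeta>)\<close> into its adjoint.
\<close>

lemma cinner_integral_op_symmetric:
  assumes \<phi>: "continuous_on (sphere c r) \<phi>" and real: "cnj c = c" "\<And>\<zeta>. cnj (\<phi> \<zeta>) = \<phi> (cnj \<zeta>)"
  shows "cinner (integral_op \<phi> x) y = cinner x (integral_op \<phi> y)"
proof -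
  let ?int = "contour_integral (circlepath c r)"
  let ?f = "\<lambda>\<zeta>. \<phi> \<zeta> * cinner (resolvent B \<zeta> x) y"
  have conj_path: "cnj \<circ> circlepath c r = reversepath (circlepath c r)"
  proof
    fix s
    (* The circle has period 1 in s, so conjugation s to - s agrees with reversal s to 1 - s. *)
    have "2 * of_real pi * \<i> * of_real (1 - s) = 2 * of_real pi * \<i> - 2 * of_real pi * \<i> * of_real s"
      by (simp add: algebra_simps)
    then have "exp (2 * of_real pi * \<i> * of_real (1 - s)) = exp (- (2 * of_real pi * \<i> * of_real s))"
      by (simp add: exp_diff exp_minus divide_inverse)
    then show "(cnj \<circ> circlepath c r) s = reversepath (circlepath c r) s"
      by (simp add: reversepath_def circlepath real(1) exp_cnj mult.commute mult.left_commute)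
  qed
  have "cnj (?int (\<lambda>\<zeta>. \<phi> \<zeta> * cinner (resolvent B \<zeta> y) x)) = cnj (?int (cnj \<circ> ?f \<circ> cnj))"
  proof (rule arg_cong[where f = cnj], rule contour_integral_eq)
    fix \<zeta> assume "\<zeta> \<in> path_image (circlepath c r)"
    then have n: "norm (\<zeta> - c) = r" using r_pos by (simp add: dist_norm norm_minus_commute)
    have "norm (cnj \<zeta> - c) = r"
      using n by (metis complex_cnj_diff complex_mod_cnj real(1))
    then have z: "\<zeta> \<notin> spectrum B" "cnj \<zeta> \<notin> spectrum B"
      using n circle_free by blast+
    have "cinner (resolvent B \<zeta> y) x = cnj (cinner (resolvent B (cnj \<zeta>) x) y)"
      using cinner_resolvent[OF self_adjoint z, of y x] by (metis cinner_commute)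
    then show "\<phi> \<zeta> * cinner (resolvent B \<zeta> y) x = (cnj \<circ> ?f \<circ> cnj) \<zeta>"
      by (simp add: real(2))
  qed
  also have "\<dots> = contour_integral (cnj \<circ> circlepath c r) ?f"
    by (rule contour_integral_cnj[symmetric]) simp
  also have "\<dots> = - ?int ?f"
    unfolding conj_path by (rule contour_integral_reversepath) simp
  finally have "cnj (cinner (integral_op \<phi> y) x) = cinner (integral_op \<phi> x) y"
    by (simp add: cinner_integral_op[OF \<phi>])
  then show ?thesis by (metis cinner_commute)
qed

end

context circle_free_of_spectrum
begin

definition riesz_proj :: "'a \<Rightarrow>\<^sub>L 'a" where "riesz_proj = integral_op (\<lambda>_. 1)"
text \<open>The operator \<open>(B - c) P\<close>, named after the eigennilpotents of perturbation theory.\<close>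

definition eigennilpotent :: "'a \<Rightarrow>\<^sub>L 'a" where "eigennilpotent = integral_op (\<lambda>\<zeta>. \<zeta> - c)"
definition reduced_res :: "'a \<Rightarrow>\<^sub>L 'a" where "reduced_res = integral_op (\<lambda>\<zeta>. inverse (c - \<zeta>))"

lemma continuous_on_weights:
  "continuous_on (sphere c r) (\<lambda>_. 1 :: complex)"
  "continuous_on (sphere c r) (\<lambda>\<zeta>. \<zeta> - c)"
  "continuous_on (sphere c r) (\<lambda>\<zeta>. inverse (c - \<zeta>))"
  using r_pos by (auto intro!: continuous_intros)

lemma clinear_riesz_proj: "clinear (blinfun_apply riesz_proj)"
  and clinear_eigennilpotent: "clinear (blinfun_apply eigennilpotent)"
  and clinear_reduced_res: "clinear (blinfun_apply reduced_res)"
  unfolding riesz_proj_def eigennilpotent_def reduced_res_def by (intro clinear_integral_op continuous_on_weights)+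

lemma riesz_proj_symmetric: "cnj c = c \<Longrightarrow> cinner (riesz_proj x) y = cinner x (riesz_proj y)"
  unfolding riesz_proj_def by (rule cinner_integral_op_symmetric) auto

lemma eigennilpotent_symmetric: "cnj c = c \<Longrightarrow> cinner (eigennilpotent x) y = cinner x (eigennilpotent y)"
  unfolding eigennilpotent_def by (rule cinner_integral_op_symmetric) (auto intro!: continuous_intros)

lemma riesz_proj_in_graph: "(riesz_proj x, c *\<^sub>C riesz_proj x + eigennilpotent x) \<in> B"
proof -
  have "contour_integral (circlepath c r) (\<lambda>_. 1) = 0"
    by (rule contour_integral_circlepath_holomorphic[of r _ c "r + 1"]) (use r_pos in auto)
  then have "(riesz_proj x, integral_op (\<lambda>\<zeta>. \<zeta> * 1) x) \<in> B"
    using integral_op_in_graph[OF continuous_on_weights(1), of x] by (simp add: riesz_proj_def)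
  also have "integral_op (\<lambda>\<zeta>. \<zeta> * 1) x = integral_op (\<lambda>\<zeta>. c * 1 + 1 * (\<zeta> - c)) x"
    by (rule arg_cong[where f = "\<lambda>X. blinfun_apply X x"], rule integral_op_cong)
       (auto intro!: continuous_intros)
  also have "\<dots> = c *\<^sub>C riesz_proj x + eigennilpotent x"
    by (subst integral_op_combination[OF continuous_on_weights(1,2)])
       (simp add: riesz_proj_def eigennilpotent_def scaleC_one)
  finally show ?thesis .
qed

lemma reduced_res_in_graph: "(reduced_res x, c *\<^sub>C reduced_res x + x - riesz_proj x) \<in> B"
proof -
  have nz: "c - \<zeta> \<noteq> 0" if "norm (\<zeta> - c) = r" for \<zeta> using that r_pos by auto
  have "contour_integral (circlepath c r) (\<lambda>\<zeta>. inverse (c - \<zeta>)) =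
      contour_integral (circlepath c r) (\<lambda>\<zeta>. - 1 * (1 / (\<zeta> - c)))"
    by (rule contour_integral_eq) (simp add: divide_inverse flip: inverse_minus_eq)
  also have "\<dots> = - 1 * contour_integral (circlepath c r) (\<lambda>\<zeta>. 1 / (\<zeta> - c))"
    by (rule contour_integral_lmul) (use r_pos in \<open>auto intro!: contour_integrable continuous_intros\<close>)
  also have "\<dots> = - (2 * of_real pi * \<i>)"
    using r_pos by (simp add: contour_integral_inverse_circlepath)
  finally have "(reduced_res x, integral_op (\<lambda>\<zeta>. \<zeta> * inverse (c - \<zeta>)) x + x) \<in> B"
    using integral_op_in_graph[OF continuous_on_weights(3), of x]
    by (simp add: reduced_res_def scaleC_one)
  also have "integral_op (\<lambda>\<zeta>. \<zeta> * inverse (c - \<zeta>)) x = integral_op (\<lambda>\<zeta>. c * inverse (c - \<zeta>) + (- 1) * 1) x"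
  proof (rule arg_cong[where f = "\<lambda>X. blinfun_apply X x"], rule integral_op_cong)
    fix \<zeta> assume "norm (\<zeta> - c) = r"
    from nz[OF this] show "\<zeta> * inverse (c - \<zeta>) = c * inverse (c - \<zeta>) + (- 1) * 1"
      by (simp add: field_simps)
  qed (use r_pos in \<open>auto intro!: continuous_intros\<close>)
  also have "\<dots> = c *\<^sub>C reduced_res x + (- 1) *\<^sub>C riesz_proj x"
    by (subst integral_op_combination[OF continuous_on_weights(3,1)]) (simp add: riesz_proj_def reduced_res_def)
  also have "c *\<^sub>C reduced_res x + (- 1) *\<^sub>C riesz_proj x + x = c *\<^sub>C reduced_res x + x - riesz_proj x"
    by (simp add: scaleC_one)
  finally show ?thesis .
qed

text \<open>
  One factor is integrated over a slightly larger circle.  By the resolvent identity the double integral has the integrand \<open>(f w - f z) / (w - z)\<close>; the term with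
  \<open>f w\<close> vanishes as \<open>w\<close> lies outside the inner circle, and the other one yields \<open>P\<close> after
  exchanging the integrals.
\<close>

lemma riesz_proj_idempotent:
  assumes a: "a < r" "r < b" and free: "\<And>\<zeta>. a < norm (\<zeta> - c) \<Longrightarrow> norm (\<zeta> - c) < b \<Longrightarrow> \<zeta> \<notin> spectrum B"
  shows "riesz_proj (riesz_proj x) = riesz_proj x"
proof (rule cinner_ext)
  fix y
  (* A radius between the inner circle and the end of the annulus free of spectrum. *)
  define r' where "r' = (r + b) / 2"
  have r': "r < r'" "r' < b" "0 < r'" using a r_pos by (auto simp: r'_def)
  let ?S = "{z. a < norm (z - c) \<and> norm (z - c) < b}"
  let ?k = "- 1 / (2 * of_real pi * \<i>)"
  let ?in = "contour_integral (circlepath c r)" and ?out = "contour_integral (circlepath c r')"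
  define f where "f = (\<lambda>z. cinner (resolvent B z x) y)"
  have opS: "open ?S"
  proof -
    have "open {z. norm (z - c) < b}" "open {z. a < norm (z - c)}"
      by (intro open_Collect_less continuous_intros)+
    from open_Int[OF this] show ?thesis by (simp add: Int_def conj_commute)
  qed
  have holo: "(\<lambda>z. cinner (resolvent B z u) v) holomorphic_on ?S" for u v
    by (rule holomorphic_resolvent[OF subspace opS]) (use free in auto)
  have in_S: "z \<in> ?S" if "norm (z - c) = r \<or> norm (z - c) = r'" for z
    using that a r' by auto
  define g where "g = (\<lambda>z. - ?k * f z)"
  have f_cont: "continuous_on (sphere c r) f" and g_cont: "continuous_on (sphere c r) g"
    unfolding f_def g_def by (intro continuous_intros)+
  have "cinner (riesz_proj (riesz_proj x)) y = ?k * ?in (\<lambda>w. cinner (resolvent B w (riesz_proj x)) y)"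
    unfolding riesz_proj_def by (subst cinner_integral_op) auto
  also have "?in (\<lambda>w. cinner (resolvent B w (riesz_proj x)) y) = ?out (\<lambda>w. cinner (resolvent B w (riesz_proj x)) y)"
    by (rule contour_integral_circlepath_annulus[OF holo]) (use r_pos a r' in auto)
  also have "\<dots> = ?out (\<lambda>w. ?in (\<lambda>z. g z / (w - z)))"
  proof (rule contour_integral_eq)
    fix w assume "w \<in> path_image (circlepath c r')"
    then have w: "norm (w - c) = r'" using r' by (simp add: dist_norm norm_minus_commute)
    then have w_free: "w \<notin> spectrum B" using in_S free by blast
    have "cinner (resolvent B w (riesz_proj x)) y = ?k * ?in (\<lambda>z. 1 * cinner (resolvent B w (resolvent B z x)) y)"
      unfolding riesz_proj_def
    proof (rule functional_integral_op[OF continuous_on_weights(1)])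
      show "bounded_linear (\<lambda>X :: 'a \<Rightarrow>\<^sub>L 'a. cinner (resolvent B w (X x)) y)"
        by (rule bounded_linear_compose[OF bounded_linear_cinner_left
              bounded_linear_compose[OF blinfun.bounded_linear_right blinfun.bounded_linear_left]])
    qed (simp add: cinner_scaleC_left clinear_scaleC[OF clinear_resolvent[OF subspace w_free]])
    also have "?in (\<lambda>z. 1 * cinner (resolvent B w (resolvent B z x)) y) =
        ?in (\<lambda>z. (- f w) * (1 / (z - w)) - f z / (w - z))"
    proof (rule contour_integral_eq)
      fix z assume "z \<in> path_image (circlepath c r)"
      then have z: "norm (z - c) = r" using r_pos by (simp add: dist_norm norm_minus_commute)
      then have "z \<noteq> w" using w r' by auto
      have "(w - z) * cinner (resolvent B w (resolvent B z x)) y = f w - f z"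
        using arg_cong[OF resolvent_identity[OF subspace w_free circle_free[OF z]],
            of "\<lambda>X. cinner (blinfun_apply X x) y"]
        by (simp add: f_def blinfun.diff_left cinner_diff_left cinner_scaleC_left)
      with \<open>z \<noteq> w\<close> have "cinner (resolvent B w (resolvent B z x)) y = (f w - f z) / (w - z)"
        by (simp add: eq_divide_eq mult.commute)
      also have "\<dots> = (- f w) * (1 / (z - w)) - f z / (w - z)"
        using minus_divide_divide[of "f w" "w - z"] by (simp add: diff_divide_distrib)
      finally show "1 * cinner (resolvent B w (resolvent B z x)) y =
          (- f w) * (1 / (z - w)) - f z / (w - z)" by simp
    qed
    also have "\<dots> = (- f w) * ?in (\<lambda>z. 1 / (z - w)) - ?in (\<lambda>z. f z / (w - z))"
    proof (subst contour_integral_diff)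
      have "continuous_on (sphere c r) (\<lambda>z. 1 / (z - w))" "continuous_on (sphere c r) (\<lambda>z. f z / (w - z))"
        using w r' by (auto intro!: continuous_intros f_cont simp: dist_norm norm_minus_commute)
      note ci = this[THEN contour_integrable]
      show "(\<lambda>z. (- f w) * (1 / (z - w))) contour_integrable_on circlepath c r"
        "(\<lambda>z. f z / (w - z)) contour_integrable_on circlepath c r"
        by (intro contour_integrable_lmul ci)+
      show "?in (\<lambda>z. (- f w) * (1 / (z - w))) - ?in (\<lambda>z. f z / (w - z)) =
          (- f w) * ?in (\<lambda>z. 1 / (z - w)) - ?in (\<lambda>z. f z / (w - z))"
        by (subst contour_integral_lmul[OF ci(1)]) rule
    qed
    also have "?in (\<lambda>z. 1 / (z - w)) = 0"
      by (rule contour_integral_circlepath_holomorphic[of r _ c r'])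
         (use w r' r_pos in \<open>auto intro!: holomorphic_intros simp: dist_norm norm_minus_commute\<close>)
    also have "?k * (- f w * 0 - ?in (\<lambda>z. f z / (w - z))) = (- ?k) * ?in (\<lambda>z. f z / (w - z))"
      by simp
    also have "\<dots> = ?in (\<lambda>z. (- ?k) * (f z / (w - z)))"
      by (intro contour_integral_lmul[symmetric] contour_integrable continuous_intros f_cont)
         (use w r' in \<open>auto simp: dist_norm norm_minus_commute\<close>)
    also have "\<dots> = ?in (\<lambda>z. g z / (w - z))"
      by (simp add: g_def)
    finally show "cinner (resolvent B w (riesz_proj x)) y = ?in (\<lambda>z. g z / (w - z))" .
  qed
  also have "?out (\<lambda>w. ?in (\<lambda>z. g z / (w - z))) = ?in (\<lambda>z. ?out (\<lambda>w. g z / (w - z)))"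
  proof (rule contour_integral_swap)
    have "continuous_on (sphere c r' \<times> sphere c r) (\<lambda>p. g (snd p) / (fst p - snd p))"
      by (intro continuous_intros continuous_on_compose2[OF g_cont]) (use r' in auto)
    then show "continuous_on (path_image (circlepath c r') \<times> path_image (circlepath c r)) (\<lambda>(w, z). g z / (w - z))"
      using r' r_pos by (simp add: case_prod_beta)
    show "continuous_on {0..1} (\<lambda>t. vector_derivative (circlepath c r) (at t))"
      "continuous_on {0..1} (\<lambda>t. vector_derivative (circlepath c r') (at t))"
      by (auto simp: vector_derivative_circlepath intro!: continuous_intros)
  qed auto
  also have "?in (\<lambda>z. ?out (\<lambda>w. g z / (w - z))) = ?in (\<lambda>z. g z * (2 * of_real pi * \<i>))"
  proof (rule contour_integral_eq)
    fix z assume "z \<in> path_image (circlepath c r)"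
    then have z: "norm (z - c) = r" using r_pos by (simp add: dist_norm norm_minus_commute)
    have "?out (\<lambda>w. g z / (w - z)) = ?out (\<lambda>w. g z * (1 / (w - z)))" by simp
    also have "\<dots> = g z * ?out (\<lambda>w. 1 / (w - z))"
      by (intro contour_integral_lmul contour_integrable_continuous_circlepath continuous_intros)
         (use z r' in \<open>auto simp: dist_norm norm_minus_commute\<close>)
    also have "?out (\<lambda>w. 1 / (w - z)) = 2 * of_real pi * \<i>"
      using z r' by (intro contour_integral_inverse_circlepath) simp
    finally show "?out (\<lambda>w. g z / (w - z)) = g z * (2 * of_real pi * \<i>)" .
  qed
  also have "\<dots> = ?in f"
    by (simp add: g_def)
  also have "?k * ?in f = cinner (riesz_proj x) y"
    unfolding riesz_proj_def f_def by (subst cinner_integral_op) auto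
  finally show "cinner (riesz_proj (riesz_proj x)) y = cinner (riesz_proj x) y" .
qed

text \<open>
  On the circle \<open>|w| = \<epsilon>\<close> one has \<open>w\<^sup>2 - \<epsilon>\<^sup>2 = 2\<i> w Im w\<close>, which compensates the growth of the resolvent of
  a self-adjoint operator at the real axis.  Hence the coefficient integral of \<open>w\<^sup>2 R(c + w)\<close> vanishes:
  the singularity at \<open>c\<close> is at most a double pole, and \<open>(B - c)\<^sup>2 P = 0\<close>.  As \<open>(B - c) P\<close> is symmetric, it
  vanishes itself.
\<close>

lemma eigennilpotent_eq_0:
  assumes c: "cnj c = c" and a: "r < b"
    and free: "\<And>\<zeta>. 0 < norm (\<zeta> - c) \<Longrightarrow> norm (\<zeta> - c) < b \<Longrightarrow> \<zeta> \<notin> spectrum B"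
  shows "eigennilpotent = 0"
proof -
  let ?S = "ball c b - {c}"
  have holo: "(\<lambda>z. cinner (resolvent B z u) v) holomorphic_on ?S" for u v
  proof (rule holomorphic_resolvent[OF subspace])
    have "z \<notin> spectrum B" if "z \<in> ?S" for z
      using that by (intro free) (auto simp: dist_norm norm_minus_commute)
    then show "?S \<inter> spectrum B = {}" by blast
  qed auto
  have sq: "integral_op (\<lambda>\<zeta>. (\<zeta> - c)\<^sup>2) = 0"
  proof (rule blinfun_eqI_cinner)
    fix x y
    define g where "g = (\<lambda>z. cinner (resolvent B z x) y)"
    have g: "g holomorphic_on ?S" unfolding g_def by (rule holo)
    have g_le: "\<bar>Im (z - c)\<bar> * cmod (g z) \<le> norm x * norm y" if "z \<in> ?S" for z
    proof -
      have "\<bar>Im (z - c)\<bar> * cmod (g z) \<le> \<bar>Im z\<bar> * (norm (resolvent B z x) * norm y)"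
        using c unfolding g_def by (intro mult_mono Cauchy_Schwarz) (auto simp: complex_eq_iff)
      also have "\<bar>Im z\<bar> * norm (resolvent B z x) \<le> norm x"
        using that by (intro resolvent_norm_le[OF self_adjoint free]) (auto simp: dist_norm norm_minus_commute)
      then have "\<bar>Im z\<bar> * (norm (resolvent B z x) * norm y) \<le> norm x * norm y"
        by (simp add: mult_right_mono flip: mult.assoc)
      finally show ?thesis .
    qed
    let ?int = "\<lambda>e. contour_integral (circlepath c e)"
    define M where "M = cmod (?int r g) + 4 * pi * (norm x * norm y)"
    have le: "cmod (?int r (\<lambda>z. (z - c)\<^sup>2 * g z)) \<le> e\<^sup>2 * M" if e: "0 < e" "e < r" for e
    proof -
      have sub: "sphere c e \<subseteq> ?S" using e a by auto
      have g_cont: "continuous_on (sphere c e) g"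
        by (rule continuous_on_subset[OF holomorphic_on_imp_continuous_on[OF g] sub])
      have def1: "?int r h = ?int e h" if "h holomorphic_on ?S" for h
        by (rule contour_integral_circlepath_eq(3)[OF open_ball that]) (use e a in auto)
      have ci: "h contour_integrable_on circlepath c e" if "continuous_on (sphere c e) h" for h
        using that e by (intro contour_integrable_continuous_circlepath) simp
      have "?int r (\<lambda>z. (z - c)\<^sup>2 * g z) = ?int e (\<lambda>z. (z - c)\<^sup>2 * g z)"
        by (intro def1 holomorphic_intros g)
      also have "\<dots> = ?int e (\<lambda>z. ((z - c)\<^sup>2 - e\<^sup>2) * g z + e\<^sup>2 * g z)"
        by (simp add: algebra_simps)
      also have "\<dots> = ?int e (\<lambda>z. ((z - c)\<^sup>2 - e\<^sup>2) * g z) + e\<^sup>2 * ?int e g"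
        by (subst contour_integral_add, (intro ci continuous_intros g_cont)+,
            subst contour_integral_lmul, (intro ci continuous_intros g_cont)+, rule refl)
      also have "?int e g = ?int r g" by (rule def1[OF g, symmetric])
      finally have eq: "?int r (\<lambda>z. (z - c)\<^sup>2 * g z) =
          ?int e (\<lambda>z. ((z - c)\<^sup>2 - e\<^sup>2) * g z) + e\<^sup>2 * ?int r g" .
      have "cmod (?int e (\<lambda>z. ((z - c)\<^sup>2 - e\<^sup>2) * g z)) \<le> (2 * e * (norm x * norm y)) * (2 * pi * e)"
      proof (rule has_contour_integral_bound_circlepath)
        show "((\<lambda>z. ((z - c)\<^sup>2 - e\<^sup>2) * g z) has_contour_integral
            ?int e (\<lambda>z. ((z - c)\<^sup>2 - e\<^sup>2) * g z)) (circlepath c e)"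
          by (intro has_contour_integral_integral ci continuous_intros g_cont)
        fix z assume z: "norm (z - c) = e"
        then have zS: "z \<in> ?S" using sub by (auto simp: dist_norm norm_minus_commute)
        define w where "w = z - c"
        have "complex_of_real (e\<^sup>2) = w * cnj w"
          using complex_norm_square[of w] z by (simp only: w_def)
        then have "w\<^sup>2 - e\<^sup>2 = w * (w - cnj w)"
          by (simp add: power2_eq_square algebra_simps)
        also have "w - cnj w = 2 * \<i> * Im w"
          by (simp add: complex_eq_iff)
        finally have "cmod (((z - c)\<^sup>2 - e\<^sup>2) * g z) = 2 * e * (\<bar>Im (z - c)\<bar> * cmod (g z))"
          using z by (simp add: norm_mult w_def flip: of_real_diff)
        also have "\<dots> \<le> 2 * e * (norm x * norm y)"
          using g_le[OF zS] e by (intro mult_left_mono) auto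
        finally show "cmod (((z - c)\<^sup>2 - e\<^sup>2) * g z) \<le> 2 * e * (norm x * norm y)" .
      qed (use e in auto)
      then have "cmod (?int r (\<lambda>z. (z - c)\<^sup>2 * g z)) \<le>
          (2 * e * (norm x * norm y)) * (2 * pi * e) + cmod (e\<^sup>2 * ?int r g)"
        unfolding eq by (intro order_trans[OF norm_triangle_ineq] add_right_mono)
      also have "\<dots> = e\<^sup>2 * M"
        by (simp add: M_def norm_mult norm_power power2_eq_square algebra_simps)
      finally show ?thesis .
    qed
    have "((\<lambda>e. e\<^sup>2 * M) \<longlongrightarrow> 0\<^sup>2 * M) (at_right 0)"
      by (intro tendsto_intros)
    moreover have "\<forall>\<^sub>F e in at_right 0. cmod (?int r (\<lambda>z. (z - c)\<^sup>2 * g z)) \<le> e\<^sup>2 * M"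
      using le r_pos by (auto simp: eventually_at_right_field)
    ultimately have "cmod (?int r (\<lambda>z. (z - c)\<^sup>2 * g z)) \<le> 0"
      using tendsto_lowerbound[of _ _ "at_right (0::real)"] by fastforce
    then show "cinner (integral_op (\<lambda>\<zeta>. (\<zeta> - c)\<^sup>2) x) y = cinner (blinfun_apply 0 x) y"
      by (subst cinner_integral_op) (auto intro!: continuous_intros simp: g_def)
  qed
  have eigennilpotent_graph: "(eigennilpotent x, c *\<^sub>C eigennilpotent x) \<in> B" for x
  proof -
    have "contour_integral (circlepath c r) (\<lambda>\<zeta>. \<zeta> - c) = 0"
      by (rule contour_integral_circlepath_holomorphic[of r _ c "r + 1"])
         (use r_pos in \<open>auto intro!: holomorphic_intros\<close>)
    then have "(eigennilpotent x, integral_op (\<lambda>\<zeta>. \<zeta> * (\<zeta> - c)) x) \<in> B"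
      using integral_op_in_graph[OF continuous_on_weights(2), of x] by (simp add: eigennilpotent_def)
    also have "integral_op (\<lambda>\<zeta>. \<zeta> * (\<zeta> - c)) x = integral_op (\<lambda>\<zeta>. c * (\<zeta> - c) + 1 * (\<zeta> - c)\<^sup>2) x"
      by (rule arg_cong[where f = "\<lambda>X. blinfun_apply X x"], rule integral_op_cong)
         (auto intro!: continuous_intros simp: algebra_simps power2_eq_square)
    also have "\<dots> = c *\<^sub>C eigennilpotent x"
      by (subst integral_op_combination) (auto intro!: continuous_intros simp: eigennilpotent_def sq)
    finally show ?thesis .
  qed
  show ?thesis
  proof (rule blinfun_eqI)
    fix x
    have "cinner (eigennilpotent x) (eigennilpotent x) = 0"
      using self_adjointD[OF self_adjoint riesz_proj_in_graph[of x] eigennilpotent_graph[of x]] c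
      by (simp add: cinner_simps)
    then show "eigennilpotent x = blinfun_apply 0 x" by simp
  qed
qed

end

lemma norm_resolvent_integral_diff_le:
  assumes B: "circle_free_of_spectrum B c r" and B': "circle_free_of_spectrum B' c r"
    and \<phi>: "continuous_on (sphere c r) \<phi>" "\<And>\<zeta>. norm (\<zeta> - c) = r \<Longrightarrow> cmod (\<phi> \<zeta>) \<le> M"
    and d: "\<And>\<zeta>. norm (\<zeta> - c) = r \<Longrightarrow> norm (resolvent B \<zeta> - resolvent B' \<zeta>) \<le> d" and M: "0 \<le> M"
  shows "norm (resolvent_integral (circlepath c r) \<phi> B - resolvent_integral (circlepath c r) \<phi> B') \<le> r * (M * d)"
proof -
  interpret B: circle_free_of_spectrum B c r by (rule B)
  interpret B': circle_free_of_spectrum B' c r by (rule B')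
  let ?F = "\<lambda>\<zeta>. \<phi> \<zeta> *\<^sub>C resolvent B \<zeta>" and ?F' = "\<lambda>\<zeta>. \<phi> \<zeta> *\<^sub>C resolvent B' \<zeta>"
  have cont: "continuous_on (sphere c r) ?F" "continuous_on (sphere c r) ?F'"
    by (intro continuous_intros \<phi> B.continuous_on_resolvent_sphere B'.continuous_on_resolvent_sphere)+
  have "resolvent_integral (circlepath c r) \<phi> B - resolvent_integral (circlepath c r) \<phi> B' =
      (- 1 / (2 * of_real pi * \<i>)) *\<^sub>C op_contour_integral (circlepath c r) (\<lambda>\<zeta>. ?F \<zeta> - ?F' \<zeta>)"
    unfolding resolvent_integral_def op_contour_integral_diff[OF B.r_pos cont, symmetric]
    by (simp add: bounded_bilinear.diff_right[OF bounded_bilinear_scaleC_blinfun])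
  also have "norm \<dots> \<le> cmod (- 1 / (2 * of_real pi * \<i>)) * (2 * pi * r * (M * d))"
  proof (intro order_trans[OF norm_scaleC_blinfun_le] mult_left_mono norm_op_contour_integral_le B.r_pos)
    fix \<zeta> assume "\<zeta> \<in> sphere c r"
    then have z: "norm (\<zeta> - c) = r" by (simp add: dist_norm norm_minus_commute)
    have "?F \<zeta> - ?F' \<zeta> = \<phi> \<zeta> *\<^sub>C (resolvent B \<zeta> - resolvent B' \<zeta>)"
      by (simp add: bounded_bilinear.diff_right[OF bounded_bilinear_scaleC_blinfun])
    also have "norm \<dots> \<le> M * d"
      by (intro order_trans[OF norm_scaleC_blinfun_le] mult_mono \<phi>(2) d z M norm_ge_zero)
    finally show "norm (?F \<zeta> - ?F' \<zeta>) \<le> M * d" .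
  qed (auto intro!: continuous_intros cont)
  also have "\<dots> = r * (M * d)"
    by (simp add: norm_mult norm_divide)
  finally show ?thesis .
qed

section \<open>The transformation operators\<close>

lemma op_power_compose: "op_power X m o\<^sub>L op_power X n = op_power X (m + n)"
proof (rule blinfun_eqI)
  show "(op_power X m o\<^sub>L op_power X n) x = op_power X (m + n) x" for x
    by (induction m) auto
qed

lemma norm_op_power_le: "norm (op_power X n) \<le> norm X ^ n"
proof (induction n)
  case 0
  show ?case by (simp add: norm_blinfun_id_le)
next
  case (Suc n)
  have "norm (op_power X (Suc n)) \<le> norm X * norm (op_power X n)"
    by (simp add: norm_blinfun_compose)
  also have "\<dots> \<le> norm X * norm X ^ n"
    by (intro mult_left_mono Suc.IH norm_ge_zero)
  finally show ?case by simp
qed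

lemma op_power_commute:
  fixes X Y :: "'a :: real_normed_vector \<Rightarrow>\<^sub>L 'a"
  assumes "\<And>x. Y (blinfun_apply X x) = X (blinfun_apply Y x)"
  shows "Y (op_power X n x) = op_power X n (blinfun_apply Y x)"
  by (induction n) (auto simp: assms)

lemma op_power_uminus: "op_power (- X) n = (- 1) ^ n *\<^sub>R op_power X n"
  by (induction n) (auto intro!: blinfun_eqI simp: blinfun.minus_left blinfun.scaleR_left blinfun.scaleR_right)

lemma summable_norm_op_power:
  assumes "norm X < 1" "\<And>n. \<bar>a n\<bar> \<le> 1"
  shows "summable (\<lambda>n. norm (a n *\<^sub>R op_power X n))"
proof (rule summable_comparison_test)
  show "summable (\<lambda>n. norm X ^ n)" using assms(1) by (intro summable_geometric) simp
  have "\<bar>a n\<bar> * norm (op_power X n) \<le> 1 * norm X ^ n" for n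
    by (intro mult_mono assms norm_op_power_le) auto
  then show "\<exists>N. \<forall>n\<ge>N. norm (norm (a n *\<^sub>R op_power X n)) \<le> norm X ^ n" by simp
qed

lemma Neumann_series:
  fixes X :: "'a :: banach \<Rightarrow>\<^sub>L 'a"
  assumes "norm X < 1"
  shows "(\<Sum>n. op_power X n) o\<^sub>L (id_blinfun - X) = id_blinfun"
proof -
  have "summable (\<lambda>n. norm (op_power X n))"
    using summable_norm_op_power[OF assms, of "\<lambda>_. 1"] by simp
  then have "(\<lambda>n. op_power X n) sums (\<Sum>n. op_power X n)"
    using summable_norm_cancel summable_sums by blast
  then have "(\<lambda>n. (\<Sum>k<n. op_power X k) o\<^sub>L (id_blinfun - X)) \<longlonglongrightarrow>
      ((\<Sum>n. op_power X n) o\<^sub>L (id_blinfun - X))"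
    unfolding sums_def
    by (rule bounded_linear.tendsto[OF bounded_bilinear.bounded_linear_left[OF bounded_bilinear_blinfun_compose]])
  moreover have "(\<Sum>k<n. op_power X k) o\<^sub>L (id_blinfun - X) = id_blinfun - op_power X n" for n
  proof (rule blinfun_eqI)
    fix x
    have "(\<Sum>k<n. op_power X k) (x - X x) = x - op_power X n x"
    proof (induction n)
      case (Suc n)
      have "op_power X n (X x) = X (op_power X n x)" by (rule op_power_commute[symmetric]) simp
      then show ?case using Suc by (simp add: blinfun.add_left blinfun.diff_right algebra_simps)
    qed simp
    then show "((\<Sum>k<n. op_power X k) o\<^sub>L (id_blinfun - X)) x = (id_blinfun - op_power X n) x"
      by (simp add: blinfun.diff_left)
  qed
  moreover have "(\<lambda>n. op_power X n) \<longlonglongrightarrow> 0"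
  proof (rule Lim_null_comparison)
    show "\<forall>\<^sub>F n in sequentially. norm (op_power X n) \<le> norm X ^ n" by (simp add: norm_op_power_le)
    show "(\<lambda>n. norm X ^ n) \<longlonglongrightarrow> 0" using assms by (intro LIMSEQ_realpow_zero) auto
  qed
  then have "(\<lambda>n. id_blinfun - op_power X n) \<longlonglongrightarrow> id_blinfun - 0"
    by (intro tendsto_intros)
  ultimately show ?thesis using LIMSEQ_unique by fastforce
qed

text \<open>
  Consecutive coefficients have the ratio \<open>- (n + 1/2) / (n + 1)\<close>, of modulus at most 1.
\<close>

lemma abs_gbinomial_minus_half_le: "\<bar>((- 1 / 2) :: real) gchoose n\<bar> \<le> 1"
proof (induction n)
  case (Suc n)
  have "((- 1 / 2) :: real) gchoose Suc n = (- 1 / 2 gchoose n) * ((- 1 / 2 - real n) / real (Suc n))"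
    using gbinomial_absorb_comp[of "- 1 / 2 :: real" n] gbinomial_mult_1[of "- 1 / 2 :: real" n]
    by (simp add: field_simps)
  moreover have "\<bar>(- 1 / 2 - real n) / real (Suc n)\<bar> \<le> 1"
    by (simp add: field_simps)
  ultimately show ?case
    using Suc mult_mono[of "\<bar>(- 1 / 2 :: real) gchoose n\<bar>" 1 "\<bar>(- 1 / 2 - real n) / real (Suc n)\<bar>" 1]
    by (simp add: abs_mult)
qed simp

text \<open>
  The square of the binomial series is computed by rearranging the double series along its diagonals;
  by Vandermonde's identity the coefficients become those of the geometric series.
\<close>

lemma inv_sqrt_square:
  fixes X :: "'a :: banach \<Rightarrow>\<^sub>L 'a"
  assumes X: "norm X < 1"
  shows "inv_sqrt_one_minus X o\<^sub>L inv_sqrt_one_minus X = (\<Sum>n. op_power X n)"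
proof -
  define a where "a = (\<lambda>n. ((- 1 / 2) :: real) gchoose n)"
  define f where "f = (\<lambda>n. a n *\<^sub>R op_power (- X) n)"
  define Z where "Z = inv_sqrt_one_minus X"
  have a: "\<bar>a n\<bar> \<le> 1" for n
    unfolding a_def by (rule abs_gbinomial_minus_half_le)
  have sf: "summable (\<lambda>n. norm (f n))"
    unfolding f_def using X a by (intro summable_norm_op_power) auto
  then have f: "f sums Z"
    unfolding Z_def inv_sqrt_one_minus_def f_def[unfolded a_def, symmetric]
    using summable_norm_cancel summable_sums by blast
  define F where "F = (\<lambda>(i, j). f i o\<^sub>L f j)"
  have F_abs: "F abs_summable_on (UNIV \<times> UNIV)"
  proof -
    let ?g = "\<lambda>(i, j). norm (f i) * norm (f j)"
    have hs: "((\<lambda>n. norm (f n)) has_sum (\<Sum>n. norm (f n))) UNIV"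
      using sf by (intro norm_summable_imp_has_sum) (auto simp: summable_sums)
    have "?g summable_on (UNIV \<times> UNIV)"
    proof (rule summable_on_SigmaI)
      show "((\<lambda>j. ?g (i, j)) has_sum norm (f i) * (\<Sum>n. norm (f n))) UNIV" for i
        using has_sum_cmult_right[OF hs, of "norm (f i)"] by simp
      show "(\<lambda>i. norm (f i) * (\<Sum>n. norm (f n))) summable_on UNIV"
        using has_sum_cmult_left[OF hs] by (auto simp: summable_on_def)
    qed auto
    then show ?thesis
      by (rule summable_on_comparison_test) (auto simp: F_def norm_blinfun_compose)
  qed
  have F: "(F has_sum (Z o\<^sub>L Z)) (UNIV \<times> UNIV)"
  proof (rule has_sum_SigmaI)
    have bl: "bounded_linear (\<lambda>Y. f i o\<^sub>L Y)" "bounded_linear (\<lambda>Y. Y o\<^sub>L Z)" for i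
      by (intro bounded_bilinear.bounded_linear_left bounded_bilinear.bounded_linear_right
          bounded_bilinear_blinfun_compose)+
    have hs: "(f has_sum Z) UNIV" by (rule norm_summable_imp_has_sum[OF sf f])
    show "((\<lambda>j. F (i, j)) has_sum (f i o\<^sub>L Z)) UNIV" for i
      using has_sum_bounded_linear[OF bl(1) hs, of i] by (simp add: F_def o_def)
    show "((\<lambda>i. f i o\<^sub>L Z) has_sum (Z o\<^sub>L Z)) UNIV"
      using has_sum_bounded_linear[OF bl(2) hs] by (simp add: o_def)
    show "F summable_on UNIV \<times> UNIV" by (rule abs_summable_summable[OF F_abs])
  qed
  have "((\<lambda>(n, k). F (k, n - k)) has_sum (Z o\<^sub>L Z)) (SIGMA n:UNIV. {..n})"
    using F by (rule has_sum_reindex_bij_witness[where i = "\<lambda>(n, k). (k, n - k)" and j = "\<lambda>(i, j). (i + j, i)",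
        THEN iffD1, rotated -1]) auto
  then have "((\<lambda>n. \<Sum>k\<le>n. F (k, n - k)) has_sum (Z o\<^sub>L Z)) UNIV"
    by (rule has_sum_SigmaD) (auto intro: has_sum_finite)
  moreover have "(\<Sum>k\<le>n. F (k, n - k)) = op_power X n" for n
  proof -
    have "(\<Sum>k\<le>n. F (k, n - k)) = (\<Sum>k\<le>n. (a k * a (n - k)) *\<^sub>R op_power (- X) n)"
      by (intro sum.cong refl)
         (simp add: F_def f_def bounded_bilinear.scaleR_left[OF bounded_bilinear_blinfun_compose]
           bounded_bilinear.scaleR_right[OF bounded_bilinear_blinfun_compose] op_power_compose)
    also have "\<dots> = (\<Sum>k = 0..n. a k * a (n - k)) *\<^sub>R op_power (- X) n"
      by (simp add: scaleR_sum_left atLeast0AtMost)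
    also have "(\<Sum>k = 0..n. a k * a (n - k)) = (- 1) gchoose n"
      unfolding a_def using gbinomial_Vandermonde[of "- 1 / 2 :: real" "- 1 / 2" n] by simp
    also have "\<dots> = (- 1) ^ n"
      using gbinomial_minus[of "1 :: real" n] by (simp flip: binomial_gbinomial)
    finally show ?thesis
      by (simp add: op_power_uminus flip: power_add mult_2)
  qed
  ultimately show ?thesis
    by (auto simp: Z_def[symmetric] dest!: has_sum_imp_sums sums_unique)
qed

lemma inv_sqrt_square_inverse:
  fixes X :: "'a :: banach \<Rightarrow>\<^sub>L 'a"
  assumes X: "norm X < 1"
  shows "inv_sqrt_one_minus X (inv_sqrt_one_minus X (x - X x)) = x"
proof -
  have "(inv_sqrt_one_minus X o\<^sub>L inv_sqrt_one_minus X o\<^sub>L (id_blinfun - X)) x = id_blinfun x"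
    unfolding inv_sqrt_square[OF X] Neumann_series[OF X] ..
  then show ?thesis by (simp add: blinfun.diff_left)
qed

lemma inv_sqrt_sums:
  fixes X :: "'a :: banach \<Rightarrow>\<^sub>L 'a"
  assumes X: "norm X < 1"
  shows "(\<lambda>n. ((- 1 / 2 :: real) gchoose n) *\<^sub>R op_power (- X) n) sums inv_sqrt_one_minus X"
proof -
  have "norm (- X) < 1" using X by simp
  from summable_norm_op_power[OF this abs_gbinomial_minus_half_le] show ?thesis
    unfolding inv_sqrt_one_minus_def by (rule summable_sums[OF summable_norm_cancel])
qed

lemma inv_sqrt_commute:
  fixes X Y :: "'a :: banach \<Rightarrow>\<^sub>L 'a"
  assumes X: "norm X < 1" and Y: "\<And>x. Y (blinfun_apply X x) = X (blinfun_apply Y x)"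
  shows "Y (inv_sqrt_one_minus X x) = inv_sqrt_one_minus X (blinfun_apply Y x)"
proof (rule sums_unique2)
  let ?f = "\<lambda>n. ((- 1 / 2 :: real) gchoose n) *\<^sub>R op_power (- X) n"
  have bl: "bounded_linear (\<lambda>Z. Y (blinfun_apply Z x))" "bounded_linear (\<lambda>Z. blinfun_apply Z (Y x))"
    by (intro bounded_linear_compose[OF blinfun.bounded_linear_right] blinfun.bounded_linear_left)+
  show "(\<lambda>n. Y (?f n x)) sums Y (inv_sqrt_one_minus X x)"
    by (rule bounded_linear.sums[OF bl(1) inv_sqrt_sums[OF X]])
  have "Y (?f n x) = ?f n (Y x)" for n
    using Y op_power_commute[of Y "- X" n x]
    by (simp add: blinfun.scaleR_left blinfun.scaleR_right blinfun.minus_left blinfun.minus_right)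
  then show "(\<lambda>n. Y (?f n x)) sums inv_sqrt_one_minus X (Y x)"
    using bounded_linear.sums[OF bl(2) inv_sqrt_sums[OF X]] by simp
qed

lemma norm_inv_sqrt_minus_id_le:
  fixes X :: "'a :: banach \<Rightarrow>\<^sub>L 'a"
  assumes X: "norm X \<le> 1 / 2"
  shows "norm (inv_sqrt_one_minus X - id_blinfun) \<le> 2 * norm X"
proof -
  let ?f = "\<lambda>n. ((- 1 / 2 :: real) gchoose n) *\<^sub>R op_power (- X) n"
  have q: "norm X < 1" using X by simp
  have geo: "(\<lambda>n. norm X * norm X ^ n) sums (norm X * (1 / (1 - norm X)))"
    using q by (intro sums_mult geometric_sums) simp
  have le: "norm (?f (Suc n)) \<le> norm X * norm X ^ n" for n
  proof -
    have "norm (?f (Suc n)) \<le> 1 * norm (- X) ^ Suc n"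
      unfolding norm_scaleR by (intro mult_mono abs_gbinomial_minus_half_le norm_op_power_le) auto
    then show ?thesis by simp
  qed
  have "(\<lambda>n. ?f (Suc n)) sums (inv_sqrt_one_minus X - ?f 0)"
    by (rule iffD2[OF sums_Suc_iff[of ?f]]) (use inv_sqrt_sums[OF q] in simp)
  then have eq: "inv_sqrt_one_minus X - id_blinfun = (\<Sum>n. ?f (Suc n))"
    by (simp add: sums_unique)
  have "norm (\<Sum>n. ?f (Suc n)) \<le> (\<Sum>n. norm X * norm X ^ n)"
    by (rule norm_suminf_le[OF le sums_summable[OF geo]])
  also have "\<dots> = norm X * (1 / (1 - norm X))" using sums_unique[OF geo] by simp
  also have "\<dots> \<le> norm X * 2"
    using X by (intro mult_left_mono) (auto simp: field_simps)
  finally show ?thesis by (simp add: eq mult.commute)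
qed

lemma op_inverse_eqI:
  fixes U V :: "'a :: real_normed_vector \<Rightarrow>\<^sub>L 'a"
  assumes "\<And>x. U (blinfun_apply V x) = x" "\<And>x. V (blinfun_apply U x) = x"
  shows "op_inverse U = V"
  unfolding op_inverse_def
proof (rule the_equality)
  show "U o\<^sub>L V = id_blinfun \<and> V o\<^sub>L U = id_blinfun"
    by (auto intro!: blinfun_eqI simp: assms)
  fix V' assume "U o\<^sub>L V' = id_blinfun \<and> V' o\<^sub>L U = id_blinfun"
  then have "V' (U (V x)) = V x" for x
    by (metis blinfun_apply_blinfun_compose blinfun_apply_id_blinfun id_apply)
  then show "V' = V" by (intro blinfun_eqI) (simp add: assms)
qed

locale close_projections =
  fixes P0 P :: "'a :: banach \<Rightarrow>\<^sub>L 'a"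
  assumes idem0: "\<And>x. P0 (P0 x) = P0 x" and idem: "\<And>x. P (P x) = P x"
    and close: "norm (P - P0) < 1"
begin

abbreviation "X \<equiv> (P - P0) o\<^sub>L (P - P0)"
abbreviation "Z \<equiv> inv_sqrt_one_minus X"

lemma norm_X_le: "norm X \<le> (norm (P - P0))\<^sup>2"
  using norm_blinfun_compose[of "P - P0" "P - P0"] by (simp add: power2_eq_square)

lemma norm_X: "norm X < 1"
  using norm_X_le power_less_one_iff[of "norm (P - P0)" 2] close by simp

lemmas blin = blinfun.diff_left blinfun.diff_right blinfun.add_left blinfun.add_right idem idem0

lemma Z_commute: "P (Z x) = Z (P x)" "P0 (Z x) = Z (P0 x)"
  by (rule inv_sqrt_commute[OF norm_X]; simp add: blin)+

lemma Z_cancel: "Z (Z (x - X x)) = x"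
  by (rule inv_sqrt_square_inverse[OF norm_X])

lemma transformation_apply:
  "transformation_operator P0 P x = Z (x - P x - P0 x + P (P0 x) + P (P0 x))"
  by (simp add: transformation_operator_def blin algebra_simps)

text \<open>
  With \<open>M = (I - P) (I - P0) + P P0\<close> and \<open>M' = (I - P0) (I - P) + P0 P\<close> one has
  \<open>M M' = M' M = I - X\<close>, and \<open>X\<close> commutes with both projections.  Hence \<open>V = M' Z\<close> inverts
  the transformation operator \<open>Z M\<close>.
\<close>

definition V :: "'a \<Rightarrow>\<^sub>L 'a" where
  "V = (((id_blinfun - P0) o\<^sub>L (id_blinfun - P)) + (P0 o\<^sub>L P)) o\<^sub>L Z"

lemma V_apply: "V x = Z (x - P0 x - P x + P0 (P x) + P0 (P x))"
  by (simp add: V_def blin Z_commute algebra_simps)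

lemma transformation_V: "transformation_operator P0 P (V x) = x"
proof -
  have "transformation_operator P0 P (V x) = Z (Z (x - X x))"
    unfolding V_apply transformation_apply by (simp add: blin Z_commute algebra_simps)
  then show ?thesis using Z_cancel[of x] by simp
qed

lemma V_transformation: "V (transformation_operator P0 P x) = x"
proof -
  have "V (transformation_operator P0 P x) = Z (Z (x - X x))"
    unfolding V_apply transformation_apply by (simp add: blin Z_commute algebra_simps)
  then show ?thesis using Z_cancel[of x] by simp
qed

lemma op_inverse_transformation: "op_inverse (transformation_operator P0 P) = V"
  by (rule op_inverse_eqI) (simp_all add: transformation_V V_transformation)

lemma transformation_on_range: "transformation_operator P0 P (P0 x) = Z (P (P0 x))"
  unfolding transformation_apply by (simp add: blin)

lemma inverse_transformation_on_range: "P0 (op_inverse (transformation_operator P0 P) x) = P0 (P (Z x))"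
  unfolding op_inverse_transformation V_apply by (simp add: blin Z_commute)

end

section \<open>Lagrangian projections and boundary triplets\<close>

lemma symplectic_J_J: "symplectic_J (symplectic_J x) = - x"
  by (simp add: symplectic_J.rep_eq prod_eq_iff)

lemma norm_symplectic_J: "norm (symplectic_J x) = norm x"
  by (simp add: symplectic_J.rep_eq norm_prod_def add.commute)

locale lagrangian_projection =
  fixes Q :: "('b :: complex_inner \<times> 'b) \<Rightarrow>\<^sub>L ('b \<times> 'b)"
  assumes orthogonal: "orthogonal_projection Q" and lagrangian: "lagrangian (range (blinfun_apply Q))"
begin

lemma idem: "Q (Q x) = Q x"
  using orthogonal unfolding orthogonal_projection_def by (metis blinfun_apply_blinfun_compose)

lemma symmetric: "cinner (Q x) y = cinner x (Q y)"
  using orthogonal unfolding orthogonal_projection_def by blast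

lemma isotropic: "cinner (symplectic_J (Q x)) (Q y) = 0"
proof -
  have "Q x \<in> {f. \<forall>g\<in>range (blinfun_apply Q). symplectic_form f g = 0}"
    using lagrangian unfolding lagrangian_def by blast
  then have "symplectic_form (Q x) (Q y) = 0" by blast
  then show ?thesis by (simp add: symplectic_form_J)
qed

text \<open>
  Isotropy of the range says \<open>Q J Q = 0\<close>; its maximality says \<open>(I - Q) J (I - Q) = 0\<close>.
  Together these are the exchange relation.
\<close>

lemma J_exchange: "Q (symplectic_J x) = symplectic_J x - symplectic_J (Q x)"
proof -
  let ?h = "symplectic_J (x - Q x)"
  have "cinner (symplectic_J ?h) (Q y) = - cinner (Q (x - Q x)) y" for y
    by (simp only: symplectic_J_J cinner_minus_left symmetric)
  then have "cinner (symplectic_J ?h) (Q y) = 0" for y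
    by (simp add: blinfun.diff_right idem)
  then have "?h \<in> {f. \<forall>g\<in>range (blinfun_apply Q). symplectic_form f g = 0}"
    by (auto simp: symplectic_form_J)
  then have "?h \<in> range (blinfun_apply Q)"
    using lagrangian unfolding lagrangian_def by blast
  then have 1: "Q ?h = ?h" using idem by auto
  have "Q (symplectic_J (Q x)) = 0"
    using isotropic by (intro cinner_ext) (simp add: symmetric)
  with 1 show ?thesis by (simp add: blinfun.diff_right)
qed

end

locale boundary_value_setting =
  fixes A :: "'a :: complex_hilbert operator"
    and \<Gamma>0 \<Gamma>1 :: "'a \<Rightarrow> 'b :: complex_hilbert" and T :: "'a \<Rightarrow> 'b \<times> 'b"
  assumes dense: "densely_defined A" and triplet: "boundary_triplet A \<Gamma>0 \<Gamma>1"
    and T_def: "T = (\<lambda>u. (\<Gamma>0 u, \<Gamma>1 u))"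
begin

abbreviation "Amax \<equiv> op_adjoint A"

lemmas sv = single_valued_op_adjoint[OF dense]
lemmas sub = subspace_op_adjoint[of A]

lemma T_add: "(u, x) \<in> Amax \<Longrightarrow> (v, y) \<in> Amax \<Longrightarrow> T (u + v) = T u + T v"
  using triplet unfolding boundary_triplet_def Let_def T_def by blast

lemma T_scale: "(u, x) \<in> Amax \<Longrightarrow> T (a *\<^sub>C u) = a *\<^sub>C T u"
  using triplet unfolding boundary_triplet_def Let_def T_def by blast

lemma T_diff: "(u, x) \<in> Amax \<Longrightarrow> (v, y) \<in> Amax \<Longrightarrow> T (u - v) = T u - T v"
  using T_add[OF subspace_graph_diff[OF sub, of u x v y], of v y] by simp

lemma Green:
  assumes "(u, x) \<in> Amax" "(v, y) \<in> Amax"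
  shows "cinner x v - cinner u y = cinner (symplectic_J (T u)) (T v)"
proof -
  have "cinner (op_apply Amax u) v - cinner u (op_apply Amax v) =
      cinner (\<Gamma>1 u) (\<Gamma>0 v) - cinner (\<Gamma>0 u) (\<Gamma>1 v)"
    using triplet assms unfolding boundary_triplet_def Let_def by blast
  then show ?thesis
    using assms by (simp add: op_apply_eq[OF sv] T_def symplectic_form_def flip: symplectic_form_J)
qed

lemma exists_trace_bound: "\<exists>K\<ge>0. \<forall>(u, x)\<in>Amax. norm (T u) \<le> K * (norm u + norm x)"
proof -
  obtain K where K: "\<And>u. u \<in> Domain Amax \<Longrightarrow> norm (T u) \<le> K * graph_norm Amax u"
    using triplet unfolding boundary_triplet_def Let_def T_def by blast
  have "norm (T u) \<le> \<bar>K\<bar> * (norm u + norm x)" if "(u, x) \<in> Amax" for u x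
  proof -
    have "graph_norm Amax u = sqrt ((norm u)\<^sup>2 + (norm x)\<^sup>2)"
      using that by (simp add: graph_norm_def graph_cinner_def op_apply_eq[OF sv] cinner_self)
    then have g: "0 \<le> graph_norm Amax u" "graph_norm Amax u \<le> norm u + norm x"
      by (auto intro: sqrt_sum_squares_le_sum)
    have "norm (T u) \<le> K * graph_norm Amax u" using K that by blast
    also have "\<dots> \<le> \<bar>K\<bar> * (norm u + norm x)" using g by (intro mult_mono) auto
    finally show ?thesis .
  qed
  then show ?thesis by (intro exI[of _ "\<bar>K\<bar>"]) auto
qed

definition trace_bound :: real where
  "trace_bound = (SOME K. K \<ge> 0 \<and> (\<forall>(u, x)\<in>Amax. norm (T u) \<le> K * (norm u + norm x)))"

lemma trace_bound_nonneg: "trace_bound \<ge> 0"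
  and norm_T_le: "(u, x) \<in> Amax \<Longrightarrow> norm (T u) \<le> trace_bound * (norm u + norm x)"
  using someI_ex[OF exists_trace_bound] unfolding trace_bound_def by auto

text \<open>
  \<open>Y\<close> is \<open>A* X\<close>.  A pair of bounded operators related in this way is an element of \<open>B(K, H\<^sub>+)\<close>, with
  norm equivalent to \<open>norm X + norm Y\<close>.
\<close>

definition in_domain :: "'k :: real_normed_vector \<Rightarrow>\<^sub>L 'a \<Rightarrow> 'k \<Rightarrow>\<^sub>L 'a \<Rightarrow> bool" where
  "in_domain X Y \<longleftrightarrow> (\<forall>x. (X x, Y x) \<in> Amax)"

lemma bounded_linear_trace:
  assumes "in_domain X Y"
  shows "bounded_linear (\<lambda>x. T (X x))"
proof (rule bounded_linear_intro[of _ "trace_bound * (norm X + norm Y)"])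
  have XY: "(X x, Y x) \<in> Amax" for x using assms by (simp add: in_domain_def)
  show "T (X (x + y)) = T (X x) + T (X y)" for x y
    using T_add[OF XY XY] by (simp add: blinfun.add_right)
  show "T (X (a *\<^sub>R x)) = a *\<^sub>R T (X x)" for a x
    using T_scale[OF XY, of "complex_of_real a" x] by (simp add: blinfun.scaleR_right scaleR_scaleC)
  show "norm (T (X x)) \<le> norm x * (trace_bound * (norm X + norm Y))" for x
  proof -
    have "norm (T (X x)) \<le> trace_bound * (norm (X x) + norm (Y x))" by (rule norm_T_le[OF XY])
    also have "\<dots> \<le> trace_bound * (norm X * norm x + norm Y * norm x)"
      by (intro mult_left_mono add_mono norm_blinfun trace_bound_nonneg)
    finally show ?thesis by (simp add: algebra_simps)
  qed
qed

lemma trace_comp_apply: "in_domain X Y \<Longrightarrow> trace_comp T X x = T (X x)"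
  unfolding trace_comp_def by (simp add: bounded_linear_Blinfun_apply bounded_linear_trace)

lemma norm_trace_comp_le:
  assumes "in_domain X Y"
  shows "norm (trace_comp T X) \<le> trace_bound * (norm X + norm Y)"
proof (rule norm_blinfun_bound)
  show "0 \<le> trace_bound * (norm X + norm Y)" using trace_bound_nonneg by simp
  have XY: "(X x, Y x) \<in> Amax" for x using assms by (simp add: in_domain_def)
  fix x
  have "norm (T (X x)) \<le> trace_bound * (norm (X x) + norm (Y x))" by (rule norm_T_le[OF XY])
  also have "\<dots> \<le> trace_bound * (norm X * norm x + norm Y * norm x)"
    by (intro mult_left_mono add_mono norm_blinfun trace_bound_nonneg)
  finally show "norm (trace_comp T X x) \<le> trace_bound * (norm X + norm Y) * norm x"
    by (simp add: trace_comp_apply[OF assms] algebra_simps)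
qed

lemma clinear_trace_comp:
  fixes X :: "'k :: complex_inner \<Rightarrow>\<^sub>L 'a"
  assumes "in_domain X Y" "clinear (blinfun_apply X)"
  shows "clinear (blinfun_apply (trace_comp T X))"
proof (rule clinearI)
  have XY: "(X x, Y x) \<in> Amax" for x using assms by (simp add: in_domain_def)
  show "trace_comp T X (a *\<^sub>C x) = a *\<^sub>C trace_comp T X x" for a x
    using T_scale[OF XY] by (simp add: trace_comp_apply[OF assms(1)] clinear_scaleC[OF assms(2)])
qed

lemma in_domain_diff: "in_domain X Y \<Longrightarrow> in_domain X' Y' \<Longrightarrow> in_domain (X - X') (Y - Y')"
  unfolding in_domain_def by (simp add: blinfun.diff_left subspace_graph_diff[OF sub])

lemma in_domain_scaleR: "in_domain X Y \<Longrightarrow> in_domain (a *\<^sub>R X) (a *\<^sub>R Y)"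
  unfolding in_domain_def
  by (simp add: blinfun.scaleR_left scaleR_scaleC subspace_graph_scale[OF sub])

lemma in_domain_compose: "in_domain X Y \<Longrightarrow> in_domain (X o\<^sub>L Z) (Y o\<^sub>L Z)"
  unfolding in_domain_def by simp

lemma trace_comp_diff:
  assumes "in_domain X Y" "in_domain X' Y'"
  shows "trace_comp T (X - X') = trace_comp T X - trace_comp T X'"
proof (rule blinfun_eqI)
  fix x
  have "T (X x - X' x) = T (X x) - T (X' x)"
    using assms T_diff unfolding in_domain_def by blast
  then show "trace_comp T (X - X') x = (trace_comp T X - trace_comp T X') x"
    by (simp add: trace_comp_apply[OF assms(1)] trace_comp_apply[OF assms(2)]
        trace_comp_apply[OF in_domain_diff[OF assms]] blinfun.diff_left)
qed

lemma trace_comp_scaleR: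
  assumes "in_domain X Y"
  shows "trace_comp T (a *\<^sub>R X) = a *\<^sub>R trace_comp T X"
proof (rule blinfun_eqI)
  fix x
  have "T (a *\<^sub>R X x) = a *\<^sub>R T (X x)"
    using assms T_scale unfolding in_domain_def scaleR_scaleC by blast
  then show "trace_comp T (a *\<^sub>R X) x = (a *\<^sub>R trace_comp T X) x"
    by (simp add: trace_comp_apply[OF assms] trace_comp_apply[OF in_domain_scaleR[OF assms]] blinfun.scaleR_left)
qed

definition extension :: "('b \<times> 'b) \<Rightarrow>\<^sub>L ('b \<times> 'b) \<Rightarrow> 'a operator \<Rightarrow> bool" where
  "extension Q B \<longleftrightarrow> lagrangian_projection Q \<and> self_adjoint B \<and> A \<subseteq> B \<and>
     T ` Domain B = range (blinfun_apply Q)"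

lemma extension_self_adjoint: "extension Q B \<Longrightarrow> self_adjoint B"
  by (simp add: extension_def)

lemma extension_in_Amax: "extension Q B \<Longrightarrow> p \<in> B \<Longrightarrow> p \<in> Amax"
  using op_adjoint_antimono[of A B] by (auto simp: extension_def self_adjoint_def)

lemma extension_trace: "extension Q B \<Longrightarrow> (u, x) \<in> B \<Longrightarrow> Q (T u) = T u"
  by (smt (verit) DomainI extension_def image_iff lagrangian_projection.idem)

text \<open>
  Green's identity for two different extensions sees only the difference of the boundary projections,
  because the form vanishes on either of the two Lagrangian subspaces.
\<close>

lemma Green_extensions:
  assumes B: "extension Q B" "(u, x) \<in> B" and B': "extension Q' B'" "(v, y) \<in> B'"
  shows "cinner x v - cinner u y = cinner ((Q' - Q) (symplectic_J (T u))) (T v)"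
proof -
  interpret Q: lagrangian_projection Q using B(1) by (simp add: extension_def)
  interpret Q': lagrangian_projection Q' using B'(1) by (simp add: extension_def)
  have u: "Q (T u) = T u" and v: "Q' (T v) = T v"
    using extension_trace B B' by blast+
  have "cinner (Q' (symplectic_J (T u))) (T v) = cinner (symplectic_J (T u)) (T v)"
    by (simp add: Q'.symmetric v)
  moreover have "cinner (Q (symplectic_J (T u))) (T v) = 0"
    using Q.isotropic[of "T u" "T v"] by (simp add: Q.symmetric u)
  ultimately show ?thesis
    using Green[OF extension_in_Amax[OF B] extension_in_Amax[OF B']]
    by (simp add: blinfun.diff_left cinner_diff_left)
qed

text \<open>
  Green's identity for \<open>u\<close> and \<open>R\<^sub>0(cnj \<zeta>) x\<close>, a weak form of Krein's resolvent formula.  It speaks about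
  an arbitrary \<open>u\<close> in the domain of \<open>B\<close>, so that it can be used before \<open>\<zeta>\<close> is known to lie in the resolvent
  set of \<open>B\<close>.
\<close>

lemma resolvent_difference_estimate:
  assumes B0: "extension Q0 B0" and B: "extension Q B" and C: "0 \<le> C"
    and z: "\<zeta> \<notin> spectrum B0" "cnj \<zeta> \<notin> spectrum B0" "norm (resolvent B0 (cnj \<zeta>)) \<le> C" "cmod \<zeta> \<le> C"
    and u: "(u, u') \<in> B"
  defines "L \<equiv> trace_bound\<^sup>2 * (1 + C + C\<^sup>2) * (1 + C)"
  shows "norm (resolvent B0 \<zeta> (u' - \<zeta> *\<^sub>C u) - u) \<le>
    norm (Q - Q0) * L * (norm u + norm (u' - \<zeta> *\<^sub>C u))"
proof (rule norm_le_if_cinner_le)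
  define f where "f = u' - \<zeta> *\<^sub>C u"
  have L0: "L \<ge> 0" unfolding L_def using C trace_bound_nonneg by simp
  then show "0 \<le> norm (Q - Q0) * L * (norm u + norm (u' - \<zeta> *\<^sub>C u))" by simp
  fix x
  define y where "y = resolvent B0 (cnj \<zeta>) x"
  have y: "(y, x + cnj \<zeta> *\<^sub>C y) \<in> B0" unfolding y_def by (rule resolvent_in_graph[OF z(2)])
  have "cinner (resolvent B0 \<zeta> f - u) x = cinner f y - cinner u x"
    using cinner_resolvent[OF extension_self_adjoint[OF B0] z(1,2)]
    by (simp add: y_def cinner_diff_left)
  also have "\<dots> = cinner u' y - cinner u (x + cnj \<zeta> *\<^sub>C y)"
    by (simp add: f_def cinner_simps)
  also have "\<dots> = cinner ((Q0 - Q) (symplectic_J (T u))) (T y)"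
    by (rule Green_extensions[OF B u B0 y])
  also have "cmod \<dots> \<le> (norm (Q0 - Q) * norm (T u)) * norm (T y)"
    using norm_blinfun[of "Q0 - Q" "symplectic_J (T u)"]
    by (intro order_trans[OF Cauchy_Schwarz] mult_right_mono) (simp_all add: norm_symplectic_J)
  finally have main: "cmod (cinner (resolvent B0 \<zeta> f - u) x) \<le> norm (Q - Q0) * norm (T u) * norm (T y)"
    by (simp add: norm_minus_commute)
  have ny: "norm y \<le> C * norm x"
    unfolding y_def by (rule order_trans[OF norm_blinfun]) (simp add: z(3) mult_right_mono)
  have "norm (T y) \<le> trace_bound * (norm y + norm (x + cnj \<zeta> *\<^sub>C y))"
    by (rule norm_T_le[OF extension_in_Amax[OF B0 y]])
  also have "\<dots> \<le> trace_bound * (norm y + (norm x + C * norm y))"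
    using z(4) by (intro mult_left_mono add_left_mono trace_bound_nonneg
        order_trans[OF norm_triangle_ineq]) (simp add: norm_scaleC mult_right_mono)
  also have "\<dots> \<le> trace_bound * (C * norm x + (norm x + C * (C * norm x)))"
    using ny C by (intro mult_left_mono add_mono trace_bound_nonneg order_refl) auto
  finally have Ty: "norm (T y) \<le> trace_bound * ((1 + C + C\<^sup>2) * norm x)"
    by (simp add: algebra_simps power2_eq_square)
  have "norm (T u) \<le> trace_bound * (norm u + norm u')"
    by (rule norm_T_le[OF extension_in_Amax[OF B u]])
  also have "norm u' \<le> norm f + C * norm u"
    using norm_triangle_ineq[of f "\<zeta> *\<^sub>C u"] mult_right_mono[OF z(4), of "norm u"]
    by (simp add: f_def norm_scaleC)
  then have "trace_bound * (norm u + norm u') \<le> trace_bound * ((1 + C) * (norm u + norm f))"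
    using mult_nonneg_nonneg[OF C norm_ge_zero[of f]]
    by (intro mult_left_mono trace_bound_nonneg) (simp add: algebra_simps)
  finally have Tu: "norm (T u) \<le> trace_bound * ((1 + C) * (norm u + norm f))" .
  have "norm (Q - Q0) * norm (T u) * norm (T y) \<le>
      norm (Q - Q0) * (trace_bound * ((1 + C) * (norm u + norm f))) * (trace_bound * ((1 + C + C\<^sup>2) * norm x))"
    using C trace_bound_nonneg by (intro mult_mono Tu Ty order_refl) auto
  also have "\<dots> = norm (Q - Q0) * L * (norm u + norm f) * norm x"
    by (simp add: L_def power2_eq_square algebra_simps)
  finally show "cmod (cinner (resolvent B0 \<zeta> (u' - \<zeta> *\<^sub>C u) - u) x) \<le>
      norm (Q - Q0) * L * (norm u + norm (u' - \<zeta> *\<^sub>C u)) * norm x"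
    using main unfolding f_def by linarith
qed

text \<open>
  If the difference of the boundary projections is so small that \<open>u\<close> on the right hand side of the
  previous estimate can be absorbed, the estimate bounds \<open>B - \<zeta>\<close> from below.  The same holds at the
  conjugate point, and self-adjointness gives the resolvent.
\<close>

lemma extension_resolvent_perturbation:
  assumes B0: "extension Q0 B0" and B: "extension Q B" and C: "0 \<le> C"
    and z: "\<zeta> \<notin> spectrum B0" "cnj \<zeta> \<notin> spectrum B0" "norm (resolvent B0 \<zeta>) \<le> C"
      "norm (resolvent B0 (cnj \<zeta>)) \<le> C" "cmod \<zeta> \<le> C"
    and small: "norm (Q - Q0) * (trace_bound\<^sup>2 * (1 + C + C\<^sup>2) * (1 + C)) \<le> 1 / 2"
  shows "\<zeta> \<notin> spectrum B"
    and "norm (resolvent B \<zeta> - resolvent B0 \<zeta>) \<le>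
      norm (Q - Q0) * (trace_bound\<^sup>2 * (1 + C + C\<^sup>2) * (1 + C) * (2 * C + 2))"
proof -
  define L where "L = trace_bound\<^sup>2 * (1 + C + C\<^sup>2) * (1 + C)"
  have below: "1 / (2 * C + 1) * norm u \<le> norm (u' - w *\<^sub>C u)"
    if w: "w = \<zeta> \<or> w = cnj \<zeta>" and u: "(u, u') \<in> B" for w u u'
  proof -
    define f where "f = u' - w *\<^sub>C u"
    have "norm (resolvent B0 w f - u) \<le> norm (Q - Q0) * L * (norm u + norm f)"
      using resolvent_difference_estimate[OF B0 B C _ _ _ _ u, of w] z w
      unfolding f_def L_def by auto
    also have "\<dots> \<le> 1 / 2 * (norm u + norm f)"
      using small unfolding L_def by (intro mult_right_mono) auto
    finally have 1: "norm (resolvent B0 w f - u) \<le> 1 / 2 * (norm u + norm f)" .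
    have "norm (resolvent B0 w f) \<le> C * norm f"
      using z w by (intro order_trans[OF norm_blinfun] mult_right_mono) auto
    then have "norm u \<le> (2 * C + 1) * norm f"
      using 1 norm_triangle_ineq3[of "resolvent B0 w f" u] by (simp add: algebra_simps abs_le_iff)
    then show ?thesis using C by (simp add: f_def field_simps)
  qed
  have c: "1 / (2 * C + 1) > 0" using C by simp
  show free: "\<zeta> \<notin> spectrum B"
    by (rule bounded_below_imp_not_spectrum(1)[OF extension_self_adjoint[OF B] c]) (use below in auto)
  show "norm (resolvent B \<zeta> - resolvent B0 \<zeta>) \<le>
      norm (Q - Q0) * (trace_bound\<^sup>2 * (1 + C + C\<^sup>2) * (1 + C) * (2 * C + 2))"
  proof (rule norm_blinfun_bound)
    show "0 \<le> norm (Q - Q0) * (trace_bound\<^sup>2 * (1 + C + C\<^sup>2) * (1 + C) * (2 * C + 2))"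
      using C by simp
    fix f
    define u where "u = resolvent B \<zeta> f"
    have u: "(u, f + \<zeta> *\<^sub>C u) \<in> B" unfolding u_def by (rule resolvent_in_graph[OF free])
    have nu: "norm u \<le> (2 * C + 1) * norm f"
      using below[OF _ u, of \<zeta>] C by (simp add: field_simps)
    have "norm (resolvent B0 \<zeta> f - u) \<le> norm (Q - Q0) * L * (norm u + norm f)"
      using resolvent_difference_estimate[OF B0 B C z(1,2,4,5) u] by (simp add: L_def)
    also have "\<dots> \<le> norm (Q - Q0) * L * ((2 * C + 2) * norm f)"
      using C nu by (intro mult_left_mono) (auto simp: L_def algebra_simps)
    finally show "norm ((resolvent B \<zeta> - resolvent B0 \<zeta>) f) \<le>
        norm (Q - Q0) * (trace_bound\<^sup>2 * (1 + C + C\<^sup>2) * (1 + C) * (2 * C + 2)) * norm f"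
      by (simp add: u_def L_def blinfun.diff_left norm_minus_commute mult_ac)
  qed
qed

text \<open>
  On a compact annulus the constants of the preceding estimate are uniform.  The annulus is symmetric
  about the real axis, as needed for the conjugate points.
\<close>

lemma annulus_resolvent_perturbation:
  assumes B0: "extension Q0 B0" and c: "cnj c = c"
    and free: "\<And>\<zeta>. a \<le> norm (\<zeta> - c) \<Longrightarrow> norm (\<zeta> - c) \<le> b \<Longrightarrow> \<zeta> \<notin> spectrum B0"
  shows "\<exists>\<delta>>0. \<exists>M\<ge>0. \<forall>Q B \<zeta>. extension Q B \<longrightarrow> norm (Q - Q0) < \<delta> \<longrightarrow>
    a \<le> norm (\<zeta> - c) \<longrightarrow> norm (\<zeta> - c) \<le> b \<longrightarrow>
    \<zeta> \<notin> spectrum B \<and> norm (resolvent B \<zeta> - resolvent B0 \<zeta>) \<le> norm (Q - Q0) * M"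
proof -
  define K where "K = cball c b - ball c a"
  have K_iff: "\<zeta> \<in> K \<longleftrightarrow> a \<le> norm (\<zeta> - c) \<and> norm (\<zeta> - c) \<le> b" for \<zeta>
    by (auto simp: K_def dist_norm norm_minus_commute)
  have "compact K" unfolding K_def by (intro compact_diff) auto
  moreover have "continuous_on K (resolvent B0)"
    by (rule continuous_on_subset[OF continuous_on_resolvent[OF self_adjoint_subspace[OF extension_self_adjoint[OF B0]]]])
       (use free K_iff in auto)
  ultimately have "bounded (resolvent B0 ` K)" "bounded K"
    by (auto intro: compact_imp_bounded compact_continuous_image)
  then obtain C1 C2 where C12: "\<And>\<zeta>. \<zeta> \<in> K \<Longrightarrow> norm (resolvent B0 \<zeta>) \<le> C1" "\<And>\<zeta>. \<zeta> \<in> K \<Longrightarrow> cmod \<zeta> \<le> C2"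
    unfolding bounded_iff by blast
  define C where "C = \<bar>C1\<bar> + \<bar>C2\<bar>"
  have C: "0 \<le> C" "\<And>\<zeta>. \<zeta> \<in> K \<Longrightarrow> norm (resolvent B0 \<zeta>) \<le> C" "\<And>\<zeta>. \<zeta> \<in> K \<Longrightarrow> cmod \<zeta> \<le> C"
    using C12 by (force simp: C_def)+
  define L where "L = trace_bound\<^sup>2 * (1 + C + C\<^sup>2) * (1 + C)"
  have L: "L \<ge> 0" using C(1) by (simp add: L_def)
  have "\<zeta> \<notin> spectrum B \<and> norm (resolvent B \<zeta> - resolvent B0 \<zeta>) \<le> norm (Q - Q0) * (L * (2 * C + 2))"
    if B: "extension Q B" and q: "norm (Q - Q0) < 1 / (2 * (L + 1))"
      and z: "a \<le> norm (\<zeta> - c)" "norm (\<zeta> - c) \<le> b" for Q B \<zeta>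
  proof -
    have "norm (cnj \<zeta> - c) = norm (\<zeta> - c)"
      using c by (metis complex_cnj_diff complex_mod_cnj)
    with z have K: "\<zeta> \<in> K" "cnj \<zeta> \<in> K" by (simp_all add: K_iff)
    have "norm (Q - Q0) * L \<le> 1 / (2 * (L + 1)) * (L + 1)"
      using q L by (intro mult_mono) auto
    also have "\<dots> = 1 / 2" using L by simp
    finally have small: "norm (Q - Q0) * L \<le> 1 / 2" .
    have *: "\<zeta> \<notin> spectrum B0" "cnj \<zeta> \<notin> spectrum B0" using K free K_iff by blast+
    show ?thesis
      using extension_resolvent_perturbation[OF B0 B C(1) * C(2)[OF K(1)] C(2)[OF K(2)] C(3)[OF K(1)]] small
      by (simp add: L_def)
  qed
  moreover have "1 / (2 * (L + 1)) > 0" "L * (2 * C + 2) \<ge> 0"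
    using L C(1) by auto
  ultimately show ?thesis by blast
qed

end

section \<open>Spectral data of an isolated part of the spectrum\<close>

text \<open>
  What the perturbation argument retains of the contour integrals: an orthogonal projection \<open>P\<close>, the
  operator \<open>N = (B - lam) P\<close>, and an operator \<open>S\<close> with \<open>(B - lam) S = I - P\<close>.
\<close>

definition spectral_data ::
  "'a :: complex_hilbert operator \<Rightarrow> complex \<Rightarrow> 'a \<Rightarrow>\<^sub>L 'a \<Rightarrow> 'a \<Rightarrow>\<^sub>L 'a \<Rightarrow> 'a \<Rightarrow>\<^sub>L 'a \<Rightarrow> bool" where
  "spectral_data B lam P N S \<longleftrightarrow>
     clinear (blinfun_apply P) \<and> clinear (blinfun_apply N) \<and> clinear (blinfun_apply S) \<and>
     (\<forall>x. P (P x) = P x) \<and> (\<forall>x y. cinner (P x) y = cinner x (P y)) \<and>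
     (\<forall>x y. cinner (N x) y = cinner x (N y)) \<and>
     (\<forall>x. (P x, lam *\<^sub>C P x + N x) \<in> B) \<and> (\<forall>x. (S x, lam *\<^sub>C S x + x - P x) \<in> B)"

lemma spectral_data_resolvent_integrals:
  assumes B: "circle_free_of_spectrum B c r" and c: "cnj c = c" and a: "a < r" "r < b"
    and free: "\<And>\<zeta>. a < norm (\<zeta> - c) \<Longrightarrow> norm (\<zeta> - c) < b \<Longrightarrow> \<zeta> \<notin> spectrum B"
  shows "spectral_data B c (resolvent_integral (circlepath c r) (\<lambda>_. 1) B)
    (resolvent_integral (circlepath c r) (\<lambda>\<zeta>. \<zeta> - c) B)
    (resolvent_integral (circlepath c r) (\<lambda>\<zeta>. inverse (c - \<zeta>)) B)"
proof -
  interpret circle_free_of_spectrum B c r by (rule B)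
  have "spectral_data B c riesz_proj eigennilpotent reduced_res"
    unfolding spectral_data_def
    using clinear_riesz_proj clinear_eigennilpotent clinear_reduced_res riesz_proj_idempotent[OF a free] riesz_proj_symmetric[OF c]
      eigennilpotent_symmetric[OF c] riesz_proj_in_graph reduced_res_in_graph by blast
  then show ?thesis by (simp only: riesz_proj_def eigennilpotent_def reduced_res_def)
qed

lemma norm_orthogonal_projection_le:
  fixes P :: "'a :: complex_inner \<Rightarrow>\<^sub>L 'a"
  assumes "\<And>x. P (P x) = P x" "\<And>x y. cinner (P x) y = cinner x (P y)"
  shows "norm P \<le> 1"
proof (rule norm_blinfun_bound)
  fix x
  have "(norm (P x))\<^sup>2 = cmod (cinner (P x) (P x))" by (simp add: cinner_self norm_power)
  also have "\<dots> = cmod (cinner x (P x))" using assms by metis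
  also have "\<dots> \<le> norm x * norm (P x)" by (rule Cauchy_Schwarz)
  finally show "norm (P x) \<le> 1 * norm x"
    by (cases "P x = 0") (auto simp: power2_eq_square)
qed simp

locale spectral_data_of_extension = boundary_value_setting A \<Gamma>0 \<Gamma>1 T
  for A :: "'a :: complex_hilbert operator"
    and \<Gamma>0 \<Gamma>1 :: "'a \<Rightarrow> 'b :: complex_hilbert" and T :: "'a \<Rightarrow> 'b \<times> 'b" +
  fixes Q B lam P N S
  assumes ext: "extension Q B" and data: "spectral_data B lam P N S"
begin

sublocale Q: lagrangian_projection Q using ext by (simp add: extension_def)

lemma clinear_P: "clinear (blinfun_apply P)" and clinear_N: "clinear (blinfun_apply N)"
  and clinear_S: "clinear (blinfun_apply S)" and P_idem: "P (P x) = P x"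
  and P_symmetric: "cinner (P x) y = cinner x (P y)" and N_symmetric: "cinner (N x) y = cinner x (N y)"
  and P_graph: "(P x, lam *\<^sub>C P x + N x) \<in> B" and S_graph: "(S x, lam *\<^sub>C S x + x - P x) \<in> B"
  using data unfolding spectral_data_def by blast+

lemma norm_P_le: "norm P \<le> 1"
  by (rule norm_orthogonal_projection_le[OF P_idem P_symmetric])

lemma N_P: "N (P x) = N x"
proof -
  have "(P x, lam *\<^sub>C P x + N (P x)) \<in> B" using P_graph[of "P x"] by (simp add: P_idem)
  then have "lam *\<^sub>C P x + N (P x) = lam *\<^sub>C P x + N x"
    using P_graph[of x] self_adjoint_single_valued[OF extension_self_adjoint[OF ext]]
    by (blast dest: single_valuedD)
  then show ?thesis by simp
qed

lemma P_N: "P (N x) = N x"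
  by (rule cinner_ext) (simp add: P_symmetric N_symmetric N_P)

lemma in_domain_P: "in_domain P (lam *\<^sub>C P + N)"
  unfolding in_domain_def using extension_in_Amax[OF ext P_graph] by (simp add: blinfun.add_left)

lemma in_domain_S: "in_domain S (lam *\<^sub>C S + id_blinfun - P)"
  unfolding in_domain_def using extension_in_Amax[OF ext S_graph]
  by (simp add: blinfun.add_left blinfun.diff_left)

lemmas trace_P = trace_comp_apply[OF in_domain_P] and trace_S = trace_comp_apply[OF in_domain_S]
lemmas clinear_trace_P = clinear_trace_comp[OF in_domain_P clinear_P]
  and clinear_trace_S = clinear_trace_comp[OF in_domain_S clinear_S]

end

text \<open>
  The index 0 belongs to the unperturbed extension, for which \<open>(B0 - lam) P0 = 0\<close>.
\<close>

locale perturbed_spectral_data =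
  boundary_value_setting A \<Gamma>0 \<Gamma>1 T +
  unperturbed: spectral_data_of_extension A \<Gamma>0 \<Gamma>1 T Q0 B0 lam P0 0 S0 +
  spectral_data_of_extension A \<Gamma>0 \<Gamma>1 T Q B lam P N S
  for A :: "'a :: complex_hilbert operator"
    and \<Gamma>0 \<Gamma>1 :: "'a \<Rightarrow> 'b :: complex_hilbert" and T :: "'a \<Rightarrow> 'b \<times> 'b"
    and Q0 B0 lam P0 S0 Q B P N S +
  assumes lam_real: "cnj lam = lam"
begin

abbreviation "J \<equiv> symplectic_J"
abbreviation "TP0 \<equiv> trace_comp T P0"

lemma J_difference: "(Q - Q0) (J x) = - J ((Q - Q0) x)"
  by (simp add: blinfun.diff_left blinfun.diff_right Q.J_exchange unperturbed.Q.J_exchange)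

lemma unperturbed_graph: "(P0 x, lam *\<^sub>C P0 x) \<in> B0"
  using unperturbed.P_graph[of x] by simp

text \<open>
  For \<open>u\<close> in \<open>ran P0\<close> and any \<open>x\<close> one has \<open>\<langle>(P - I) u, x\<rangle> = \<langle>B0 u, S x\<rangle> - \<langle>u, B S x\<rangle>\<close>, because
  \<open>B0 u = lam u\<close> and \<open>(B - lam) S = I - P\<close>; the right hand side is a boundary term.
\<close>

lemma projection_difference:
  "(P - P0) o\<^sub>L P0 = cadjoint (trace_comp T S) o\<^sub>L (Q - Q0) o\<^sub>L J o\<^sub>L TP0"
proof (rule blinfun_eqI_cinner)
  fix w x
  have "cinner (((P - P0) o\<^sub>L P0) w) x = cinner (lam *\<^sub>C P0 w) (S x) - cinner (P0 w) (lam *\<^sub>C S x + x - P x)"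
    by (simp add: blinfun.diff_left unperturbed.P_idem cinner_simps P_symmetric lam_real)
  also have "\<dots> = cinner ((Q - Q0) (J (T (P0 w)))) (T (S x))"
    by (rule Green_extensions[OF unperturbed.ext unperturbed_graph ext S_graph])
  finally show "cinner (((P - P0) o\<^sub>L P0) w) x =
      cinner ((cadjoint (trace_comp T S) o\<^sub>L (Q - Q0) o\<^sub>L J o\<^sub>L TP0) w) x"
    by (simp add: cinner_cadjoint[OF clinear_trace_S] trace_S unperturbed.trace_P)
qed

text \<open>
  As before, with \<open>P x\<close> in place of \<open>S x\<close>: \<open>\<langle>B0 u, P x\<rangle> - \<langle>u, B P x\<rangle> = - \<langle>u, N x\<rangle>\<close>.
\<close>

lemma compression_half:
  "N o\<^sub>L P0 = - (cadjoint (trace_comp T P) o\<^sub>L (Q - Q0) o\<^sub>L J o\<^sub>L TP0)"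
proof (rule blinfun_eqI_cinner)
  fix w x
  have "- cinner ((N o\<^sub>L P0) w) x = cinner (lam *\<^sub>C P0 w) (P x) - cinner (P0 w) (lam *\<^sub>C P x + N x)"
    by (simp add: cinner_simps N_symmetric lam_real)
  also have "\<dots> = cinner ((Q - Q0) (J (T (P0 w)))) (T (P x))"
    by (rule Green_extensions[OF unperturbed.ext unperturbed_graph ext P_graph])
  finally have "cinner ((N o\<^sub>L P0) w) x = - cinner ((Q - Q0) (J (T (P0 w)))) (T (P x))"
    by (metis minus_minus)
  then show "cinner ((N o\<^sub>L P0) w) x =
      cinner (blinfun_apply (- (cadjoint (trace_comp T P) o\<^sub>L (Q - Q0) o\<^sub>L J o\<^sub>L TP0)) w) x"
    by (simp add: cinner_cadjoint[OF clinear_trace_P] trace_P unperturbed.trace_P blinfun.minus_left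
        cinner_minus_left)
qed

lemma in_domain_P_P0: "in_domain (P o\<^sub>L P0) ((lam *\<^sub>C P + N) o\<^sub>L P0)"
  by (rule in_domain_compose[OF in_domain_P])

lemma clinear_trace_P_P0: "clinear (blinfun_apply (trace_comp T (P o\<^sub>L P0)))"
  by (rule clinear_trace_comp[OF in_domain_P_P0 clinear_compose[OF clinear_P unperturbed.clinear_P]])

lemma compression:
  "P0 o\<^sub>L N o\<^sub>L P0 = - (cadjoint (trace_comp T (P o\<^sub>L P0)) o\<^sub>L (Q - Q0) o\<^sub>L J o\<^sub>L TP0)"
proof (rule blinfun_eqI_cinner)
  fix w x
  have "cinner ((P0 o\<^sub>L N o\<^sub>L P0) w) x = cinner ((N o\<^sub>L P0) w) (P0 x)"
    by (simp add: unperturbed.P_symmetric)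
  also have "\<dots> = - cinner ((Q - Q0) (J (TP0 w))) (T (P (P0 x)))"
    unfolding compression_half
    by (simp add: blinfun.minus_left cinner_minus_left cinner_cadjoint[OF clinear_trace_P] trace_P)
  finally show "cinner ((P0 o\<^sub>L N o\<^sub>L P0) w) x =
      cinner (blinfun_apply (- (cadjoint (trace_comp T (P o\<^sub>L P0)) o\<^sub>L (Q - Q0) o\<^sub>L J o\<^sub>L TP0)) w) x"
    by (simp add: blinfun.minus_left cinner_minus_left cinner_cadjoint[OF clinear_trace_P_P0]
        trace_comp_apply[OF in_domain_P_P0])
qed

lemma norm_trace_P_difference_le:
  "norm (trace_comp T P - TP0) \<le> trace_bound * ((1 + cmod lam) * norm (P - P0) + norm N)"
proof -
  have "norm (trace_comp T P - TP0) \<le> trace_bound * (norm (P - P0) + norm ((lam *\<^sub>C P + N) - (lam *\<^sub>C P0 + 0)))"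
    unfolding trace_comp_diff[OF in_domain_P unperturbed.in_domain_P, symmetric]
    by (rule norm_trace_comp_le[OF in_domain_diff[OF in_domain_P unperturbed.in_domain_P]])
  also have "(lam *\<^sub>C P + N) - (lam *\<^sub>C P0 + 0) = lam *\<^sub>C (P - P0) + N"
    by (simp add: bounded_bilinear.diff_right[OF bounded_bilinear_scaleC_blinfun])
  also have "trace_bound * (norm (P - P0) + norm (lam *\<^sub>C (P - P0) + N)) \<le>
      trace_bound * (norm (P - P0) + (cmod lam * norm (P - P0) + norm N))"
    by (intro mult_left_mono add_left_mono order_trans[OF norm_triangle_ineq] add_right_mono
        norm_scaleC_blinfun_le trace_bound_nonneg)
  finally show ?thesis by (simp add: algebra_simps)
qed

lemma norm_trace_S_difference_le:
  "norm (trace_comp T S - trace_comp T S0) \<le>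
    trace_bound * ((1 + cmod lam) * norm (S - S0) + norm (P - P0))"
proof -
  let ?Y = "lam *\<^sub>C S + id_blinfun - P" and ?W = "lam *\<^sub>C S0 + id_blinfun - P0"
  have "norm (trace_comp T S - trace_comp T S0) \<le> trace_bound * (norm (S - S0) + norm (?Y - ?W))"
    unfolding trace_comp_diff[OF in_domain_S unperturbed.in_domain_S, symmetric]
    by (rule norm_trace_comp_le[OF in_domain_diff[OF in_domain_S unperturbed.in_domain_S]])
  also have "?Y - ?W = lam *\<^sub>C (S - S0) - (P - P0)"
    by (simp add: bounded_bilinear.diff_right[OF bounded_bilinear_scaleC_blinfun])
  also have "trace_bound * (norm (S - S0) + norm (lam *\<^sub>C (S - S0) - (P - P0))) \<le>
      trace_bound * (norm (S - S0) + (cmod lam * norm (S - S0) + norm (P - P0)))"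
    by (intro mult_left_mono add_left_mono order_trans[OF norm_triangle_ineq4] add_right_mono
        norm_scaleC_blinfun_le trace_bound_nonneg)
  finally show ?thesis by (simp add: algebra_simps)
qed

text \<open>
  On \<open>ran P\<close> the operator \<open>B\<close> is \<open>lam + N\<close>, and \<open>U\<close> maps \<open>ran P0\<close> into \<open>ran P\<close>.  The factors
  \<open>Z = (I - D\<^sup>2)\<^sup>-\<^sup>1\<^sup>/\<^sup>2\<close> of \<open>U\<close> and of its inverse commute with both projections, which leaves \<open>Z N Z\<close>
  between them.
\<close>

lemma transformed_operator:
  assumes close: "norm (P - P0) < 1"
  defines "U \<equiv> transformation_operator P0 P" and "Z \<equiv> inv_sqrt_one_minus ((P - P0) o\<^sub>L (P - P0))"
  shows "Blinfun (\<lambda>u. blinfun_apply (P0 o\<^sub>L op_inverse U) (op_apply B (blinfun_apply (U o\<^sub>L P0) u))) =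
    lam *\<^sub>C P0 + (P0 o\<^sub>L P o\<^sub>L Z o\<^sub>L N o\<^sub>L Z o\<^sub>L P o\<^sub>L P0)" (is "_ = ?W")
proof -
  interpret cp: close_projections P0 P
    by unfold_locales (use unperturbed.P_idem P_idem close in auto)
  have Z_scale: "Z (lam *\<^sub>C x) = lam *\<^sub>C Z x" for x
    using inv_sqrt_commute[OF cp.norm_X, of "lam *\<^sub>C id_blinfun" x]
    by (simp add: Z_def clinear_scaleC[OF clinear_diff[OF clinear_P unperturbed.clinear_P]])
  have inv: "P0 (op_inverse U x) = P0 (P (Z x))" for x
    unfolding U_def Z_def by (rule cp.inverse_transformation_on_range)
  have inv_U: "op_inverse U (U x) = x" for x
    by (simp add: U_def cp.op_inverse_transformation cp.V_transformation)
  have "blinfun_apply (P0 o\<^sub>L op_inverse U) (op_apply B (blinfun_apply (U o\<^sub>L P0) u)) = ?W u" for u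
  proof -
    define v where "v = Z (P (P0 u))"
    have v: "U (P0 u) = v" unfolding U_def v_def Z_def by (rule cp.transformation_on_range)
    have Pv: "P v = v" unfolding v_def Z_def by (simp add: cp.Z_commute P_idem)
    have "op_apply B v = lam *\<^sub>C v + N v"
      using P_graph[of v] Pv self_adjoint_single_valued[OF extension_self_adjoint[OF ext]]
      by (intro op_apply_eq) simp_all
    then have "blinfun_apply (P0 o\<^sub>L op_inverse U) (op_apply B (blinfun_apply (U o\<^sub>L P0) u)) =
        P0 (P (Z (lam *\<^sub>C v + N v)))"
      by (simp add: v inv)
    also have "\<dots> = lam *\<^sub>C P0 (P (Z v)) + P0 (P (Z (N v)))"
      by (simp add: blinfun.add_right Z_scale clinear_scaleC[OF clinear_P]
          clinear_scaleC[OF unperturbed.clinear_P])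
    also have "P0 (P (Z v)) = P0 (op_inverse U (U (P0 u)))"
      by (simp add: v inv)
    also have "\<dots> = P0 u"
      by (simp add: inv_U unperturbed.P_idem)
    finally show ?thesis
      by (simp add: blinfun.add_left v_def)
  qed
  then show ?thesis by (simp add: blinfun_apply_inverse)
qed

text \<open>
  Write \<open>Z = I + E\<close> with \<open>norm E \<le> 2 d\<^sup>2\<close>, \<open>d = norm (P - P0)\<close>.  As \<open>N = P N P\<close>, every term of the
  difference contains \<open>N\<close> and at least one factor \<open>E\<close>.
\<close>

lemma norm_transformed_operator_difference_le:
  assumes close: "norm (P - P0) \<le> 1 / 2"
  defines "Z \<equiv> inv_sqrt_one_minus ((P - P0) o\<^sub>L (P - P0))"
  shows "norm ((P0 o\<^sub>L P o\<^sub>L Z o\<^sub>L N o\<^sub>L Z o\<^sub>L P o\<^sub>L P0) - (P0 o\<^sub>L N o\<^sub>L P0)) \<le> 6 * (norm (P - P0))\<^sup>2 * norm N"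
proof -
  define E where "E = Z - id_blinfun"
  define d where "d = norm (P - P0)"
  interpret cp: close_projections P0 P
    by unfold_locales (use unperturbed.P_idem P_idem close in auto)
  have d: "0 \<le> d" "d\<^sup>2 \<le> 1 / 4"
    using close power_mono[of d "1/2" 2] by (auto simp: d_def power2_eq_square)
  have "norm cp.X \<le> 1 / 2" using cp.norm_X_le d by (simp add: d_def)
  then have "norm E \<le> 2 * norm cp.X"
    unfolding E_def Z_def by (rule norm_inv_sqrt_minus_id_le)
  then have E: "norm E \<le> 2 * d\<^sup>2" using cp.norm_X_le by (simp add: d_def)
  have Z: "Z x = x + E x" for x by (simp add: E_def blinfun.diff_left)
  let ?R = "(E o\<^sub>L N) + (N o\<^sub>L E) + (E o\<^sub>L N o\<^sub>L E)"
  have "(P0 o\<^sub>L P o\<^sub>L Z o\<^sub>L N o\<^sub>L Z o\<^sub>L P o\<^sub>L P0) - (P0 o\<^sub>L N o\<^sub>L P0) = P0 o\<^sub>L P o\<^sub>L ?R o\<^sub>L P o\<^sub>L P0"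
    by (rule blinfun_eqI) (simp add: blinfun.diff_left blinfun.add_left blinfun.add_right Z N_P P_N algebra_simps)
  also have "norm \<dots> \<le> norm ?R"
  proof -
    have le: "norm (X o\<^sub>L P) \<le> norm X" "norm (P o\<^sub>L X) \<le> norm X"
      "norm (X o\<^sub>L P0) \<le> norm X" "norm (P0 o\<^sub>L X) \<le> norm X" for X :: "'a \<Rightarrow>\<^sub>L 'a"
      using norm_blinfun_compose[of X P] norm_blinfun_compose[of P X]
        norm_blinfun_compose[of X P0] norm_blinfun_compose[of P0 X]
        mult_left_mono[OF norm_P_le, of "norm X"] mult_left_mono[OF unperturbed.norm_P_le, of "norm X"]
      by (auto simp: mult.commute)
    have assoc: "P0 o\<^sub>L P o\<^sub>L ?R o\<^sub>L P o\<^sub>L P0 = P0 o\<^sub>L (P o\<^sub>L (?R o\<^sub>L P o\<^sub>L P0))"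
      by (rule blinfun_eqI) simp
    show ?thesis unfolding assoc by (meson le order_trans)
  qed
  also have "\<dots> \<le> norm E * norm N + norm N * norm E + norm E * norm N * norm E"
    by (intro order_trans[OF norm_triangle_ineq] add_mono norm_blinfun_compose
        order_trans[OF norm_blinfun_compose] mult_right_mono) auto
  also have "\<dots> = norm N * (norm E * (2 + norm E))" by (simp add: algebra_simps)
  also have "\<dots> \<le> norm N * (2 * d\<^sup>2 * (2 + 1))"
    using E d by (intro mult_left_mono mult_mono) auto
  finally show ?thesis by (simp add: d_def algebra_simps)
qed

end

section \<open>Second order expansion\<close>

lemma bigo_cmult:
  fixes f :: "'t \<Rightarrow> real"
  assumes "f \<in> O[F](g)"
  shows "(\<lambda>t. c * f t) \<in> O[F](g)"
  using landau_o.big.mult[of "\<lambda>_. c" F "\<lambda>_. 1" f g] assms by simp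

locale infinitesimal =
  fixes F :: "'t filter" and \<tau> :: "'t \<Rightarrow> real"
  assumes nontrivial: "F \<noteq> bot" and \<tau>_nonzero: "\<forall>\<^sub>F t in F. \<tau> t \<noteq> 0" and \<tau>_tendsto: "(\<tau> \<longlongrightarrow> 0) F"
begin

definition has_order :: "nat \<Rightarrow> ('t \<Rightarrow> 'a :: real_normed_vector \<Rightarrow>\<^sub>L 'b :: real_normed_vector) \<Rightarrow> bool" where
  "has_order k X \<longleftrightarrow> (\<lambda>t. norm (X t)) \<in> O[F](\<lambda>t. \<tau> t ^ k)"

lemma has_order_dominated:
  assumes "\<forall>\<^sub>F t in F. norm (X t) \<le> h t" "h \<in> O[F](\<lambda>t. \<tau> t ^ k)"
  shows "has_order k X"
  unfolding has_order_def
proof (rule landau_o.big_trans[OF _ assms(2)])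
  show "(\<lambda>t. norm (X t)) \<in> O[F](h)"
    using assms(1) by (intro bigoI[of _ 1]) (auto elim!: eventually_mono)
qed

lemma has_order_cong:
  assumes "\<forall>\<^sub>F t in F. X t = Y t" "has_order k Y"
  shows "has_order k X"
proof (rule has_order_dominated)
  show "\<forall>\<^sub>F t in F. norm (X t) \<le> norm (Y t)" using assms(1) by eventually_elim simp
  show "(\<lambda>t. norm (Y t)) \<in> O[F](\<lambda>t. \<tau> t ^ k)" using assms(2) by (simp add: has_order_def)
qed

lemma has_order_const: "has_order 0 (\<lambda>_. C)"
  unfolding has_order_def by simp

lemma has_order_add:
  assumes "has_order k X" "has_order k Y"
  shows "has_order k (\<lambda>t. X t + Y t)"
proof (rule has_order_dominated)
  show "\<forall>\<^sub>F t in F. norm (X t + Y t) \<le> norm (X t) + norm (Y t)"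
    by (simp add: norm_triangle_ineq)
  show "(\<lambda>t. norm (X t) + norm (Y t)) \<in> O[F](\<lambda>t. \<tau> t ^ k)"
    using assms by (intro sum_in_bigo) (simp_all add: has_order_def)
qed

lemma has_order_uminus: "has_order k X \<Longrightarrow> has_order k (\<lambda>t. - X t)"
  unfolding has_order_def by simp

lemma has_order_compose:
  assumes "has_order j X" "has_order k Y"
  shows "has_order (j + k) (\<lambda>t. X t o\<^sub>L Y t)"
proof (rule has_order_dominated)
  show "\<forall>\<^sub>F t in F. norm (X t o\<^sub>L Y t) \<le> norm (X t) * norm (Y t)"
    by (simp add: norm_blinfun_compose)
  show "(\<lambda>t. norm (X t) * norm (Y t)) \<in> O[F](\<lambda>t. \<tau> t ^ (j + k))"
    using landau_o.big.mult[OF assms[unfolded has_order_def]] by (simp add: power_add)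
qed

lemma has_order_scaleR:
  assumes "has_order k X"
  shows "has_order (Suc k) (\<lambda>t. \<tau> t *\<^sub>R X t)"
proof -
  have "(\<lambda>t. \<bar>\<tau> t\<bar>) \<in> O[F](\<tau>)" by (rule bigoI[of _ 1]) simp
  from landau_o.big.mult[OF this assms[unfolded has_order_def]] show ?thesis
    by (simp add: has_order_def)
qed

lemma has_order_weaken:
  assumes "has_order (Suc k) X"
  shows "has_order k X"
proof -
  have "\<tau> \<in> O[F](\<lambda>_. 1)"
    using \<tau>_tendsto by (intro bigoI_tendsto[of _ _ 0]) auto
  then have "(\<lambda>t. \<tau> t * \<tau> t ^ k) \<in> O[F](\<lambda>t. 1 * \<tau> t ^ k)"
    by (intro landau_o.big.mult landau_o.big_refl)
  then show ?thesis
    using assms unfolding has_order_def by (auto intro: landau_o.big_trans)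
qed

lemma has_order_cadjoint:
  fixes X :: "'t \<Rightarrow> 'a :: complex_hilbert \<Rightarrow>\<^sub>L 'b :: complex_inner"
  assumes "has_order k X" "\<forall>\<^sub>F t in F. clinear (blinfun_apply (X t))"
  shows "has_order k (\<lambda>t. cadjoint (X t))"
proof (rule has_order_dominated)
  show "\<forall>\<^sub>F t in F. norm (cadjoint (X t)) \<le> norm (X t)"
    using assms(2) by eventually_elim (rule norm_cadjoint_le)
  show "(\<lambda>t. norm (X t)) \<in> O[F](\<lambda>t. \<tau> t ^ k)" using assms(1) by (simp add: has_order_def)
qed

lemma has_order_tendsto_0:
  assumes "has_order 1 X"
  shows "((\<lambda>t. norm (X t)) \<longlongrightarrow> 0) F"
proof -
  obtain c where "\<forall>\<^sub>F t in F. norm (norm (X t)) \<le> c * norm (\<tau> t ^ 1)"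
    using assms unfolding has_order_def by (rule landau_o.bigE)
  then have "\<forall>\<^sub>F t in F. norm (norm (X t)) \<le> c * \<bar>\<tau> t\<bar>" by simp
  moreover have "((\<lambda>t. c * \<bar>\<tau> t\<bar>) \<longlongrightarrow> c * \<bar>0\<bar>) F"
    by (intro tendsto_intros \<tau>_tendsto)
  ultimately show ?thesis by (intro Lim_null_comparison[of "\<lambda>t. norm (X t)"]) auto
qed

lemma has_order_quotient_tendsto:
  assumes "has_order 2 X"
  shows "((\<lambda>t. (1 / \<tau> t) *\<^sub>R X t x) \<longlongrightarrow> 0) F"
proof -
  obtain c where "\<forall>\<^sub>F t in F. norm (norm (X t)) \<le> c * norm (\<tau> t ^ 2)"
    using assms unfolding has_order_def by (rule landau_o.bigE)
  then have "\<forall>\<^sub>F t in F. norm ((1 / \<tau> t) *\<^sub>R X t x) \<le> c * norm x * \<bar>\<tau> t\<bar>"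
    using \<tau>_nonzero
  proof eventually_elim
    case (elim t)
    define a where "a = \<bar>\<tau> t\<bar>"
    have a: "a > 0" "norm (\<tau> t ^ 2) = a * a"
      using elim(2) by (auto simp: a_def power2_eq_square)
    have "norm (X t x) \<le> (c * (a * a)) * norm x"
      unfolding a(2)[symmetric] using elim(1) by (intro order_trans[OF norm_blinfun] mult_right_mono) auto
    then have "(1 / a) * norm (X t x) \<le> (1 / a) * ((c * (a * a)) * norm x)"
      using a(1) by (intro mult_left_mono) auto
    moreover have "norm ((1 / \<tau> t) *\<^sub>R X t x) = (1 / a) * norm (X t x)"
      by (simp add: a_def)
    ultimately have "norm ((1 / \<tau> t) *\<^sub>R X t x) \<le> (1 / a) * ((c * (a * a)) * norm x)"
      by (simp only:)
    also have "(1 / a) * ((c * (a * a)) * norm x) = c * norm x * \<bar>\<tau> t\<bar>"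
      unfolding a_def[symmetric] using a(1) by simp
    finally show ?case .
  qed
  moreover have "((\<lambda>t. c * norm x * \<bar>\<tau> t\<bar>) \<longlongrightarrow> c * norm x * \<bar>0\<bar>) F"
    by (intro tendsto_intros \<tau>_tendsto)
  then have "((\<lambda>t. c * norm x * \<bar>\<tau> t\<bar>) \<longlongrightarrow> 0) F" by simp
  ultimately show ?thesis by (rule Lim_null_comparison)
qed

lemma has_order_3_smallo:
  assumes "has_order 3 X"
  shows "(\<lambda>t. norm (X t)) \<in> o[F](\<lambda>t. (\<tau> t)\<^sup>2)"
proof -
  have "\<tau> \<in> o[F](\<lambda>_. 1)"
    using \<tau>_tendsto by (intro smalloI_tendsto) auto
  then have "(\<lambda>t. \<tau> t * (\<tau> t)\<^sup>2) \<in> o[F](\<lambda>t. 1 * (\<tau> t)\<^sup>2)"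
    by (intro landau_o.small_big_mult landau_o.big_refl)
  then have "(\<lambda>t. \<tau> t ^ 3) \<in> o[F](\<lambda>t. (\<tau> t)\<^sup>2)"
    by (simp add: power3_eq_cube power2_eq_square mult.assoc)
  then show ?thesis
    using assms unfolding has_order_def by (rule landau_o.big_small_trans[rotated])
qed

lemma Taylor_expansion_orders:
  assumes "(\<lambda>t. norm (X t - (X0 + \<tau> t *\<^sub>R Xd + ((\<tau> t)\<^sup>2 / 2) *\<^sub>R Xdd))) \<in> o[F](\<lambda>t. (\<tau> t)\<^sup>2)"
  shows "has_order 2 (\<lambda>t. X t - X0 - \<tau> t *\<^sub>R Xd)" and "has_order 1 (\<lambda>t. X t - X0)"
proof -
  define Y where "Y t = X t - (X0 + \<tau> t *\<^sub>R Xd + ((\<tau> t)\<^sup>2 / 2) *\<^sub>R Xdd)" for t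
  have "has_order 2 Y"
    using landau_o.small_imp_big[OF assms] by (simp add: has_order_def Y_def)
  moreover have "has_order (Suc (Suc 0)) (\<lambda>t. \<tau> t *\<^sub>R \<tau> t *\<^sub>R (1 / 2) *\<^sub>R Xdd)"
    by (intro has_order_scaleR has_order_const)
  then have "has_order 2 (\<lambda>t. \<tau> t *\<^sub>R \<tau> t *\<^sub>R (1 / 2) *\<^sub>R Xdd)" by (simp add: numeral_2_eq_2)
  ultimately have "has_order 2 (\<lambda>t. Y t + \<tau> t *\<^sub>R \<tau> t *\<^sub>R (1 / 2) *\<^sub>R Xdd)"
    by (rule has_order_add)
  also have "(\<lambda>t. Y t + \<tau> t *\<^sub>R \<tau> t *\<^sub>R (1 / 2) *\<^sub>R Xdd) = (\<lambda>t. X t - X0 - \<tau> t *\<^sub>R Xd)"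
    by (simp add: Y_def fun_eq_iff power2_eq_square algebra_simps)
  finally show first: "has_order 2 (\<lambda>t. X t - X0 - \<tau> t *\<^sub>R Xd)" .
  have "has_order (Suc 0) (\<lambda>t. \<tau> t *\<^sub>R Xd)"
    by (intro has_order_scaleR has_order_const)
  moreover have "has_order (Suc 0) (\<lambda>t. X t - X0 - \<tau> t *\<^sub>R Xd)"
    by (rule has_order_weaken) (use first in \<open>simp add: numeral_2_eq_2\<close>)
  ultimately have "has_order (Suc 0) (\<lambda>t. \<tau> t *\<^sub>R Xd + (X t - X0 - \<tau> t *\<^sub>R Xd))"
    by (rule has_order_add)
  then show "has_order 1 (\<lambda>t. X t - X0)" by simp
qed

end

lemma smallo_dominated:
  fixes f h :: "'t \<Rightarrow> real"
  assumes "\<forall>\<^sub>F t in F. norm (f t) \<le> h t" "h \<in> o[F](g)"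
  shows "f \<in> o[F](g)"
proof (rule landau_o.big_small_trans[OF _ assms(2)])
  show "f \<in> O[F](h)"
    using assms(1) by (intro bigoI[of _ 1]) (auto elim!: eventually_mono)
qed

locale perturbed_family =
  boundary_value_setting A \<Gamma>0 \<Gamma>1 T +
  unperturbed: spectral_data_of_extension A \<Gamma>0 \<Gamma>1 T Q0 B0 lam P0 0 S0 +
  infinitesimal F \<tau>
  for A :: "'a :: complex_hilbert operator"
    and \<Gamma>0 \<Gamma>1 :: "'a \<Rightarrow> 'b :: complex_hilbert" and T :: "'a \<Rightarrow> 'b \<times> 'b"
    and Q0 B0 lam P0 S0 and F :: "'t filter" and \<tau> +
  fixes Q B P N S Qd Qdd
  assumes lam_real: "cnj lam = lam"
    and family: "\<forall>\<^sub>F t in F. spectral_data_of_extension A \<Gamma>0 \<Gamma>1 T (Q t) (B t) lam (P t) (N t) (S t)"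
    and P_order: "has_order 1 (\<lambda>t. P t - P0)" and N_order: "has_order 1 N"
    and S_order: "has_order 1 (\<lambda>t. S t - S0)"
    and Q_expansion: "(\<lambda>t. norm (Q t - (Q0 + \<tau> t *\<^sub>R Qd + ((\<tau> t)\<^sup>2 / 2) *\<^sub>R Qdd))) \<in> o[F](\<lambda>t. (\<tau> t)\<^sup>2)"
    and Qd_clinear: "clinear (blinfun_apply Qd)"
begin

abbreviation "J \<equiv> symplectic_J"
abbreviation "TP0 \<equiv> trace_comp T P0"
abbreviation "TS0 \<equiv> trace_comp T S0"

lemma perturbed:
  "\<forall>\<^sub>F t in F. perturbed_spectral_data A \<Gamma>0 \<Gamma>1 T Q0 B0 lam P0 S0 (Q t) (B t) (P t) (N t) (S t)"
  using family
  by eventually_elim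
     (intro perturbed_spectral_data.intro boundary_value_setting_axioms
       unperturbed.spectral_data_of_extension_axioms perturbed_spectral_data_axioms.intro lam_real)

definition rem1 where "rem1 t = Q t - Q0 - \<tau> t *\<^sub>R Qd"
definition rem2 where "rem2 t = Q t - (Q0 + \<tau> t *\<^sub>R Qd + ((\<tau> t)\<^sup>2 / 2) *\<^sub>R Qdd)"

lemma rem1_order: "has_order 2 rem1"
  using Taylor_expansion_orders(1)[OF Q_expansion] by (simp add: rem1_def[abs_def])

lemmas Q_order = Taylor_expansion_orders(2)[OF Q_expansion]

lemma trace_P_order: "has_order 1 (\<lambda>t. trace_comp T (P t) - TP0)"
proof (rule has_order_dominated)
  show "\<forall>\<^sub>F t in F. norm (trace_comp T (P t) - TP0) \<le>
      trace_bound * ((1 + cmod lam) * norm (P t - P0) + norm (N t))"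
    using perturbed by eventually_elim (rule perturbed_spectral_data.norm_trace_P_difference_le)
  show "(\<lambda>t. trace_bound * ((1 + cmod lam) * norm (P t - P0) + norm (N t))) \<in> O[F](\<lambda>t. \<tau> t ^ 1)"
    using P_order N_order unfolding has_order_def
    by (intro bigo_cmult sum_in_bigo)
qed

lemma trace_S_order: "has_order 1 (\<lambda>t. trace_comp T (S t) - TS0)"
proof (rule has_order_dominated)
  show "\<forall>\<^sub>F t in F. norm (trace_comp T (S t) - TS0) \<le>
      trace_bound * ((1 + cmod lam) * norm (S t - S0) + norm (P t - P0))"
    using perturbed by eventually_elim (rule perturbed_spectral_data.norm_trace_S_difference_le)
  show "(\<lambda>t. trace_bound * ((1 + cmod lam) * norm (S t - S0) + norm (P t - P0))) \<in> O[F](\<lambda>t. \<tau> t ^ 1)"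
    using P_order S_order unfolding has_order_def
    by (intro bigo_cmult sum_in_bigo)
qed

text \<open>
  \<open>G\<close> is the derivative of \<open>P\<^sub>t P0\<close>, and \<open>- H\<close> that of \<open>N\<^sub>t P0\<close>.
\<close>

definition G where "G = cadjoint TS0 o\<^sub>L Qd o\<^sub>L J o\<^sub>L TP0"
definition H where "H = cadjoint TP0 o\<^sub>L Qd o\<^sub>L J o\<^sub>L TP0"
definition errP where "errP t = ((P t - P0) o\<^sub>L P0) - \<tau> t *\<^sub>R G"
definition errN where "errN t = (N t o\<^sub>L P0) + \<tau> t *\<^sub>R H"

text \<open>
  In each term on the right two factors are small, or one factor is of second order.
\<close>

lemma product_expansion:
  "(C o\<^sub>L (Q t - Q0) o\<^sub>L J o\<^sub>L TP0) - \<tau> t *\<^sub>R (C0 o\<^sub>L Qd o\<^sub>L J o\<^sub>L TP0) =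
    ((C - C0) o\<^sub>L (Q t - Q0) o\<^sub>L J o\<^sub>L TP0) + (C0 o\<^sub>L rem1 t o\<^sub>L J o\<^sub>L TP0)"
  by (rule blinfun_eqI)
     (simp add: rem1_def blinfun.diff_left blinfun.diff_right blinfun.add_left blinfun.scaleR_left blinfun.scaleR_right)

lemma product_expansion_order:
  assumes "has_order 1 (\<lambda>t. C t - C0)"
  shows "has_order 2 (\<lambda>t. ((C t - C0) o\<^sub>L (Q t - Q0) o\<^sub>L J o\<^sub>L TP0) + (C0 o\<^sub>L rem1 t o\<^sub>L J o\<^sub>L TP0))"
  using has_order_compose[OF has_order_compose[OF has_order_compose[OF assms Q_order] has_order_const] has_order_const, of J TP0]
    has_order_compose[OF has_order_compose[OF has_order_compose[OF has_order_const rem1_order] has_order_const] has_order_const, of C0 J TP0]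
  by (intro has_order_add) (simp_all add: numeral_2_eq_2)

lemma errP_order: "has_order 2 errP"
proof (rule has_order_cong[OF _ product_expansion_order])
  have clin: "\<forall>\<^sub>F t in F. clinear (blinfun_apply (trace_comp T (S t)))"
    using family by eventually_elim (rule spectral_data_of_extension.clinear_trace_S)
  show "has_order 1 (\<lambda>t. cadjoint (trace_comp T (S t)) - cadjoint TS0)"
  proof (rule has_order_cong)
    show "\<forall>\<^sub>F t in F. cadjoint (trace_comp T (S t)) - cadjoint TS0 = cadjoint (trace_comp T (S t) - TS0)"
      using clin by eventually_elim (simp add: cadjoint_diff unperturbed.clinear_trace_S)
    show "has_order 1 (\<lambda>t. cadjoint (trace_comp T (S t) - TS0))"
      using clin by (intro has_order_cadjoint trace_S_order)
        (auto elim!: eventually_mono intro: clinear_diff unperturbed.clinear_trace_S)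
  qed
  show "\<forall>\<^sub>F t in F. errP t = ((cadjoint (trace_comp T (S t)) - cadjoint TS0) o\<^sub>L (Q t - Q0) o\<^sub>L J o\<^sub>L TP0) +
      (cadjoint TS0 o\<^sub>L rem1 t o\<^sub>L J o\<^sub>L TP0)"
    using perturbed
    by eventually_elim
       (simp add: errP_def G_def perturbed_spectral_data.projection_difference flip: product_expansion)
qed

lemma errN_order: "has_order 2 errN"
proof (rule has_order_cong[OF _ has_order_uminus[OF product_expansion_order]])
  have clin: "\<forall>\<^sub>F t in F. clinear (blinfun_apply (trace_comp T (P t)))"
    using family by eventually_elim (rule spectral_data_of_extension.clinear_trace_P)
  show "has_order 1 (\<lambda>t. cadjoint (trace_comp T (P t)) - cadjoint TP0)"
  proof (rule has_order_cong)
    show "\<forall>\<^sub>F t in F. cadjoint (trace_comp T (P t)) - cadjoint TP0 = cadjoint (trace_comp T (P t) - TP0)"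
      using clin by eventually_elim (simp add: cadjoint_diff unperturbed.clinear_trace_P)
    show "has_order 1 (\<lambda>t. cadjoint (trace_comp T (P t) - TP0))"
      using clin by (intro has_order_cadjoint trace_P_order)
        (auto elim!: eventually_mono intro: clinear_diff unperturbed.clinear_trace_P)
  qed
  show "\<forall>\<^sub>F t in F. errN t = - (((cadjoint (trace_comp T (P t)) - cadjoint TP0) o\<^sub>L (Q t - Q0) o\<^sub>L J o\<^sub>L TP0) +
      (cadjoint TP0 o\<^sub>L rem1 t o\<^sub>L J o\<^sub>L TP0))"
    using perturbed
    by eventually_elim
       (simp add: errN_def H_def perturbed_spectral_data.compression_half flip: product_expansion)
qed

text \<open>
  That the first order coefficient \<open>G\<close> maps into the domain of \<open>A*\<close> follows from the closedness of
  \<open>A*\<close>: both the difference quotients of \<open>P\<^sub>t P0\<close> and their images under \<open>A*\<close> converge.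
\<close>

lemma in_domain_G: "in_domain G (lam *\<^sub>C G - H)"
  unfolding in_domain_def
proof
  fix x
  let ?f = "\<lambda>t. (1 / \<tau> t) *\<^sub>R (P t (P0 x) - P0 x)"
  let ?g = "\<lambda>t. (1 / \<tau> t) *\<^sub>R (lam *\<^sub>C P t (P0 x) + N t (P0 x) - lam *\<^sub>C P0 x)"
  have "((\<lambda>t. (1 / \<tau> t) *\<^sub>R errP t x + G x) \<longlongrightarrow> 0 + G x) F"
    by (intro tendsto_intros has_order_quotient_tendsto errP_order)
  moreover have "\<forall>\<^sub>F t in F. (1 / \<tau> t) *\<^sub>R errP t x + G x = ?f t"
    using \<tau>_nonzero
    by eventually_elim (simp add: errP_def blinfun.diff_left blinfun.scaleR_left unperturbed.P_idem scaleR_right_diff_distrib)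
  ultimately have f: "(?f \<longlongrightarrow> G x) F"
    by (auto intro: Lim_transform_eventually)
  have "((\<lambda>t. lam *\<^sub>C ?f t + ((1 / \<tau> t) *\<^sub>R errN t x - H x)) \<longlongrightarrow> lam *\<^sub>C G x + (0 - H x)) F"
    by (intro tendsto_intros f has_order_quotient_tendsto errN_order)
  moreover have "\<forall>\<^sub>F t in F. lam *\<^sub>C ?f t + ((1 / \<tau> t) *\<^sub>R errN t x - H x) = ?g t"
    using \<tau>_nonzero
    by eventually_elim (simp add: errN_def blinfun.add_left blinfun.scaleR_left scaleR_right_diff_distrib
        scaleR_right_distrib scaleR_scaleC scaleC_scaleC complex_vector.scale_right_diff_distrib mult.commute algebra_simps)
  ultimately have g: "(?g \<longlongrightarrow> (lam *\<^sub>C G - H) x) F"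
    by (auto intro: Lim_transform_eventually simp: blinfun.diff_left)
  have "\<forall>\<^sub>F t in F. (?f t, ?g t) \<in> Amax"
    using family
  proof eventually_elim
    case (elim t)
    interpret Pt: spectral_data_of_extension A \<Gamma>0 \<Gamma>1 T "Q t" "B t" lam "P t" "N t" "S t" by (rule elim)
    have "(P t (P0 x) - P0 x, lam *\<^sub>C P t (P0 x) + N t (P0 x) - lam *\<^sub>C P0 x) \<in> Amax"
      using subspace_graph_diff[OF sub extension_in_Amax[OF Pt.ext Pt.P_graph[of "P0 x"]]
          extension_in_Amax[OF unperturbed.ext unperturbed.P_graph[of x]]] by simp
    then show ?case
      unfolding scaleR_scaleC by (rule subspace_graph_scale[OF sub])
  qed
  then show "(G x, (lam *\<^sub>C G - H) x) \<in> Amax"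
    by (rule tendsto_op_adjoint[OF nontrivial f g])
qed

lemma clinear_G: "clinear (blinfun_apply G)"
  unfolding G_def
  by (intro clinear_compose clinear_cadjoint unperturbed.clinear_trace_S unperturbed.clinear_trace_P
      Qd_clinear clinear_symplectic_J)

definition errT where "errT t = trace_comp T (P t o\<^sub>L P0) - TP0 - \<tau> t *\<^sub>R trace_comp T G"

text \<open>
  The trace is bounded only in the graph norm.  The graph norm of the remainder of \<open>P\<^sub>t P0\<close> is
  controlled by the remainders of \<open>P\<^sub>t P0\<close> and of \<open>N\<^sub>t P0\<close>, as \<open>A* P\<^sub>t = lam P\<^sub>t + N\<^sub>t\<close>.
\<close>

lemma errT_order: "has_order 2 errT"
proof (rule has_order_dominated)
  show "(\<lambda>t. trace_bound * (norm (errP t) + norm (lam *\<^sub>C errP t + errN t))) \<in> O[F](\<lambda>t. \<tau> t ^ 2)"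
  proof (intro bigo_cmult sum_in_bigo)
    have "has_order 2 (\<lambda>t. lam *\<^sub>C errP t)"
      by (rule has_order_dominated[of _ "\<lambda>t. cmod lam * norm (errP t)"])
         (use errP_order in \<open>auto simp: has_order_def norm_scaleC_blinfun_le intro!: bigo_cmult\<close>)
    from has_order_add[OF this errN_order]
    show "(\<lambda>t. norm (lam *\<^sub>C errP t + errN t)) \<in> O[F](\<lambda>t. \<tau> t ^ 2)" by (simp add: has_order_def)
    show "(\<lambda>t. norm (errP t)) \<in> O[F](\<lambda>t. \<tau> t ^ 2)" using errP_order by (simp add: has_order_def)
  qed
  show "\<forall>\<^sub>F t in F. norm (errT t) \<le> trace_bound * (norm (errP t) + norm (lam *\<^sub>C errP t + errN t))"
    using family
  proof eventually_elim
    case (elim t)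
    interpret Pt: spectral_data_of_extension A \<Gamma>0 \<Gamma>1 T "Q t" "B t" lam "P t" "N t" "S t" by (rule elim)
    note d1 = in_domain_compose[OF Pt.in_domain_P, of P0]
    note d2 = in_domain_diff[OF d1 unperturbed.in_domain_P]
    note d3 = in_domain_scaleR[OF in_domain_G, of "\<tau> t"]
    have "errT t = trace_comp T ((P t o\<^sub>L P0) - P0 - \<tau> t *\<^sub>R G)"
      by (simp add: errT_def trace_comp_diff[OF d2 d3] trace_comp_diff[OF d1 unperturbed.in_domain_P]
          trace_comp_scaleR[OF in_domain_G])
    also have "norm \<dots> \<le> trace_bound * (norm ((P t o\<^sub>L P0) - P0 - \<tau> t *\<^sub>R G) +
        norm (((lam *\<^sub>C P t + N t) o\<^sub>L P0) - (lam *\<^sub>C P0 + 0) - \<tau> t *\<^sub>R (lam *\<^sub>C G - H)))"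
      by (rule norm_trace_comp_le[OF in_domain_diff[OF d2 d3]])
    also have "(P t o\<^sub>L P0) - P0 - \<tau> t *\<^sub>R G = errP t"
      by (rule blinfun_eqI) (simp add: errP_def blinfun.diff_left unperturbed.P_idem)
    also have "((lam *\<^sub>C P t + N t) o\<^sub>L P0) - (lam *\<^sub>C P0 + 0) - \<tau> t *\<^sub>R (lam *\<^sub>C G - H) = lam *\<^sub>C errP t + errN t"
      by (rule blinfun_eqI)
         (simp add: errP_def errN_def blinfun.diff_left blinfun.add_left blinfun.scaleR_left unperturbed.P_idem
           complex_vector.scale_right_diff_distrib scaleR_right_diff_distrib scaleR_scaleC scaleC_scaleC mult.commute)
    finally show ?case .
  qed
qed

definition Wd where "Wd = cadjoint TP0 o\<^sub>L J o\<^sub>L Qd o\<^sub>L TP0"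
definition Wdd where "Wdd = (cadjoint TP0 o\<^sub>L J o\<^sub>L Qdd o\<^sub>L TP0) -
  2 *\<^sub>R (cadjoint (trace_comp T G) o\<^sub>L Qd o\<^sub>L J o\<^sub>L TP0)"

text \<open>
  In \<open>P0 N\<^sub>t P0 = - (T P\<^sub>t P0)* (Q\<^sub>t - Q0) J T P0\<close> the trace is expanded to first order and \<open>Q\<^sub>t\<close> to second
  order.  The constant term of the trace produces \<open>Wd\<close> and the first part of \<open>Wdd\<close>, after \<open>J\<close> is moved to
  the left, which changes the sign.  Its linear term meets the linear term of \<open>Q\<^sub>t\<close> and produces the second
  part of \<open>Wdd\<close>.
\<close>

lemma compression_expansion:
  "(\<lambda>t. norm ((P0 o\<^sub>L N t o\<^sub>L P0) - (\<tau> t *\<^sub>R Wd + ((\<tau> t)\<^sup>2 / 2) *\<^sub>R Wdd))) \<in> o[F](\<lambda>t. (\<tau> t)\<^sup>2)"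
proof -
  let ?G = "cadjoint (trace_comp T G)"
  let ?R1 = "\<lambda>t. cadjoint TP0 o\<^sub>L J o\<^sub>L rem2 t o\<^sub>L TP0"
  let ?R2 = "\<lambda>t. \<tau> t *\<^sub>R (?G o\<^sub>L rem1 t o\<^sub>L J o\<^sub>L TP0)"
  let ?R3 = "\<lambda>t. cadjoint (errT t) o\<^sub>L (Q t - Q0) o\<^sub>L J o\<^sub>L TP0"
  have clin_P: "\<forall>\<^sub>F t in F. clinear (blinfun_apply (trace_comp T (P t o\<^sub>L P0)))"
    using perturbed by eventually_elim (rule perturbed_spectral_data.clinear_trace_P_P0)
  have clin_G: "clinear (blinfun_apply (trace_comp T G))"
    by (rule clinear_trace_comp[OF in_domain_G clinear_G])
  have clin_rG: "clinear (blinfun_apply (a *\<^sub>R trace_comp T G))" for a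
    by (rule clinearI) (simp add: blinfun.scaleR_left clinear_scaleC[OF clin_G] scaleR_scaleC scaleC_scaleC mult.commute)
  have clin_E: "\<forall>\<^sub>F t in F. clinear (blinfun_apply (errT t))"
    using clin_P unfolding errT_def
    by eventually_elim (intro clinear_diff unperturbed.clinear_trace_P clin_rG)
  have eq: "\<forall>\<^sub>F t in F. (P0 o\<^sub>L N t o\<^sub>L P0) - (\<tau> t *\<^sub>R Wd + ((\<tau> t)\<^sup>2 / 2) *\<^sub>R Wdd) = ?R1 t + (- ?R2 t + - ?R3 t)"
    using perturbed clin_E
  proof eventually_elim
    case (elim t)
    interpret pt: perturbed_spectral_data A \<Gamma>0 \<Gamma>1 T Q0 B0 lam P0 S0 "Q t" "B t" "P t" "N t" "S t" by (rule elim)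
    have "trace_comp T (P t o\<^sub>L P0) = TP0 + \<tau> t *\<^sub>R trace_comp T G + errT t" by (simp add: errT_def)
    then have adj: "cadjoint (trace_comp T (P t o\<^sub>L P0)) = cadjoint TP0 + \<tau> t *\<^sub>R ?G + cadjoint (errT t)"
      by (simp add: cadjoint_add cadjoint_diff cadjoint_scaleR unperturbed.clinear_trace_P clin_G clin_rG elim
          clinearI blinfun.add_left clinear_scaleC[OF unperturbed.clinear_trace_P] clinear_scaleC[OF clin_rG] scaleC_add_right)
    have exch: "(Q t - Q0) (J x) = - (J (rem2 t x) + \<tau> t *\<^sub>R J (Qd x) + ((\<tau> t)\<^sup>2 / 2) *\<^sub>R J (Qdd x))" for x
      using pt.J_difference[of x]
      by (simp add: rem2_def blinfun.diff_left blinfun.diff_right blinfun.add_left blinfun.add_right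
          blinfun.scaleR_left blinfun.scaleR_right)
    have rem1: "(Q t - Q0) (J x) = rem1 t (J x) + \<tau> t *\<^sub>R Qd (J x)" for x
      by (simp add: rem1_def blinfun.diff_left blinfun.scaleR_left)
    show ?case
    proof (rule blinfun_eqI)
      fix x
      define y where "y = TP0 x"
      have "(P0 o\<^sub>L N t o\<^sub>L P0) x = - (cadjoint TP0 ((Q t - Q0) (J y)) + \<tau> t *\<^sub>R ?G ((Q t - Q0) (J y))
          + cadjoint (errT t) ((Q t - Q0) (J y)))"
        unfolding pt.compression adj by (simp add: y_def blinfun.minus_left blinfun.add_left blinfun.scaleR_left)
      also have "cadjoint TP0 ((Q t - Q0) (J y)) = - (cadjoint TP0 (J (rem2 t y)) +
          \<tau> t *\<^sub>R cadjoint TP0 (J (Qd y)) + ((\<tau> t)\<^sup>2 / 2) *\<^sub>R cadjoint TP0 (J (Qdd y)))"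
        unfolding exch by (simp add: blinfun.minus_right blinfun.add_right blinfun.scaleR_right blinfun.diff_right)
      also have "?G ((Q t - Q0) (J y)) = ?G (rem1 t (J y)) + \<tau> t *\<^sub>R ?G (Qd (J y))"
        unfolding rem1 by (simp add: blinfun.add_right blinfun.scaleR_right)
      finally show "blinfun_apply ((P0 o\<^sub>L N t o\<^sub>L P0) - (\<tau> t *\<^sub>R Wd + ((\<tau> t)\<^sup>2 / 2) *\<^sub>R Wdd)) x =
          (?R1 t + (- ?R2 t + - ?R3 t)) x"
        by (simp add: Wd_def Wdd_def y_def[symmetric] blinfun.diff_left blinfun.add_left blinfun.minus_left
            blinfun.scaleR_left scaleR_right_diff_distrib scaleR_right_distrib power2_eq_square)
    qed
  qed
  have "has_order 3 ?R2"
    using has_order_scaleR[OF has_order_compose[OF has_order_compose[OF has_order_compose[OF has_order_const rem1_order]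
          has_order_const] has_order_const], of ?G J TP0] by (simp add: numeral_3_eq_3 numeral_2_eq_2)
  moreover have "has_order 3 ?R3"
    using has_order_compose[OF has_order_compose[OF has_order_compose[OF has_order_cadjoint[OF errT_order clin_E] Q_order]
          has_order_const] has_order_const, of J TP0] by (simp add: numeral_3_eq_3 numeral_2_eq_2)
  ultimately have R23: "(\<lambda>t. norm (- ?R2 t + - ?R3 t)) \<in> o[F](\<lambda>t. (\<tau> t)\<^sup>2)"
    by (intro has_order_3_smallo has_order_add has_order_uminus)
  have R1: "(\<lambda>t. norm (?R1 t)) \<in> o[F](\<lambda>t. (\<tau> t)\<^sup>2)"
  proof (rule smallo_dominated)
    show "(\<lambda>t. norm (cadjoint TP0 o\<^sub>L J) * norm (rem2 t) * norm TP0) \<in> o[F](\<lambda>t. (\<tau> t)\<^sup>2)"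
      using Q_expansion by (simp add: rem2_def)
    show "\<forall>\<^sub>F t in F. norm (norm (?R1 t)) \<le> norm (cadjoint TP0 o\<^sub>L J) * norm (rem2 t) * norm TP0"
      by (auto intro!: always_eventually order_trans[OF norm_blinfun_compose] mult_right_mono norm_blinfun_compose)
  qed
  show ?thesis
  proof (rule smallo_dominated)
    show "(\<lambda>t. norm (?R1 t) + norm (- ?R2 t + - ?R3 t)) \<in> o[F](\<lambda>t. (\<tau> t)\<^sup>2)"
      by (rule sum_in_smallo(1)[OF R1 R23])
    show "\<forall>\<^sub>F t in F. norm (norm ((P0 o\<^sub>L N t o\<^sub>L P0) - (\<tau> t *\<^sub>R Wd + ((\<tau> t)\<^sup>2 / 2) *\<^sub>R Wdd))) \<le>
        norm (?R1 t) + norm (- ?R2 t + - ?R3 t)"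
      using eq by eventually_elim (simp only: real_norm_def abs_norm_cancel norm_triangle_ineq)
  qed
qed

definition W where
  "W t = Blinfun (\<lambda>u. blinfun_apply (P0 o\<^sub>L op_inverse (transformation_operator P0 (P t)))
    (op_apply (B t) (blinfun_apply (transformation_operator P0 (P t) o\<^sub>L P0) u)))"

text \<open>
  The compression \<open>P0 N\<^sub>t P0\<close> differs from the exact expression in \<open>W\<close> by a term of third order.
\<close>

lemma transformed_operator_expansion:
  "(\<lambda>t. norm (W t - (lam *\<^sub>C P0 + \<tau> t *\<^sub>R Wd + ((\<tau> t)\<^sup>2 / 2) *\<^sub>R Wdd))) \<in> o[F](\<lambda>t. (\<tau> t)\<^sup>2)"
proof -
  define Z where "Z t = inv_sqrt_one_minus ((P t - P0) o\<^sub>L (P t - P0))" for t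
  define E where "E t = (P0 o\<^sub>L P t o\<^sub>L Z t o\<^sub>L N t o\<^sub>L Z t o\<^sub>L P t o\<^sub>L P0) - (P0 o\<^sub>L N t o\<^sub>L P0)" for t
  let ?C = "\<lambda>t. (P0 o\<^sub>L N t o\<^sub>L P0) - (\<tau> t *\<^sub>R Wd + ((\<tau> t)\<^sup>2 / 2) *\<^sub>R Wdd)"
  have close: "\<forall>\<^sub>F t in F. norm (P t - P0) < 1 / 2"
    by (rule order_tendstoD(2)[OF has_order_tendsto_0[OF P_order]]) simp
  have "has_order 3 E"
  proof (rule has_order_dominated)
    show "\<forall>\<^sub>F t in F. norm (E t) \<le> 6 * (norm (P t - P0))\<^sup>2 * norm (N t)"
      using perturbed close
      by eventually_elim
         (simp add: E_def Z_def perturbed_spectral_data.norm_transformed_operator_difference_le)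
    have "(\<lambda>t. norm (P t - P0) * norm (P t - P0) * norm (N t)) \<in> O[F](\<lambda>t. \<tau> t ^ 1 * \<tau> t ^ 1 * \<tau> t ^ 1)"
      by (intro landau_o.big.mult P_order[unfolded has_order_def] N_order[unfolded has_order_def])
    then show "(\<lambda>t. 6 * (norm (P t - P0))\<^sup>2 * norm (N t)) \<in> O[F](\<lambda>t. \<tau> t ^ 3)"
      by (simp add: power2_eq_square power3_eq_cube mult.assoc)
  qed
  then have "(\<lambda>t. norm (E t)) \<in> o[F](\<lambda>t. (\<tau> t)\<^sup>2)" by (rule has_order_3_smallo)
  then have "(\<lambda>t. norm (E t) + norm (?C t)) \<in> o[F](\<lambda>t. (\<tau> t)\<^sup>2)"
    by (rule sum_in_smallo(1)[OF _ compression_expansion])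
  moreover have "\<forall>\<^sub>F t in F. norm (norm (W t - (lam *\<^sub>C P0 + \<tau> t *\<^sub>R Wd + ((\<tau> t)\<^sup>2 / 2) *\<^sub>R Wdd))) \<le>
      norm (E t) + norm (?C t)"
    using perturbed close
  proof eventually_elim
    case (elim t)
    have "W t = lam *\<^sub>C P0 + (P0 o\<^sub>L P t o\<^sub>L Z t o\<^sub>L N t o\<^sub>L Z t o\<^sub>L P t o\<^sub>L P0)"
      unfolding W_def Z_def
      by (rule perturbed_spectral_data.transformed_operator[OF elim(1)]) (use elim(2) in simp)
    then have "W t - (lam *\<^sub>C P0 + \<tau> t *\<^sub>R Wd + ((\<tau> t)\<^sup>2 / 2) *\<^sub>R Wdd) = E t + ?C t"
      by (simp add: E_def)
    then show ?case by (simp only: real_norm_def abs_norm_cancel norm_triangle_ineq)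
  qed
  ultimately show ?thesis by (rule smallo_dominated[rotated])
qed

end

section \<open>Riesz projections of a family of extensions\<close>

lemma spectral_circle_isolated:
  assumes "lam isolated_in spectrum B"
  shows "\<exists>r>0. spectral_circle B lam = circlepath lam r \<and>
    (\<forall>\<zeta>. 0 < norm (\<zeta> - lam) \<longrightarrow> norm (\<zeta> - lam) < 2 * r \<longrightarrow> \<zeta> \<notin> spectrum B)"
proof (cases "spectrum B - {lam} = {}")
  case True
  then have "\<zeta> \<notin> spectrum B" if "0 < norm (\<zeta> - lam)" for \<zeta> using that by auto
  then show ?thesis using True by (intro exI[of _ 1]) (auto simp: spectral_circle_def)
next
  case False
  define S where "S = spectrum B - {lam}"
  obtain V where V: "open V" "V \<inter> spectrum B = {lam}"
    using assms unfolding isolated_in_def by blast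
  then have "V \<inter> S = {}" "lam \<in> V" by (auto simp: S_def)
  then have "lam \<notin> closure S"
    using open_Int_closure_eq_empty[OF V(1)] by blast
  then have "infdist lam S \<noteq> 0"
    using False in_closure_iff_infdist_zero[of S lam] by (simp add: S_def)
  then have pos: "infdist lam S / 2 > 0" using infdist_nonneg[of lam S] by simp
  have "\<zeta> \<notin> spectrum B" if "0 < norm (\<zeta> - lam)" "norm (\<zeta> - lam) < 2 * (infdist lam S / 2)" for \<zeta>
  proof
    assume "\<zeta> \<in> spectrum B"
    then have "\<zeta> \<in> S" using that(1) by (auto simp: S_def)
    from infdist_le[OF this, of lam] show False using that(2) by (simp add: dist_norm norm_minus_commute)
  qed
  then show ?thesis
    using pos False by (intro exI[of _ "infdist lam S / 2"]) (auto simp: spectral_circle_def S_def)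
qed

text \<open>
  An annulus around the circle, and not only the circle, must remain free of the spectrum of the
  perturbed operators: the idempotence of their Riesz projections is obtained by varying the radius.
\<close>

lemma (in boundary_value_setting) spectral_data_near:
  assumes ext0: "extension Q0 B0" and real: "cnj lam = lam" and r: "0 < r"
    and free: "\<And>\<zeta>. 0 < norm (\<zeta> - lam) \<Longrightarrow> norm (\<zeta> - lam) < 2 * r \<Longrightarrow> \<zeta> \<notin> spectrum B0"
  defines "\<Phi> \<equiv> \<lambda>\<phi>. resolvent_integral (circlepath lam r) \<phi>"
  shows "spectral_data_of_extension A \<Gamma>0 \<Gamma>1 T Q0 B0 lam (\<Phi> (\<lambda>_. 1) B0) 0 (\<Phi> (\<lambda>\<zeta>. inverse (lam - \<zeta>)) B0)" (is ?unp)
    and "\<exists>\<delta>>0. \<exists>M. \<forall>Q B. extension Q B \<longrightarrow> norm (Q - Q0) < \<delta> \<longrightarrow>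
      spectral_data_of_extension A \<Gamma>0 \<Gamma>1 T Q B lam (\<Phi> (\<lambda>_. 1) B) (\<Phi> (\<lambda>\<zeta>. \<zeta> - lam) B)
        (\<Phi> (\<lambda>\<zeta>. inverse (lam - \<zeta>)) B) \<and>
      norm (\<Phi> (\<lambda>_. 1) B - \<Phi> (\<lambda>_. 1) B0) \<le> M * norm (Q - Q0) \<and>
      norm (\<Phi> (\<lambda>\<zeta>. \<zeta> - lam) B) \<le> M * norm (Q - Q0) \<and>
      norm (\<Phi> (\<lambda>\<zeta>. inverse (lam - \<zeta>)) B - \<Phi> (\<lambda>\<zeta>. inverse (lam - \<zeta>)) B0) \<le> M * norm (Q - Q0)"
proof -
  have circ0: "circle_free_of_spectrum B0 lam r"
    by unfold_locales (use extension_self_adjoint[OF ext0] r free in auto)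
  interpret c0: circle_free_of_spectrum B0 lam r by (rule circ0)
  have N0: "\<Phi> (\<lambda>\<zeta>. \<zeta> - lam) B0 = 0"
  proof -
    have "c0.eigennilpotent = 0"
      by (rule c0.eigennilpotent_eq_0[OF real, of "2 * r"]) (use r free in auto)
    then show ?thesis by (simp add: \<Phi>_def c0.eigennilpotent_def)
  qed
  have data: "spectral_data_of_extension A \<Gamma>0 \<Gamma>1 T Q B lam (\<Phi> (\<lambda>_. 1) B) (\<Phi> (\<lambda>\<zeta>. \<zeta> - lam) B)
        (\<Phi> (\<lambda>\<zeta>. inverse (lam - \<zeta>)) B)"
    if "extension Q B" "circle_free_of_spectrum B lam r"
      and "\<And>\<zeta>. r / 2 < norm (\<zeta> - lam) \<Longrightarrow> norm (\<zeta> - lam) < 3 * r / 2 \<Longrightarrow> \<zeta> \<notin> spectrum B" for Q B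
  proof (intro spectral_data_of_extension.intro boundary_value_setting_axioms
      spectral_data_of_extension_axioms.intro that(1))
    show "spectral_data B lam (\<Phi> (\<lambda>_. 1) B) (\<Phi> (\<lambda>\<zeta>. \<zeta> - lam) B) (\<Phi> (\<lambda>\<zeta>. inverse (lam - \<zeta>)) B)"
      unfolding \<Phi>_def
      by (rule spectral_data_resolvent_integrals[OF that(2) real, of "r / 2" "3 * r / 2"])
         (use r that(3) in simp_all)
  qed
  show ?unp
    unfolding N0[symmetric] by (rule data[OF ext0 circ0]) (rule free, use r in auto)
  have free': "\<zeta> \<notin> spectrum B0" if "r / 2 \<le> norm (\<zeta> - lam)" "norm (\<zeta> - lam) \<le> 3 * r / 2" for \<zeta>
  proof (rule free)
    show "0 < norm (\<zeta> - lam)" "norm (\<zeta> - lam) < 2 * r" using that r by linarith+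
  qed
  obtain \<delta> M where \<delta>: "\<delta> > 0" and M: "M \<ge> 0" and near: "\<And>Q B \<zeta>. extension Q B \<Longrightarrow> norm (Q - Q0) < \<delta> \<Longrightarrow>
      r / 2 \<le> norm (\<zeta> - lam) \<Longrightarrow> norm (\<zeta> - lam) \<le> 3 * r / 2 \<Longrightarrow>
      \<zeta> \<notin> spectrum B \<and> norm (resolvent B \<zeta> - resolvent B0 \<zeta>) \<le> norm (Q - Q0) * M"
    using annulus_resolvent_perturbation[OF ext0 real free'] by blast
  (* The weights 1, z - lam and 1 / (lam - z) are bounded on the circle by 1, r and 1 / r. *)
  define M' where "M' = r * ((1 + r + inverse r) * M)"
  have "spectral_data_of_extension A \<Gamma>0 \<Gamma>1 T Q B lam (\<Phi> (\<lambda>_. 1) B) (\<Phi> (\<lambda>\<zeta>. \<zeta> - lam) B)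
        (\<Phi> (\<lambda>\<zeta>. inverse (lam - \<zeta>)) B) \<and>
      norm (\<Phi> (\<lambda>_. 1) B - \<Phi> (\<lambda>_. 1) B0) \<le> M' * norm (Q - Q0) \<and>
      norm (\<Phi> (\<lambda>\<zeta>. \<zeta> - lam) B) \<le> M' * norm (Q - Q0) \<and>
      norm (\<Phi> (\<lambda>\<zeta>. inverse (lam - \<zeta>)) B - \<Phi> (\<lambda>\<zeta>. inverse (lam - \<zeta>)) B0) \<le> M' * norm (Q - Q0)"
    if ext: "extension Q B" and q: "norm (Q - Q0) < \<delta>" for Q B
  proof -
    note nr = near[OF ext q]
    have circ: "circle_free_of_spectrum B lam r"
      by unfold_locales (use extension_self_adjoint[OF ext] nr r in auto)
    have diff: "norm (\<Phi> \<phi> B - \<Phi> \<phi> B0) \<le> M' * norm (Q - Q0)"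
      if "continuous_on (sphere lam r) \<phi>" "\<And>\<zeta>. norm (\<zeta> - lam) = r \<Longrightarrow> cmod (\<phi> \<zeta>) \<le> 1 + r + inverse r" for \<phi>
    proof -
      have "norm (\<Phi> \<phi> B - \<Phi> \<phi> B0) \<le> r * ((1 + r + inverse r) * (norm (Q - Q0) * M))"
        unfolding \<Phi>_def
        by (rule norm_resolvent_integral_diff_le[OF circ circ0 that]) (use nr r in auto)
      then show ?thesis by (simp add: M'_def mult_ac)
    qed
    have "norm (\<Phi> (\<lambda>_. 1) B - \<Phi> (\<lambda>_. 1) B0) \<le> M' * norm (Q - Q0)"
      by (rule diff) (use r in auto)
    moreover have "norm (\<Phi> (\<lambda>\<zeta>. \<zeta> - lam) B - \<Phi> (\<lambda>\<zeta>. \<zeta> - lam) B0) \<le> M' * norm (Q - Q0)"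
      by (rule diff) (use r in \<open>auto intro!: continuous_intros\<close>)
    moreover have "norm (\<Phi> (\<lambda>\<zeta>. inverse (lam - \<zeta>)) B - \<Phi> (\<lambda>\<zeta>. inverse (lam - \<zeta>)) B0) \<le> M' * norm (Q - Q0)"
      by (rule diff) (use r in \<open>auto intro!: continuous_intros simp: norm_inverse norm_minus_commute\<close>)
    moreover have "spectral_data_of_extension A \<Gamma>0 \<Gamma>1 T Q B lam (\<Phi> (\<lambda>_. 1) B) (\<Phi> (\<lambda>\<zeta>. \<zeta> - lam) B)
        (\<Phi> (\<lambda>\<zeta>. inverse (lam - \<zeta>)) B)"
      by (rule data[OF ext circ]) (use nr in auto)
    ultimately show ?thesis by (simp add: N0)
  qed
  with \<delta> show "\<exists>\<delta>>0. \<exists>M. \<forall>Q B. extension Q B \<longrightarrow> norm (Q - Q0) < \<delta> \<longrightarrow>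
      spectral_data_of_extension A \<Gamma>0 \<Gamma>1 T Q B lam (\<Phi> (\<lambda>_. 1) B) (\<Phi> (\<lambda>\<zeta>. \<zeta> - lam) B)
        (\<Phi> (\<lambda>\<zeta>. inverse (lam - \<zeta>)) B) \<and>
      norm (\<Phi> (\<lambda>_. 1) B - \<Phi> (\<lambda>_. 1) B0) \<le> M * norm (Q - Q0) \<and>
      norm (\<Phi> (\<lambda>\<zeta>. \<zeta> - lam) B) \<le> M * norm (Q - Q0) \<and>
      norm (\<Phi> (\<lambda>\<zeta>. inverse (lam - \<zeta>)) B - \<Phi> (\<lambda>\<zeta>. inverse (lam - \<zeta>)) B0) \<le> M * norm (Q - Q0)"
    by blast
qed

theorem theorem2p9:
  fixes A :: "'a :: complex_hilbert operator"
    and \<Gamma>0 \<Gamma>1 :: "'a \<Rightarrow> 'b :: complex_hilbert"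
    and T :: "'a \<Rightarrow> 'b \<times> 'b"
    and J Qd Qdd :: "('b \<times> 'b) \<Rightarrow>\<^sub>L ('b \<times> 'b)"
    and Q :: "real \<Rightarrow> ('b \<times> 'b) \<Rightarrow>\<^sub>L ('b \<times> 'b)"
    and \<A> :: "real \<Rightarrow> 'a operator"
    and t0 :: real and lam :: complex and m :: nat
    and \<gamma> :: "real \<Rightarrow> complex"
    and P U W :: "real \<Rightarrow> 'a \<Rightarrow>\<^sub>L 'a" and S Wd Wdd :: "'a \<Rightarrow>\<^sub>L 'a"
  assumes A: "linear_operator A" "densely_defined A" "symmetric_operator A"
      "equal_deficiency_indices A"
    and T: "boundary_triplet A \<Gamma>0 \<Gamma>1" "T = (\<lambda>u. (\<Gamma>0 u, \<Gamma>1 u))"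
    and J: "J = symplectic_J"
    and t0: "t0 \<in> {0..1}"
    and Q: "\<And>t. t \<in> {0..1} \<Longrightarrow> orthogonal_projection (Q t)"
      "\<And>t. t \<in> {0..1} \<Longrightarrow> lagrangian (range (blinfun_apply (Q t)))"
    and Q_deriv: "clinear (blinfun_apply Qd)" "clinear (blinfun_apply Qdd)"
    and Q_expansion:
      "(\<lambda>t. norm (Q t - (Q t0 + (t - t0) *\<^sub>R Qd + ((t - t0)\<^sup>2 / 2) *\<^sub>R Qdd)))
         \<in> o[at t0 within {0..1}](\<lambda>t. (t - t0)\<^sup>2)"
    and \<A>: "\<And>t. t \<in> {0..1} \<Longrightarrow> self_adjoint (\<A> t)"
      "\<And>t. t \<in> {0..1} \<Longrightarrow> A \<subseteq> \<A> t"
      "\<And>t. t \<in> {0..1} \<Longrightarrow> T ` Domain (\<A> t) = range (blinfun_apply (Q t))"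
    and eigenvalue: "eigenspace (\<A> t0) lam \<noteq> {0}" "lam isolated_in spectrum (\<A> t0)"
    and multiplicity: "m > 0" "complex_vector.dim (eigenspace (\<A> t0) lam) = m"
    and \<gamma>: "\<gamma> = spectral_circle (\<A> t0) lam"
    and P: "\<And>t. P t = riesz_projection \<gamma> (\<A> t)"
    and S: "S = reduced_resolvent \<gamma> (\<A> t0) lam"
    and U: "\<And>t. U t = transformation_operator (P t0) (P t)"
    and W: "\<And>t. W t = Blinfun (\<lambda>u. blinfun_apply (P t0 o\<^sub>L op_inverse (U t))
                                   (op_apply (\<A> t) (blinfun_apply (U t o\<^sub>L P t0) u)))"
    and Wd: "Wd = cadjoint (trace_comp T (P t0)) o\<^sub>L J o\<^sub>L Qd o\<^sub>L trace_comp T (P t0)"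
    and Wdd: "Wdd = (cadjoint (trace_comp T (P t0)) o\<^sub>L J o\<^sub>L Qdd o\<^sub>L trace_comp T (P t0)) -
        2 *\<^sub>R (cadjoint (trace_comp T
                  (cadjoint (trace_comp T S) o\<^sub>L Qd o\<^sub>L J o\<^sub>L trace_comp T (P t0)))
               o\<^sub>L Qd o\<^sub>L J o\<^sub>L trace_comp T (P t0))"
  shows "W t0 = lam *\<^sub>C P t0 \<and>
    (\<lambda>t. norm (W t - (W t0 + (t - t0) *\<^sub>R Wd + ((t - t0)\<^sup>2 / 2) *\<^sub>R Wdd)))
      \<in> o[at t0 within {0..1}](\<lambda>t. (t - t0)\<^sup>2)"
proof -
  interpret boundary_value_setting A \<Gamma>0 \<Gamma>1 T
    by unfold_locales (use A T in auto)
  let ?F = "at t0 within {0..1}"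
  have ext: "extension (Q t) (\<A> t)" if "t \<in> {0..1}" for t
    unfolding extension_def lagrangian_projection_def using that Q \<A> by blast
  note ext0 = ext[OF t0]
  have "(0, 0) \<in> \<A> t0"
    using complex_vector.subspace_0[OF self_adjoint_subspace[OF extension_self_adjoint[OF ext0]]]
    by (simp add: zero_prod_def)
  then have "0 \<in> eigenspace (\<A> t0) lam" by (simp add: eigenspace_def)
  then obtain u where "u \<noteq> 0" "(u, lam *\<^sub>C u) \<in> \<A> t0"
    using eigenvalue(1) unfolding eigenspace_def by blast
  then have real: "cnj lam = lam"
    using self_adjoint_eigenvalue_real extension_self_adjoint[OF ext0] by blast
  obtain r where r: "r > 0" and \<gamma>_eq: "\<gamma> = circlepath lam r"
    and free: "\<And>\<zeta>. 0 < norm (\<zeta> - lam) \<Longrightarrow> norm (\<zeta> - lam) < 2 * r \<Longrightarrow> \<zeta> \<notin> spectrum (\<A> t0)"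
    using spectral_circle_isolated[OF eigenvalue(2)] \<gamma> by blast
  define N where "N t = resolvent_integral \<gamma> (\<lambda>\<zeta>. \<zeta> - lam) (\<A> t)" for t
  define S' where "S' t = resolvent_integral \<gamma> (\<lambda>\<zeta>. inverse (lam - \<zeta>)) (\<A> t)" for t
  have P_eq: "P t = resolvent_integral \<gamma> (\<lambda>_. 1) (\<A> t)" for t
    by (simp add: P riesz_projection_eq)
  have S_eq: "S = S' t0"
    by (simp add: S S'_def reduced_resolvent_eq)
  have unperturbed: "spectral_data_of_extension A \<Gamma>0 \<Gamma>1 T (Q t0) (\<A> t0) lam (P t0) 0 S"
    using spectral_data_near(1)[OF ext0 real r free] by (simp add: P_eq S_eq S'_def \<gamma>_eq)
  obtain \<delta> M where \<delta>: "\<delta> > 0" and near: "\<And>t. t \<in> {0..1} \<Longrightarrow> norm (Q t - Q t0) < \<delta> \<Longrightarrow>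
      spectral_data_of_extension A \<Gamma>0 \<Gamma>1 T (Q t) (\<A> t) lam (P t) (N t) (S' t) \<and>
      norm (P t - P t0) \<le> M * norm (Q t - Q t0) \<and> norm (N t) \<le> M * norm (Q t - Q t0) \<and>
      norm (S' t - S) \<le> M * norm (Q t - Q t0)"
    using spectral_data_near(2)[OF ext0 real r free] ext
    unfolding P_eq S_eq S'_def N_def \<gamma>_eq by blast
  interpret inf: infinitesimal ?F "\<lambda>t. t - t0"
  proof
    show "?F \<noteq> bot" using t0 trivial_limit_within[of t0 "{0..1}"] by simp
    show "\<forall>\<^sub>F t in ?F. t - t0 \<noteq> 0" by (simp add: eventually_at_filter)
    show "((\<lambda>t. t - t0) \<longlongrightarrow> 0) ?F" by (auto intro!: tendsto_eq_intros)
  qed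
  have Q_order: "inf.has_order 1 (\<lambda>t. Q t - Q t0)"
    by (rule inf.Taylor_expansion_orders(2)[OF Q_expansion])
  have "\<forall>\<^sub>F t in ?F. norm (Q t - Q t0) < \<delta>"
    by (rule order_tendstoD(2)[OF inf.has_order_tendsto_0[OF Q_order] \<delta>])
  moreover have "\<forall>\<^sub>F t in ?F. t \<in> {0..1}" by (simp add: eventually_at_filter)
  ultimately have ev: "\<forall>\<^sub>F t in ?F.
      spectral_data_of_extension A \<Gamma>0 \<Gamma>1 T (Q t) (\<A> t) lam (P t) (N t) (S' t) \<and>
      norm (P t - P t0) \<le> M * norm (Q t - Q t0) \<and> norm (N t) \<le> M * norm (Q t - Q t0) \<and>
      norm (S' t - S) \<le> M * norm (Q t - Q t0)"
    by eventually_elim (rule near)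
  have bound_order: "(\<lambda>t. M * norm (Q t - Q t0)) \<in> O[?F](\<lambda>t. (t - t0) ^ 1)"
    using Q_order unfolding inf.has_order_def by (rule bigo_cmult)
  interpret pf: perturbed_family A \<Gamma>0 \<Gamma>1 T "Q t0" "\<A> t0" lam "P t0" S ?F "\<lambda>t. t - t0" Q \<A> P N S' Qd Qdd
  proof (intro perturbed_family.intro perturbed_family_axioms.intro unperturbed real Q_deriv(1) Q_expansion
      boundary_value_setting_axioms inf.infinitesimal_axioms)
    show "\<forall>\<^sub>F t in ?F. spectral_data_of_extension A \<Gamma>0 \<Gamma>1 T (Q t) (\<A> t) lam (P t) (N t) (S' t)"
      using ev by eventually_elim blast
    show "inf.has_order 1 (\<lambda>t. P t - P t0)" "inf.has_order 1 N" "inf.has_order 1 (\<lambda>t. S' t - S)"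
      by (rule inf.has_order_dominated[OF _ bound_order], use ev in eventually_elim, blast)+
  qed
  have W_eq: "W t = pf.W t" for t
    by (simp add: W U pf.W_def)
  (* The factorisation of W holds at t0 as well, where the middle factor N is 0. *)
  have "perturbed_spectral_data A \<Gamma>0 \<Gamma>1 T (Q t0) (\<A> t0) lam (P t0) S (Q t0) (\<A> t0) (P t0) 0 S"
    by (intro perturbed_spectral_data.intro boundary_value_setting_axioms unperturbed
        perturbed_spectral_data_axioms.intro real)
  from perturbed_spectral_data.transformed_operator[OF this]
  have W0: "W t0 = lam *\<^sub>C P t0"
    by (simp add: W_eq pf.W_def)
  moreover have "Wd = pf.Wd" "Wdd = pf.Wdd"
    by (simp_all add: Wd Wdd pf.Wd_def pf.Wdd_def pf.G_def J)
  ultimately show ?thesis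
    using pf.transformed_operator_expansion by (simp add: W_eq)
qed

end
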